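(* Let $\Omega\subset\mathbb{R}^2$ be an open and bounded Lipschitz domain. Let $K:\overline{\Omega}\to\mathbb{R}^{2\times 2}$ be a real symmetric tensor (matrix-valued function) which is continuous throughout the closure $\overline{\Omega}$, with spectral decomposition $K(x,y)=Q(x,y)\Lambda(x,y)Q^T(x,y)$, $Q Q^T=Q^TQ=I$, $\Lambda(x,y)=\mathrm{diag}(\kappa_1(x,y),\kappa_2(x,y))$. Let $\mathcal{L}^{-1}\mathcal{A}:H_0^1(\Omega)\to H_0^1(\Omega)$ be the preconditioned operator associated with $K$. Then $$\mathrm{sp}(\mathcal{L}^{-1}\mathcal{A})=\mathrm{Conv}\big(\kappa_1(\overline{\Omega})\cup\kappa_2(\overline{\Omega})\big),$$ where $$\mathrm{Conv}\big(\kappa_1(\overline{\Omega})\cup\kappa_2(\overline{\Omega})\big)=\Big[\inf_{(x,y)\in\overline{\Omega}}\min_{i=1,2}\kappa_i(x,y),\ \sup_{(x,y)\in\overline{\Omega}}\max_{i=1,2}\kappa_i(x,y)\Big].$$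
   Context: "Domain" means a nonempty connected open set. The operators $\mathcal{L},\mathcal{A}:H_0^1(\Omega)\to H^{-1}(\Omega)$ are defined by $$\langle\mathcal{L}\phi,\psi\rangle=\int_\Omega\nabla\phi\cdot\nabla\psi,\qquad \langle\mathcal{A}\phi,\psi\rangle=\int_\Omega K\nabla\phi\cdot\nabla\psi,\qquad \phi,\psi\in H_0^1(\Omega).$$ $H_0^1(\Omega)$ is equipped with the inner product $(u,v)_{\mathcal{L}}=\langle\mathcal{L}u,v\rangle=\int_\Omega\nabla u\cdot\nabla v$ and the norm $\|u\|_{\mathcal{L}}^2=(u,u)_{\mathcal{L}}$. $\mathcal{L}$ is boundedly invertible, and $\mathcal{L}^{-1}\mathcal{A}$ is a bounded operator on $H_0^1(\Omega)$, self-adjoint with respect to $(\cdot,\cdot)_{\mathcal{L}}$. The spectrum is $$\mathrm{sp}(\mathcal{L}^{-1}\mathcal{A})=\{\lambda\in\mathbb{C}:\ \lambda\mathcal{I}-\mathcal{L}^{-1}\mathcal{A}\ \text{does not have a bounded inverse}\},$$ where for complex $\lambda$ the operator is understood on the complexification of $H_0^1(\Omega)$. No definiteness of $K$ is assumed. The numbers $\kappa_1(x,y),\kappa_2(x,y)$ are the two eigenvalues of $K(x,y)$, and $\kappa_i(\overline{\Omega})=\{\kappa_i(x,y):(x,y)\in\overline{\Omega}\}$. *)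

theory Defs
  imports "HOL-Analysis.Analysis"
begin

section \<open>The Hilbert space of square-integrable functions on the plane\<close>

definition square_integrable :: "(real^2 \<Rightarrow> real) \<Rightarrow> bool" where
  "square_integrable f \<longleftrightarrow> f \<in> borel_measurable lborel \<and> integrable lborel (\<lambda>x. (f x)\<^sup>2)"

lemma square_integrable_zero: "square_integrable (\<lambda>_. 0)"
  by (simp add: square_integrable_def)

lemma square_integrable_mult:
  assumes "square_integrable f" "square_integrable g"
  shows "integrable lborel (\<lambda>x. f x * g x)"
proof (rule Bochner_Integration.integrable_bound)
  show "integrable lborel (\<lambda>x. (f x)\<^sup>2 + (g x)\<^sup>2)"
    using assms by (simp add: square_integrable_def)
  show "(\<lambda>x. f x * g x) \<in> borel_measurable lborel"
    using assms unfolding square_integrable_def by (intro borel_measurable_times) auto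
  have "\<bar>a * b\<bar> \<le> a\<^sup>2 + b\<^sup>2" for a b :: real
  proof -
    have "0 \<le> (\<bar>a\<bar> - \<bar>b\<bar>)\<^sup>2" by simp
    then have "2 * (\<bar>a\<bar> * \<bar>b\<bar>) \<le> a\<^sup>2 + b\<^sup>2" by (simp add: power2_diff)
    moreover have "0 \<le> \<bar>a\<bar> * \<bar>b\<bar>" by simp
    ultimately show ?thesis unfolding abs_mult by linarith
  qed
  then show "AE x in lborel. norm (f x * g x) \<le> norm ((f x)\<^sup>2 + (g x)\<^sup>2)"
    by simp
qed

lemma square_integrable_scale:
  "square_integrable f \<Longrightarrow> square_integrable (\<lambda>x. c * f x)"
  unfolding square_integrable_def power_mult_distrib
  by (intro conjI borel_measurable_times integrable_mult_right) auto

lemma square_integrable_add: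
  assumes "square_integrable f" "square_integrable g"
  shows "square_integrable (\<lambda>x. f x + g x)"
proof -
  have "integrable lborel (\<lambda>x. (f x)\<^sup>2 + (g x)\<^sup>2 + 2 * (f x * g x))"
    using assms square_integrable_mult[OF assms] by (simp add: square_integrable_def)
  moreover have "(\<lambda>x. f x + g x) \<in> borel_measurable lborel"
    using assms unfolding square_integrable_def by (intro borel_measurable_add) auto
  ultimately show ?thesis
    by (simp add: square_integrable_def power2_sum mult.assoc)
qed

lemma square_integrable_uminus: "square_integrable f \<Longrightarrow> square_integrable (\<lambda>x. - f x)"
  using square_integrable_scale[of f "-1"] by simp

lemma square_integrable_diff:
  "square_integrable f \<Longrightarrow> square_integrable g \<Longrightarrow> square_integrable (\<lambda>x. f x - g x)"
  using square_integrable_add[of f "\<lambda>x. - g x"] by (simp add: square_integrable_uminus)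

definition L2_eq :: "(real^2 \<Rightarrow> real) \<Rightarrow> (real^2 \<Rightarrow> real) \<Rightarrow> bool" where
  "L2_eq f g \<longleftrightarrow> square_integrable f \<and> square_integrable g \<and> (AE x in lborel. f x = g x)"

quotient_type L2 = "real^2 \<Rightarrow> real" / partial: L2_eq
  morphisms rep_L2 abs_L2
proof (rule part_equivpI)
  show "\<exists>f. L2_eq f f"
    using square_integrable_zero by (auto simp: L2_eq_def)
  show "symp L2_eq"
    by (rule sympI) (auto simp: L2_eq_def)
  show "transp L2_eq"
    by (rule transpI) (auto simp: L2_eq_def elim: eventually_elim2)
qed

instantiation L2 :: real_inner
begin

lift_definition zero_L2 :: L2 is "\<lambda>_. 0"
  by (simp add: L2_eq_def square_integrable_zero)

lift_definition plus_L2 :: "L2 \<Rightarrow> L2 \<Rightarrow> L2" is "\<lambda>f g x. f x + g x"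
  by (auto simp: L2_eq_def square_integrable_add elim: eventually_elim2)

lift_definition minus_L2 :: "L2 \<Rightarrow> L2 \<Rightarrow> L2" is "\<lambda>f g x. f x - g x"
  by (auto simp: L2_eq_def square_integrable_diff elim: eventually_elim2)

lift_definition uminus_L2 :: "L2 \<Rightarrow> L2" is "\<lambda>f x. - f x"
  by (auto simp: L2_eq_def square_integrable_uminus elim: eventually_mono)

lift_definition scaleR_L2 :: "real \<Rightarrow> L2 \<Rightarrow> L2" is "\<lambda>c f x. c * f x"
  by (auto simp: L2_eq_def square_integrable_scale elim: eventually_mono)

lift_definition inner_L2 :: "L2 \<Rightarrow> L2 \<Rightarrow> real" is "\<lambda>f g. LINT x|lborel. f x * g x"
proof -
  fix f f' g g' :: "real^2 \<Rightarrow> real"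
  assume *: "L2_eq f f'" "L2_eq g g'"
  show "(LINT x|lborel. f x * g x) = (LINT x|lborel. f' x * g' x)"
  proof (rule integral_cong_AE)
    show "AE x in lborel. f x * g x = f' x * g' x"
      using * by (auto simp: L2_eq_def elim: eventually_elim2)
  qed (use * in \<open>auto simp: L2_eq_def square_integrable_def\<close>)
qed

definition norm_L2 :: "L2 \<Rightarrow> real" where "norm_L2 u = sqrt (inner u u)"
definition sgn_L2 :: "L2 \<Rightarrow> L2" where "sgn_L2 u = inverse (norm u) *\<^sub>R u"
definition dist_L2 :: "L2 \<Rightarrow> L2 \<Rightarrow> real" where "dist_L2 u v = norm (u - v)"
definition uniformity_L2 :: "(L2 \<times> L2) filter" where
  "uniformity_L2 = (INF e\<in>{0<..}. principal {(u, v). dist u v < e})"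
definition open_L2 :: "L2 set \<Rightarrow> bool" where
  "open_L2 U \<longleftrightarrow> (\<forall>u\<in>U. \<forall>\<^sub>F (u', v) in uniformity. u' = u \<longrightarrow> v \<in> U)"

instance
proof
  fix u v w :: L2 and a b :: real and U :: "L2 set"
  show "u + v + w = u + (v + w)"
    by transfer (auto simp: L2_eq_def algebra_simps square_integrable_add)
  show "u + v = v + u"
    by transfer (auto simp: L2_eq_def algebra_simps square_integrable_add)
  show "0 + u = u"
    by transfer (auto simp: L2_eq_def)
  show "- u + u = 0"
    by transfer (auto simp: L2_eq_def square_integrable_zero)
  show "u - v = u + - v"
    by transfer (auto simp: L2_eq_def square_integrable_diff)
  show "a *\<^sub>R (u + v) = a *\<^sub>R u + a *\<^sub>R v"
    by transfer (auto simp: L2_eq_def distrib_left square_integrable_add square_integrable_scale)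
  show "(a + b) *\<^sub>R u = a *\<^sub>R u + b *\<^sub>R u"
    by transfer (auto simp: L2_eq_def distrib_right square_integrable_add square_integrable_scale)
  show "a *\<^sub>R b *\<^sub>R u = (a * b) *\<^sub>R u"
    by transfer (auto simp: L2_eq_def mult.assoc square_integrable_scale)
  show "1 *\<^sub>R u = u"
    by transfer (auto simp: L2_eq_def)
  show "dist u v = norm (u - v)" by (rule dist_L2_def)
  show "sgn u = inverse (norm u) *\<^sub>R u" by (rule sgn_L2_def)
  show "uniformity = (INF e\<in>{0<..}. principal {(u::L2, v). dist u v < e})"
    by (rule uniformity_L2_def)
  show "open U \<longleftrightarrow> (\<forall>u\<in>U. \<forall>\<^sub>F (u', v) in uniformity. u' = u \<longrightarrow> v \<in> U)"
    by (rule open_L2_def)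
  show "inner u v = inner v u"
    by transfer (simp add: mult.commute)
  show "inner (u + v) w = inner u w + inner v w"
    by transfer (simp add: L2_eq_def distrib_right square_integrable_mult)
  show "inner (a *\<^sub>R u) v = a * inner u v"
    by transfer (simp add: mult.assoc)
  show "0 \<le> inner u u"
    by transfer simp
  show "inner u u = 0 \<longleftrightarrow> u = 0"
  proof transfer
    fix f assume "L2_eq f f"
    then have f: "square_integrable f" by (simp add: L2_eq_def)
    then have "(LINT x|lborel. f x * f x) = 0 \<longleftrightarrow> (AE x in lborel. f x * f x = 0)"
      by (intro integral_nonneg_eq_0_iff_AE) (auto intro: square_integrable_mult)
    then show "(LINT x|lborel. f x * f x) = 0 \<longleftrightarrow> L2_eq f (\<lambda>_. 0)"
      using f by (simp add: L2_eq_def square_integrable_zero)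
  qed
  show "norm u = sqrt (inner u u)" by (rule norm_L2_def)
qed

end

lemma square_integrable_rep_L2: "square_integrable (rep_L2 u)"
  using Quotient3_rep_reflp[OF Quotient3_L2, of u] by (simp add: L2_eq_def)

lemma rep_abs_L2: "square_integrable f \<Longrightarrow> AE x in lborel. rep_L2 (abs_L2 f) x = f x"
  using rep_abs_rsp_left[OF Quotient3_L2, of f f] by (simp add: L2_eq_def)

lemma abs_rep_L2: "abs_L2 (rep_L2 u) = u"
  using Quotient3_abs_rep[OF Quotient3_L2] .


section \<open>Sobolev spaces\<close>

definition partial_deriv :: "2 \<Rightarrow> (real^2 \<Rightarrow> real) \<Rightarrow> real^2 \<Rightarrow> real" where
  "partial_deriv i f x = frechet_derivative f (at x) (axis i 1)"

primrec C_diff :: "nat \<Rightarrow> (real^2 \<Rightarrow> real) \<Rightarrow> bool" where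
  "C_diff 0 f \<longleftrightarrow> continuous_on UNIV f"
| "C_diff (Suc k) f \<longleftrightarrow> (\<forall>x. f differentiable (at x)) \<and> (\<forall>i. C_diff k (partial_deriv i f))"

definition test_functions :: "(real^2) set \<Rightarrow> (real^2 \<Rightarrow> real) set" where
  "test_functions \<Omega> =
     {\<phi>. (\<forall>k. C_diff k \<phi>) \<and> compact (closure {x. \<phi> x \<noteq> 0}) \<and> closure {x. \<phi> x \<noteq> 0} \<subseteq> \<Omega>}"

text \<open>Functions on \<open>\<Omega>\<close> are represented by their extension by zero.\<close>

definition L2_on :: "(real^2) set \<Rightarrow> L2 set" where
  "L2_on \<Omega> = {u. AE x in lborel. x \<notin> \<Omega> \<longrightarrow> rep_L2 u x = 0}"

definition is_weak_gradient :: "(real^2) set \<Rightarrow> L2 \<Rightarrow> L2^2 \<Rightarrow> bool" where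
  "is_weak_gradient \<Omega> u g \<longleftrightarrow>
     (\<forall>i. g $ i \<in> L2_on \<Omega>) \<and>
     (\<forall>\<phi>\<in>test_functions \<Omega>. \<forall>i.
        (LINT x:\<Omega>|lborel. rep_L2 u x * partial_deriv i \<phi> x) =
        - (LINT x:\<Omega>|lborel. rep_L2 (g $ i) x * \<phi> x))"

definition H1 :: "(real^2) set \<Rightarrow> L2 set" where
  "H1 \<Omega> = {u \<in> L2_on \<Omega>. \<exists>g. is_weak_gradient \<Omega> u g}"

definition weak_gradient :: "(real^2) set \<Rightarrow> L2 \<Rightarrow> L2^2" where
  "weak_gradient \<Omega> u = (THE g. is_weak_gradient \<Omega> u g)"

definition H1_norm :: "(real^2) set \<Rightarrow> L2 \<Rightarrow> real" where
  "H1_norm \<Omega> u = sqrt ((norm u)\<^sup>2 + (norm (weak_gradient \<Omega> u))\<^sup>2)"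

definition H01 :: "(real^2) set \<Rightarrow> L2 set" where
  "H01 \<Omega> = {u \<in> H1 \<Omega>. \<forall>e>0. \<exists>\<phi>\<in>test_functions \<Omega>. H1_norm \<Omega> (u - abs_L2 \<phi>) < e}"

definition grad :: "(real^2) set \<Rightarrow> L2 \<Rightarrow> real^2 \<Rightarrow> real^2" where
  "grad \<Omega> u x = (\<chi> i. rep_L2 (weak_gradient \<Omega> u $ i) x)"


section \<open>The operators\<close>

text \<open>Functionals on \<open>H01 \<Omega>\<close> are made extensional, so that the operators below are equal as
  functions iff they are equal as functionals on \<open>H01 \<Omega>\<close>.\<close>

definition op_A :: "(real^2) set \<Rightarrow> (real^2 \<Rightarrow> real^2^2) \<Rightarrow> L2 \<Rightarrow> L2 \<Rightarrow> real" where
  "op_A \<Omega> K u = (\<lambda>v\<in>H01 \<Omega>. LINT x:\<Omega>|lborel. (K x *v grad \<Omega> u x) \<bullet> grad \<Omega> v x)"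

definition op_L :: "(real^2) set \<Rightarrow> L2 \<Rightarrow> L2 \<Rightarrow> real" where
  "op_L \<Omega> u = (\<lambda>v\<in>H01 \<Omega>. LINT x:\<Omega>|lborel. grad \<Omega> u x \<bullet> grad \<Omega> v x)"

definition norm_L :: "(real^2) set \<Rightarrow> L2 \<Rightarrow> real" where
  "norm_L \<Omega> u = sqrt (op_L \<Omega> u u)"

definition precond_op :: "(real^2) set \<Rightarrow> (real^2 \<Rightarrow> real^2^2) \<Rightarrow> L2 \<Rightarrow> L2" where
  "precond_op \<Omega> K u = the_inv_into (H01 \<Omega>) (op_L \<Omega>) (op_A \<Omega> K u)"


section \<open>Spectrum of an operator on the complexification of a real normed space\<close>

text \<open>The complexification of a real space \<open>H\<close> is \<open>H \<times> H\<close>, the pair \<open>(u, v)\<close> standing for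
  \<open>u + \<i> v\<close>.  The norm of \<open>H\<close> is an argument \<open>N\<close>, as it need not be the norm of the ambient
  type; the Hermitian extension of an inner product gives the norm \<open>cplx_norm N\<close>.\<close>

definition cplx_scale :: "complex \<Rightarrow> 'a::real_vector \<times> 'a \<Rightarrow> 'a \<times> 'a" where
  "cplx_scale c w =
     (Re c *\<^sub>R fst w - Im c *\<^sub>R snd w, Re c *\<^sub>R snd w + Im c *\<^sub>R fst w)"

definition cplx_norm :: "('a \<Rightarrow> real) \<Rightarrow> 'a \<times> 'a \<Rightarrow> real" where
  "cplx_norm N w = sqrt ((N (fst w))\<^sup>2 + (N (snd w))\<^sup>2)"

definition bounded_cplx_operator ::
    "('a::real_vector \<times> 'a) set \<Rightarrow> ('a \<times> 'a \<Rightarrow> real) \<Rightarrow> ('a \<times> 'a \<Rightarrow> 'a \<times> 'a) \<Rightarrow> bool" where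
  "bounded_cplx_operator V N S \<longleftrightarrow>
     (\<forall>w\<in>V. S w \<in> V) \<and>
     (\<forall>w\<in>V. \<forall>z\<in>V. S (w + z) = S w + S z) \<and>
     (\<forall>c. \<forall>w\<in>V. S (cplx_scale c w) = cplx_scale c (S w)) \<and>
     (\<exists>C. \<forall>w\<in>V. N (S w) \<le> C * N w)"

definition has_bounded_inverse ::
    "('a::real_vector \<times> 'a) set \<Rightarrow> ('a \<times> 'a \<Rightarrow> real) \<Rightarrow> ('a \<times> 'a \<Rightarrow> 'a \<times> 'a) \<Rightarrow> bool" where
  "has_bounded_inverse V N S \<longleftrightarrow>
     (\<exists>R. bounded_cplx_operator V N R \<and> (\<forall>w\<in>V. S w \<in> V \<and> R (S w) = w \<and> S (R w) = w))"

definition spectrum :: "'a::real_vector set \<Rightarrow> ('a \<Rightarrow> real) \<Rightarrow> ('a \<Rightarrow> 'a) \<Rightarrow> complex set" where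
  "spectrum H N T =
     {z. \<not> has_bounded_inverse (H \<times> H) (cplx_norm N)
              (\<lambda>w. cplx_scale z w - map_prod T T w)}"


section \<open>Lipschitz domains\<close>

text \<open>Near each boundary point, after an orthogonal change of coordinates, the set is the part
  of a ball lying above the graph of a Lipschitz function.\<close>

definition lipschitz_domain :: "(real^2) set \<Rightarrow> bool" where
  "lipschitz_domain \<Omega> \<longleftrightarrow>
     open \<Omega> \<and> connected \<Omega> \<and> \<Omega> \<noteq> {} \<and>
     (\<forall>p\<in>frontier \<Omega>. \<exists>r>0. \<exists>R :: real^2 \<Rightarrow> real^2. \<exists>\<gamma>::real \<Rightarrow> real. \<exists>C.
        orthogonal_transformation R \<and> C-lipschitz_on UNIV \<gamma> \<and>
        \<Omega> \<inter> ball p r = {x \<in> ball p r. \<gamma> (R x $ 1) < R x $ 2})"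

end

theory Submission
  imports Defs "HOL-Computational_Algebra.Polynomial" "HOL-Real_Asymp.Real_Asymp"
begin

text \<open>The gradient is an isometry from \<open>H01 \<Omega>\<close> with the norm \<open>norm_L \<Omega>\<close> onto a closed subspace \<open>G\<close> of
\<open>L2^2\<close>: it is injective with complete range by the Poincare inequality.  Under this isometry the
preconditioned operator becomes \<open>g \<mapsto> P (K g)\<close> on \<open>G\<close>, where \<open>P\<close> is the orthogonal projection onto
\<open>G\<close> (\<open>inner_precond_op\<close>); it is self-adjoint, and its quadratic form is the integral of
\<open>(K \<nabla>u) \<bullet> \<nabla>u\<close>.

Let \<open>{a..b}\<close> be the set of all values \<open>(K x *v \<theta>) \<bullet> \<theta>\<close> with \<open>x\<close> in the closure of \<open>\<Omega>\<close> and \<open>\<theta>\<close> a unit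
vector.  It is an interval because it is a continuous image of a compact connected set, and since
a value \<open>(K x *v \<theta>) \<bullet> \<theta>\<close> is a convex combination of the two eigenvalues of \<open>K x\<close>, this interval is the
convex hull of the ranges of the eigenvalues.

The spectrum lies in \<open>{a..b}\<close>: the quadratic form is between \<open>a\<close> and \<open>b\<close> times the squared norm, and
outside such bounds a self-adjoint operator has a bounded resolvent
(\<open>has_bounded_inverse_outside_numerical_range\<close>).

Conversely every \<open>l = (K x0 *v \<theta>) \<bullet> \<theta>\<close> is in the spectrum, because it is an approximate eigenvalue
(\<open>approximate_eigenvector\<close>).  Near \<open>x0\<close> the coefficient is almost the constant matrix \<open>A = K x0\<close>.  For a
smooth \<open>u\<close> with compact support, two integrations by parts give
\<open>\<integral> \<partial>\<^sub>i u \<partial>\<^sub>j v = \<integral> \<partial>\<^sub>j u \<partial>\<^sub>i v\<close>; if \<open>\<tau>\<close> is a unit vector orthogonal to \<open>\<theta>\<close>, this allows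
\<open>\<integral> (A \<nabla>u - l \<nabla>u) \<bullet> \<nabla>v\<close> to be rewritten so that every term contains the derivative of \<open>u\<close> in direction
\<open>\<tau>\<close>.  So it suffices to find \<open>u\<close>, supported near \<open>x0\<close>, whose derivative in direction \<open>\<tau>\<close> is small
compared to its derivative in direction \<open>\<theta>\<close>, and a wave packet \<open>\<eta> x * sin (N * (\<theta> \<bullet> x))\<close> or
\<open>\<eta> x * cos (N * (\<theta> \<bullet> x))\<close> with large \<open>N\<close> has this property (\<open>wave_packet\<close>).

The rest is infrastructure: \<open>L2\<close> is complete; products of translated and scaled copies of
\<open>exp (- 1 / t)\<close> provide enough test functions for weak gradients to be unique; and the integral of
\<open>\<partial>\<^sub>i f\<close> vanishes for compactly supported \<open>f\<close>, from which integration by parts and the Poincare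
inequality follow.\<close>

section \<open>Complete subspaces of inner product spaces\<close>

text \<open>A minimising sequence for the distance from \<open>h\<close> to \<open>S\<close> is Cauchy by the parallelogram identity; its
limit is the projection.\<close>

lemma orthogonal_projection_exists:
  fixes S :: "'a::real_inner set"
  assumes S: "subspace S" "complete S"
  shows "\<exists>p\<in>S. \<forall>v\<in>S. inner h v = inner p v"
proof -
  let ?q = "\<lambda>v. (norm (h - v))\<^sup>2"
  define D where "D = (INF v\<in>S. ?q v)"
  have bdd: "bdd_below (?q ` S)" by (rule bdd_belowI[of _ 0]) auto
  have ne: "S \<noteq> {}" using subspace_0[OF S(1)] by auto
  have D_le: "D \<le> ?q v" if "v \<in> S" for v
    unfolding D_def using bdd that by (rule cINF_lower)
  have "\<exists>v\<in>S. ?q v < D + 1 / real (Suc n)" for n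
  proof -
    have "Inf (?q ` S) < D + 1 / real (Suc n)" unfolding D_def by simp
    then show ?thesis using cInf_lessD[of "?q ` S"] ne by auto
  qed
  then obtain v where v: "\<And>n. v n \<in> S" "\<And>n. ?q (v n) < D + 1 / real (Suc n)"
    by metis
  have par: "(norm (v n - v m))\<^sup>2 \<le> 2 / real (Suc n) + 2 / real (Suc m)" for n m
  proof -
    let ?w = "(1/2) *\<^sub>R (v n + v m)"
    have "?w \<in> S" using S(1) v(1) by (simp add: subspace_scale subspace_add)
    from D_le[OF this] have "D \<le> ?q ?w" .
    moreover have "(norm (v n - v m))\<^sup>2 = 2 * ?q (v n) + 2 * ?q (v m) - 4 * ?q ?w"
      by (simp add: power2_norm_eq_inner inner_diff_left inner_diff_right inner_add_left
          inner_add_right inner_commute algebra_simps)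
    ultimately show ?thesis using v(2)[of n] v(2)[of m] by simp
  qed
  have "Cauchy v"
  proof (rule metric_CauchyI)
    fix e :: real assume e: "e > 0"
    obtain N :: nat where N: "4 / e\<^sup>2 < real N" using reals_Archimedean2 by blast
    have "dist (v n) (v m) < e" if "n \<ge> N" "m \<ge> N" for n m
    proof -
      have pos: "real N > 0" using N e by (meson divide_pos_pos less_trans zero_less_numeral zero_less_power)
      have "2 / real (Suc k) < e\<^sup>2 / 2" if "k \<ge> N" for k
      proof -
        have "2 / real (Suc k) < 2 / real N"
          using pos that by (intro divide_strict_left_mono) auto
        also have "\<dots> < e\<^sup>2 / 2" using N e pos by (simp add: field_simps)
        finally show ?thesis .
      qed
      then have "(norm (v n - v m))\<^sup>2 < e\<^sup>2" using par[of n m] that by (smt (verit) field_sum_of_halves)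
      then show ?thesis using e by (simp add: dist_norm power2_less_imp_less)
    qed
    then show "\<exists>M. \<forall>m\<ge>M. \<forall>n\<ge>M. dist (v m) (v n) < e" by blast
  qed
  then obtain p where p: "p \<in> S" "v \<longlonglongrightarrow> p" using S(2) v(1) unfolding complete_def by blast
  have "(\<lambda>n. ?q (v n)) \<longlonglongrightarrow> ?q p" using p(2) by (intro tendsto_intros)
  moreover have "(\<lambda>n. D + 1 / real (Suc n)) \<longlonglongrightarrow> D + 0"
    by (intro tendsto_intros LIMSEQ_Suc lim_1_over_n)
  ultimately have qp: "?q p \<le> D"
    using v(2) by (intro LIMSEQ_le[of "\<lambda>n. ?q (v n)" _ "\<lambda>n. D + 1 / real (Suc n)"]) (auto intro: less_imp_le)
  have "inner h w = inner p w" if w: "w \<in> S" for w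
  proof (cases "w = 0")
    case False
    \<comment> \<open>\<open>p + t *\<^sub>R w\<close> is the point nearest to \<open>h\<close> on the line through \<open>p\<close> in direction \<open>w\<close>\<close>
    define t where "t = inner (h - p) w / (norm w)\<^sup>2"
    have "p + t *\<^sub>R w \<in> S" using S(1) p(1) w by (simp add: subspace_scale subspace_add)
    from qp D_le[OF this] have "?q p \<le> ?q (p + t *\<^sub>R w)" by (rule order_trans)
    also have "\<dots> = ?q p - 2 * t * inner (h - p) w + t\<^sup>2 * (norm w)\<^sup>2"
      unfolding power2_norm_eq_inner power2_eq_square[of t]
      by (simp add: inner_diff_left inner_diff_right inner_add_left inner_add_right
          inner_commute algebra_simps)
    also have "\<dots> = ?q p - (inner (h - p) w)\<^sup>2 / (norm w)\<^sup>2"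
      using False by (simp add: t_def field_simps power2_eq_square)
    finally have "(inner (h - p) w)\<^sup>2 / (norm w)\<^sup>2 \<le> 0" by simp
    then show ?thesis using False by (simp add: divide_le_0_iff inner_diff_left)
  qed simp
  with p(1) show ?thesis by blast
qed

text \<open>A Lax-Milgram theorem, by Banach's fixed point theorem for \<open>g \<mapsto> g - t *\<^sub>R (D g - f)\<close>.\<close>

lemma coercive_solvable:
  fixes S :: "'a::real_inner set"
  assumes S: "subspace S" "complete S"
    and DS: "\<And>g. g \<in> S \<Longrightarrow> D g \<in> S"
    and Dd: "\<And>g g'. g \<in> S \<Longrightarrow> g' \<in> S \<Longrightarrow> D (g - g') = D g - D g'"
    and DC: "\<And>g. g \<in> S \<Longrightarrow> norm (D g) \<le> C * norm g"
    and c: "c > 0" and Dc: "\<And>g. g \<in> S \<Longrightarrow> c * (norm g)\<^sup>2 \<le> inner (D g) g"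
    and f: "f \<in> S"
  shows "\<exists>g\<in>S. D g = f"
proof -
  define B where "B = \<bar>C\<bar> + c"
  have B: "B > 0" "c \<le> B" using c by (auto simp: B_def)
  have DB: "norm (D g) \<le> B * norm g" if "g \<in> S" for g
  proof -
    have "C * norm g \<le> B * norm g" unfolding B_def using c by (intro mult_right_mono) auto
    then show ?thesis using DC[OF that] by simp
  qed
  \<comment> \<open>the minimiser of the squared Lipschitz constant \<open>1 - 2 * t * c + t\<^sup>2 * B\<^sup>2\<close>\<close>
  define t where "t = c / B\<^sup>2"
  have t: "t > 0" using c B by (simp add: t_def)
  define q where "q = 1 - c\<^sup>2 / B\<^sup>2"
  have q: "0 \<le> q" "q < 1" using c B by (auto simp: q_def power_mono divide_le_eq_1)
  define F where "F g = g - t *\<^sub>R (D g - f)" for g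
  have "\<exists>!g\<in>S. F g = g"
  proof (rule Banach_fix[where c = "sqrt q"])
    show "S \<noteq> {}" using f by auto
    show "F ` S \<subseteq> S" unfolding F_def using S(1) f DS by (auto intro!: subspace_diff subspace_scale)
    fix g g' assume g: "g \<in> S" "g' \<in> S"
    define w where "w = g - g'"
    have w: "w \<in> S" using g S(1) by (simp add: w_def subspace_diff)
    have Fw: "F g - F g' = w - t *\<^sub>R D w"
      using Dd[OF g] by (simp add: F_def w_def scaleR_diff_right)
    have "(norm (F g - F g'))\<^sup>2 = (norm w)\<^sup>2 - 2 * t * inner (D w) w + t\<^sup>2 * (norm (D w))\<^sup>2"
      unfolding Fw power2_norm_eq_inner power2_eq_square[of t]
      by (simp add: inner_diff_left inner_diff_right inner_commute algebra_simps)
    also have "\<dots> \<le> (norm w)\<^sup>2 - 2 * t * (c * (norm w)\<^sup>2) + t\<^sup>2 * (B * norm w)\<^sup>2"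
      using Dc[OF w] DB[OF w] t
      by (intro add_mono diff_mono mult_left_mono power_mono) auto
    also have "\<dots> = q * (norm w)\<^sup>2"
      using B by (simp add: q_def t_def field_simps power2_eq_square)
    finally have "norm (F g - F g') \<le> sqrt q * norm w"
      using q by - (rule power2_le_imp_le, simp_all add: power_mult_distrib)
    then show "dist (F g) (F g') \<le> sqrt q * dist g g'" by (simp add: dist_norm w_def)
  qed (use q S in auto)
  then obtain g where "g \<in> S" "F g = g" by blast
  then show ?thesis using t by (auto simp: F_def)
qed

text \<open>For \<open>z = a + \<i> b\<close> and \<open>A = a - T\<close> one has \<open>(A + \<i> b) (A - \<i> b) = A\<^sup>2 + b\<^sup>2\<close>, an operator on the
real space which is coercive as soon as \<open>b \<noteq> 0\<close> or \<open>A\<close> is bounded below.  Hence it has a bounded inverse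
\<open>E\<close>, and \<open>E (A - \<i> b)\<close> is the resolvent.  The Hilbert space structure enters through the map \<open>J\<close>
into an inner product space, so that the norm of \<open>H\<close> may differ from that of the ambient type.\<close>

lemma has_bounded_inverse_outside_numerical_range:
  fixes H :: "'a::real_vector set" and J :: "'a \<Rightarrow> 'b::real_inner" and T :: "'a \<Rightarrow> 'a"
  assumes H: "subspace H"
    and Ja: "\<And>u v. u \<in> H \<Longrightarrow> v \<in> H \<Longrightarrow> J (u + v) = J u + J v"
    and Js: "\<And>c u. u \<in> H \<Longrightarrow> J (c *\<^sub>R u) = c *\<^sub>R J u"
    and Ji: "inj_on J H" and JH: "complete (J ` H)"
    and N: "\<And>u. u \<in> H \<Longrightarrow> N u = norm (J u)"
    and TH: "\<And>u. u \<in> H \<Longrightarrow> T u \<in> H"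
    and Ta: "\<And>u v. u \<in> H \<Longrightarrow> v \<in> H \<Longrightarrow> T (u + v) = T u + T v"
    and Ts: "\<And>c u. u \<in> H \<Longrightarrow> T (c *\<^sub>R u) = c *\<^sub>R T u"
    and TC: "\<And>u. u \<in> H \<Longrightarrow> norm (J (T u)) \<le> C * norm (J u)"
    and sym: "\<And>u v. u \<in> H \<Longrightarrow> v \<in> H \<Longrightarrow> inner (J (T u)) (J v) = inner (J u) (J (T v))"
    and lo: "\<And>u. u \<in> H \<Longrightarrow> m * (norm (J u))\<^sup>2 \<le> inner (J (T u)) (J u)"
    and hi: "\<And>u. u \<in> H \<Longrightarrow> inner (J (T u)) (J u) \<le> M * (norm (J u))\<^sup>2"
    and z: "\<not> (Im z = 0 \<and> m \<le> Re z \<and> Re z \<le> M)"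
  shows "has_bounded_inverse (H \<times> H) (cplx_norm N) (\<lambda>w. cplx_scale z w - map_prod T T w)"
proof -
  define a where "a = Re z"
  define b where "b = Im z"
  define A where "A u = a *\<^sub>R u - T u" for u
  define D where "D u = A (A u) + b\<^sup>2 *\<^sub>R u" for u
  note sub = subspace_add[OF H] subspace_diff[OF H] subspace_scale[OF H] subspace_neg[OF H]
  have Jd: "J (u - v) = J u - J v" if "u \<in> H" "v \<in> H" for u v
    using Ja[of u "(-1) *\<^sub>R v"] Js[of v "-1"] that sub by simp
  have Td: "T (u - v) = T u - T v" if "u \<in> H" "v \<in> H" for u v
    using Ta[of u "(-1) *\<^sub>R v"] Ts[of v "-1"] that sub by simp
  have AH: "A u \<in> H" if "u \<in> H" for u using that by (simp add: A_def sub TH)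
  have Aa: "A (u + v) = A u + A v" if "u \<in> H" "v \<in> H" for u v
    using that by (simp add: A_def Ta scaleR_add_right)
  have Ad: "A (u - v) = A u - A v" if "u \<in> H" "v \<in> H" for u v
    using that by (simp add: A_def Td scaleR_diff_right)
  have As: "A (c *\<^sub>R u) = c *\<^sub>R A u" if "u \<in> H" for c u
    using that by (simp add: A_def Ts scaleR_diff_right)
  have DH: "D u \<in> H" if "u \<in> H" for u using that by (simp add: D_def sub AH)
  have Da: "D (u + v) = D u + D v" if "u \<in> H" "v \<in> H" for u v
    using that by (simp add: D_def Aa AH scaleR_add_right)
  have Dd: "D (u - v) = D u - D v" if "u \<in> H" "v \<in> H" for u v
    using that by (simp add: D_def Ad AH scaleR_diff_right)
  have Ds: "D (c *\<^sub>R u) = c *\<^sub>R D u" if "u \<in> H" for c u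
    using that by (simp add: D_def As AH scaleR_add_right)
  have AD: "A (D u) = D (A u)" if "u \<in> H" for u
    using that by (simp add: D_def Aa As AH sub)
  have JA: "J (A u) = a *\<^sub>R J u - J (T u)" if "u \<in> H" for u
    using that by (simp add: A_def Jd Js TH sub)
  have JD: "J (D u) = J (A (A u)) + b\<^sup>2 *\<^sub>R J u" if "u \<in> H" for u
    using that by (simp add: D_def Ja Js AH sub)
  define B where "B = \<bar>a\<bar> + \<bar>C\<bar>"
  have B0: "0 \<le> B" by (simp add: B_def)
  have AB: "norm (J (A u)) \<le> B * norm (J u)" if "u \<in> H" for u
  proof -
    have "norm (J (A u)) \<le> \<bar>a\<bar> * norm (J u) + norm (J (T u))"
      using norm_triangle_ineq4[of "a *\<^sub>R J u" "J (T u)"] that by (simp add: JA)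
    also have "norm (J (T u)) \<le> \<bar>C\<bar> * norm (J u)"
      using TC[OF that] by (meson abs_ge_self mult_right_mono norm_ge_zero order_trans)
    finally show ?thesis by (simp add: B_def algebra_simps)
  qed
  have symA: "inner (J (A u)) (J v) = inner (J u) (J (A v))" if "u \<in> H" "v \<in> H" for u v
    using that by (simp add: JA inner_diff_left inner_diff_right sym)
  obtain d where d: "0 \<le> d" "d\<^sup>2 + b\<^sup>2 > 0" "\<And>u. u \<in> H \<Longrightarrow> d * norm (J u) \<le> norm (J (A u))"
  proof (cases "b = 0")
    case False then show thesis using that[of 0] by simp
  next
    case True
    with z consider "a < m" | "a > M" unfolding a_def b_def by linarith
    then obtain d where "d > 0"
      "\<And>u. u \<in> H \<Longrightarrow> d * (norm (J u))\<^sup>2 \<le> \<bar>inner (J (A u)) (J u)\<bar>"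
    proof cases
      case 1
      have "(m - a) * (norm (J u))\<^sup>2 \<le> \<bar>inner (J (A u)) (J u)\<bar>" if "u \<in> H" for u
        using lo[OF that] that by (simp add: JA inner_diff_left power2_norm_eq_inner left_diff_distrib)
      with 1 show thesis using that[of "m - a"] by simp
    next
      case 2
      have "(a - M) * (norm (J u))\<^sup>2 \<le> \<bar>inner (J (A u)) (J u)\<bar>" if "u \<in> H" for u
        using hi[OF that] that by (simp add: JA inner_diff_left power2_norm_eq_inner left_diff_distrib)
      with 2 show thesis using that[of "a - M"] by simp
    qed
    note d = this
    have "d * norm (J u) \<le> norm (J (A u))" if "u \<in> H" for u
    proof (cases "J u = 0")
      case False
      have "(d * norm (J u)) * norm (J u) \<le> norm (J (A u)) * norm (J u)"
        using d(2)[OF that] Cauchy_Schwarz_ineq2[of "J (A u)" "J u"] by (simp add: power2_eq_square)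
      then show ?thesis using False by simp
    qed simp
    with d(1) True show thesis using that[of d] by simp
  qed
  define c where "c = d\<^sup>2 + b\<^sup>2"
  have c: "c > 0" using d(2) by (simp add: c_def)
  have coer: "c * (norm (J u))\<^sup>2 \<le> inner (J (D u)) (J u)" if "u \<in> H" for u
  proof -
    have "inner (J (D u)) (J u) = (norm (J (A u)))\<^sup>2 + b\<^sup>2 * (norm (J u))\<^sup>2"
      using that by (simp add: JD inner_add_left symA AH power2_norm_eq_inner)
    moreover have "(d * norm (J u))\<^sup>2 \<le> (norm (J (A u)))\<^sup>2"
      using d(1) d(3)[OF that] by (intro power_mono) auto
    ultimately show ?thesis by (simp add: c_def power_mult_distrib distrib_right)
  qed
  have lower: "c * norm (J u) \<le> norm (J (D u))" if "u \<in> H" for u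
  proof (cases "J u = 0")
    case False
    have "(c * norm (J u)) * norm (J u) \<le> norm (J (D u)) * norm (J u)"
      using coer[OF that] norm_cauchy_schwarz[of "J (D u)" "J u"] by (simp add: power2_eq_square)
    then show ?thesis using False by simp
  qed simp
  have surj: "\<exists>u\<in>H. D u = f" if f: "f \<in> H" for f
  proof -
    let ?I = "inv_into H J"
    have I: "?I (J u) = u" if "u \<in> H" for u using Ji that by simp
    have "\<exists>g\<in>J ` H. J (D (?I g)) = J f"
    proof (rule coercive_solvable[where c = c and C = "B * B + b\<^sup>2"])
      show "subspace (J ` H)"
        unfolding subspace_def
      proof (intro conjI ballI allI)
        have "J 0 = 0" using Js[of 0 0] subspace_0[OF H] by simp
        then show "0 \<in> J ` H" using subspace_0[OF H] by force
        show "x + y \<in> J ` H" if "x \<in> J ` H" "y \<in> J ` H" for x y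
          using that sub by (auto simp flip: Ja)
        show "r *\<^sub>R x \<in> J ` H" if "x \<in> J ` H" for r x
          using that sub by (auto simp flip: Js)
      qed
    next
      fix g g' assume "g \<in> J ` H" "g' \<in> J ` H"
      then show "J (D (?I (g - g'))) = J (D (?I g)) - J (D (?I g'))"
        by (auto simp: I sub Dd DH simp flip: Jd)
    next
      fix g assume "g \<in> J ` H"
      then obtain u where u: "u \<in> H" "g = J u" by blast
      have "norm (J (D u)) \<le> norm (J (A (A u))) + b\<^sup>2 * norm (J u)"
        using norm_triangle_ineq[of "J (A (A u))" "b\<^sup>2 *\<^sub>R J u"] u by (simp add: JD)
      also have "norm (J (A (A u))) \<le> B * (B * norm (J u))"
        using AB[OF AH[OF u(1)]] AB[OF u(1)] B0 by (meson mult_left_mono order_trans)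
      finally show "norm (J (D (?I g))) \<le> (B * B + b\<^sup>2) * norm g"
        using u by (simp add: I algebra_simps)
    qed (use JH f c DH coer in \<open>auto simp: I\<close>)
    then obtain u where u: "u \<in> H" "J (D u) = J f" by (auto simp: I)
    then have "D u = f" using Ji DH f by (meson inj_onD)
    with u show ?thesis by blast
  qed
  have inj: "u = v" if "u \<in> H" "v \<in> H" "D u = D v" for u v
  proof -
    have "D (u - v) = 0" using that Dd by simp
    moreover have "J 0 = 0" using Js[of 0 0] subspace_0[OF H] by simp
    ultimately have "c * norm (J (u - v)) \<le> 0" using lower[of "u - v"] that sub by simp
    then have "J (u - v) = 0" using c by (simp add: mult_le_0_iff)
    then show ?thesis using Jd that Ji by (simp add: inj_onD)
  qed
  define E where "E f = (THE u. u \<in> H \<and> D u = f)" for f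
  have E: "E f \<in> H" "D (E f) = f" if "f \<in> H" for f
  proof -
    have "\<exists>!u. u \<in> H \<and> D u = f" using surj[OF that] inj by blast
    from theI'[OF this] show "E f \<in> H" "D (E f) = f" by (simp_all add: E_def)
  qed
  have EI: "E f = u" if "u \<in> H" "D u = f" for u f
    using E[of f] DH that inj by blast
  have Ea: "E (f + g) = E f + E g" if "f \<in> H" "g \<in> H" for f g
    using that E by (intro EI) (auto simp: sub Da)
  have Es: "E (r *\<^sub>R f) = r *\<^sub>R E f" if "f \<in> H" for f r
    using that E by (intro EI) (auto simp: sub Ds)
  have Ed: "E (f - g) = E f - E g" if "f \<in> H" "g \<in> H" for f g
    using that E by (intro EI) (auto simp: sub Dd)
  have AE: "A (E f) = E (A f)" if "f \<in> H" for f
    using that E by (intro EI[symmetric]) (auto simp: AH simp flip: AD)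
  have EN: "N (E f) \<le> N f / c" if "f \<in> H" for f
    using lower[OF E(1)[OF that]] E[OF that] that c by (simp add: N field_simps)
  \<comment> \<open>\<open>E (A - \<i> b)\<close> applied to \<open>fst w + \<i> snd w\<close>\<close>
  define R where "R w = (E (A (fst w) + b *\<^sub>R snd w), E (A (snd w) - b *\<^sub>R fst w))" for w
  have S: "cplx_scale z w - map_prod T T w = (A (fst w) - b *\<^sub>R snd w, A (snd w) + b *\<^sub>R fst w)" for w
    by (simp add: cplx_scale_def A_def a_def b_def prod_eq_iff)
  have NE: "N (E (A u + r *\<^sub>R v)) \<le> (B + \<bar>b\<bar>) / c * (N u + N v)"
    if u: "u \<in> H" "v \<in> H" and r: "\<bar>r\<bar> = \<bar>b\<bar>" for u v r
  proof -
    have "N (E (A u + r *\<^sub>R v)) \<le> N (A u + r *\<^sub>R v) / c" using u by (intro EN) (auto simp: sub AH)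
    also have "N (A u + r *\<^sub>R v) \<le> norm (J (A u)) + \<bar>b\<bar> * norm (J v)"
      using norm_triangle_ineq[of "J (A u)" "r *\<^sub>R J v"] u r by (simp add: N sub AH Ja Js)
    also have "norm (J (A u)) \<le> B * norm (J u)" using AB u by simp
    also have "B * norm (J u) + \<bar>b\<bar> * norm (J v) \<le> (B + \<bar>b\<bar>) * (N u + N v)"
      using B0 u by (simp add: N algebra_simps)
    finally show ?thesis using c by (simp add: divide_right_mono)
  qed
  define P where "P = (B + \<bar>b\<bar>) / c"
  have P: "P \<ge> 0" using B0 c by (simp add: P_def)
  have bR: "bounded_cplx_operator (H \<times> H) (cplx_norm N) R"
    unfolding bounded_cplx_operator_def
  proof (intro conjI ballI allI exI)
    fix w assume w: "w \<in> H \<times> H"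
    obtain u v where uv: "w = (u, v)" "u \<in> H" "v \<in> H" using w by auto
    have n0: "0 \<le> N f" if "f \<in> H" for f using that by (simp add: N)
    show "R w \<in> H \<times> H" using uv by (simp add: R_def E sub AH)
    have f: "N (fst (R w)) \<le> P * (N u + N v)" "N (snd (R w)) \<le> P * (N u + N v)"
      using NE[of u v b] NE[of v u "-b"] uv by (auto simp: R_def P_def add.commute)
    have s: "N u \<le> cplx_norm N w" "N v \<le> cplx_norm N w"
      by (auto simp: cplx_norm_def uv intro: real_le_rsqrt)
    have "cplx_norm N (R w) \<le> N (fst (R w)) + N (snd (R w))"
      unfolding cplx_norm_def using \<open>R w \<in> H \<times> H\<close> by (intro sqrt_sum_squares_le_sum n0) auto
    also have "\<dots> \<le> 2 * (P * (N u + N v))" using f by simp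
    also have "\<dots> \<le> 2 * (P * (cplx_norm N w + cplx_norm N w))"
      using s P by (intro mult_left_mono add_mono) auto
    finally show "cplx_norm N (R w) \<le> 4 * P * cplx_norm N w"
      by simp
  next
    fix w w' assume w: "w \<in> H \<times> H" "w' \<in> H \<times> H"
    obtain u v u' v' where uv: "w = (u, v)" "w' = (u', v')" "u \<in> H" "v \<in> H" "u' \<in> H" "v' \<in> H"
      using w by auto
    have "A (u + u') + b *\<^sub>R (v + v') = (A u + b *\<^sub>R v) + (A u' + b *\<^sub>R v')"
      "A (v + v') - b *\<^sub>R (u + u') = (A v - b *\<^sub>R u) + (A v' - b *\<^sub>R u')"
      using uv by (simp_all add: Aa scaleR_add_right)
    then show "R (w + w') = R w + R w'"
      using uv by (simp add: R_def Ea sub AH)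
  next
    fix r w assume w: "w \<in> H \<times> H"
    obtain u v where uv: "w = (u, v)" "u \<in> H" "v \<in> H" using w by auto
    define p q where "p = Re r" and "q = Im r"
    have "A (p *\<^sub>R u - q *\<^sub>R v) + b *\<^sub>R (p *\<^sub>R v + q *\<^sub>R u)
        = p *\<^sub>R (A u + b *\<^sub>R v) - q *\<^sub>R (A v - b *\<^sub>R u)"
      "A (p *\<^sub>R v + q *\<^sub>R u) - b *\<^sub>R (p *\<^sub>R u - q *\<^sub>R v)
        = p *\<^sub>R (A v - b *\<^sub>R u) + q *\<^sub>R (A u + b *\<^sub>R v)"
      using uv by (simp_all add: Aa Ad As sub scaleR_add_right scaleR_diff_right mult.commute)
    then show "R (cplx_scale r w) = cplx_scale r (R w)"
      using uv by (simp add: R_def cplx_scale_def Ea Ed Es sub AH flip: p_def q_def)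
  qed
  have inv: "cplx_scale z w - map_prod T T w \<in> H \<times> H
      \<and> R (cplx_scale z w - map_prod T T w) = w
      \<and> cplx_scale z (R w) - map_prod T T (R w) = w" if w: "w \<in> H \<times> H" for w
  proof -
    obtain u v where uv: "w = (u, v)" "u \<in> H" "v \<in> H" using w by auto
    have 1: "A (A u - b *\<^sub>R v) + b *\<^sub>R (A v + b *\<^sub>R u) = D u"
      using uv by (simp add: D_def Ad As AH sub scaleR_add_right power2_eq_square)
    have 2: "A (A v + b *\<^sub>R u) - b *\<^sub>R (A u - b *\<^sub>R v) = D v"
      using uv by (simp add: D_def Aa As AH sub scaleR_diff_right power2_eq_square)
    have 3: "A (E (A u + b *\<^sub>R v)) - b *\<^sub>R E (A v - b *\<^sub>R u) = E (D u)"
    proof -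
      have "A (A u + b *\<^sub>R v) - b *\<^sub>R (A v - b *\<^sub>R u) = D u"
        using uv by (simp add: D_def Aa As AH sub scaleR_diff_right power2_eq_square)
      then show ?thesis using uv by (simp add: AE AH sub flip: Ed Es)
    qed
    have 4: "A (E (A v - b *\<^sub>R u)) + b *\<^sub>R E (A u + b *\<^sub>R v) = E (D v)"
    proof -
      have "A (A v - b *\<^sub>R u) + b *\<^sub>R (A u + b *\<^sub>R v) = D v"
        using uv by (simp add: D_def Ad As AH sub scaleR_add_right power2_eq_square)
      then show ?thesis using uv by (simp add: AE AH sub flip: Ea Es)
    qed
    have 5: "E (D u) = u" "E (D v) = v" using uv EI by auto
    show ?thesis unfolding S using uv by (simp add: R_def 1 2 3 4 5 AH sub)
  qed
  show ?thesis
    unfolding has_bounded_inverse_def by (intro exI[of _ R] conjI[OF bR] ballI inv)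
qed

section \<open>Completeness of the space of square-integrable functions\<close>

lemma L2_eqI: "AE x in lborel. rep_L2 u x = rep_L2 v x \<Longrightarrow> u = v"
  using Quotient3_rel_abs[OF Quotient3_L2, of "rep_L2 u" "rep_L2 v"]
  by (simp add: L2_eq_def square_integrable_rep_L2 abs_rep_L2)

lemma abs_L2_add: "square_integrable f \<Longrightarrow> square_integrable g \<Longrightarrow>
    abs_L2 (\<lambda>x. f x + g x) = abs_L2 f + abs_L2 g"
  by (simp add: plus_L2.abs_eq L2_eq_def)

lemma abs_L2_diff: "square_integrable f \<Longrightarrow> square_integrable g \<Longrightarrow>
    abs_L2 (\<lambda>x. f x - g x) = abs_L2 f - abs_L2 g"
  by (simp add: minus_L2.abs_eq L2_eq_def)

lemma abs_L2_scale: "square_integrable f \<Longrightarrow> abs_L2 (\<lambda>x. c * f x) = c *\<^sub>R abs_L2 f"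
  by (simp add: scaleR_L2.abs_eq L2_eq_def)

lemma inner_abs_L2: "square_integrable f \<Longrightarrow> square_integrable g \<Longrightarrow>
    inner (abs_L2 f) (abs_L2 g) = (LINT x|lborel. f x * g x)"
  by (simp add: inner_L2.abs_eq L2_eq_def)

lemma rep_L2_add: "AE x in lborel. rep_L2 (u + v) x = rep_L2 u x + rep_L2 v x"
  using rep_abs_L2[OF square_integrable_add[OF square_integrable_rep_L2[of u] square_integrable_rep_L2[of v]]]
  by (simp add: abs_L2_add square_integrable_rep_L2 abs_rep_L2)

lemma rep_L2_diff: "AE x in lborel. rep_L2 (u - v) x = rep_L2 u x - rep_L2 v x"
  using rep_abs_L2[OF square_integrable_diff[OF square_integrable_rep_L2[of u] square_integrable_rep_L2[of v]]]
  by (simp add: abs_L2_diff square_integrable_rep_L2 abs_rep_L2)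

lemma rep_L2_scale: "AE x in lborel. rep_L2 (c *\<^sub>R u) x = c * rep_L2 u x"
  using rep_abs_L2[OF square_integrable_scale[OF square_integrable_rep_L2[of u], of c]]
  by (simp add: abs_L2_scale square_integrable_rep_L2 abs_rep_L2)

lemma rep_L2_zero: "AE x in lborel. rep_L2 0 x = 0"
  using rep_abs_L2[OF square_integrable_zero] by (simp add: zero_L2.abs_eq)

lemma inner_L2_rep: "inner u v = (LINT x|lborel. rep_L2 u x * rep_L2 v x)"
  using inner_abs_L2[OF square_integrable_rep_L2[of u] square_integrable_rep_L2[of v]]
  by (simp add: abs_rep_L2)

lemma rep_L2_measurable [measurable]: "rep_L2 u \<in> borel_measurable borel"
  using square_integrable_rep_L2[of u] by (simp add: square_integrable_def)

lemma nn_integral_square_rep_L2: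
  "(\<integral>\<^sup>+x. ennreal ((rep_L2 u x)\<^sup>2) \<partial>lborel) = ennreal ((norm u)\<^sup>2)"
proof -
  have "integrable lborel (\<lambda>x. (rep_L2 u x)\<^sup>2)"
    using square_integrable_rep_L2[of u] by (simp add: square_integrable_def)
  then show ?thesis
    by (simp add: nn_integral_eq_integral power2_norm_eq_inner inner_L2_rep)
       (simp add: power2_eq_square)
qed

lemma square_integrable_iff_nn_integral:
  assumes [measurable]: "f \<in> borel_measurable borel"
  shows "square_integrable f \<longleftrightarrow> (\<integral>\<^sup>+x. ennreal ((f x)\<^sup>2) \<partial>lborel) < \<infinity>"
  using assms by (auto simp: square_integrable_def integrable_iff_bounded)

text \<open>The sum \<open>\<Sum>k. 2 ^ k * (d k)\<^sup>2\<close> of the weighted squared increments \<open>d k\<close> has a finite integral, so almost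
everywhere the \<open>d k\<close> are dominated by a geometric sequence.\<close>

lemma L2_fast_Cauchy_AE_convergent:
  fixes Y :: "nat \<Rightarrow> L2"
  assumes "\<And>k. dist (Y (Suc k)) (Y k) \<le> (1/2) ^ k"
  shows "AE x in lborel. convergent (\<lambda>k. rep_L2 (Y k) x)"
proof -
  define d where "d k x = rep_L2 (Y (Suc k) - Y k) x" for k x
  have [measurable]: "d k \<in> borel_measurable borel" for k unfolding d_def by (rule rep_L2_measurable)
  have I: "(\<integral>\<^sup>+x. ennreal (2 ^ k * (d k x)\<^sup>2) \<partial>lborel) \<le> ennreal ((1/2) ^ k)" for k
  proof -
    have "(\<integral>\<^sup>+x. ennreal (2 ^ k * (d k x)\<^sup>2) \<partial>lborel) = ennreal (2 ^ k) * ennreal ((norm (Y (Suc k) - Y k))\<^sup>2)"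
      by (simp add: ennreal_mult nn_integral_cmult d_def nn_integral_square_rep_L2)
    also have "\<dots> = ennreal (2 ^ k * (norm (Y (Suc k) - Y k))\<^sup>2)" by (simp add: ennreal_mult)
    also have "2 ^ k * (norm (Y (Suc k) - Y k))\<^sup>2 \<le> 2 ^ k * ((1/2) ^ k)\<^sup>2"
      using assms[of k] by (intro mult_left_mono power_mono) (auto simp: dist_norm)
    also have "\<dots> = (1/2) ^ k" by (simp add: power2_eq_square power_one_over)
    finally show ?thesis by (simp add: ennreal_leI)
  qed
  have "(\<integral>\<^sup>+x. (\<Sum>k. ennreal (2 ^ k * (d k x)\<^sup>2)) \<partial>lborel) = (\<Sum>k. \<integral>\<^sup>+x. ennreal (2 ^ k * (d k x)\<^sup>2) \<partial>lborel)"
    by (intro nn_integral_suminf) simp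
  also have "\<dots> \<le> (\<Sum>k. ennreal ((1/2) ^ k))" by (intro suminf_le I) auto
  also have "\<dots> = ennreal (\<Sum>k. (1/2) ^ k)"
    by (intro suminf_ennreal2) (auto intro: summable_geometric)
  also have "\<dots> < \<infinity>" by simp
  finally have "AE x in lborel. (\<Sum>k. ennreal (2 ^ k * (d k x)\<^sup>2)) \<noteq> \<infinity>"
    by (intro nn_integral_PInf_AE) auto
  moreover have "AE x in lborel. \<forall>k. d k x = rep_L2 (Y (Suc k)) x - rep_L2 (Y k) x"
    unfolding d_def by (simp add: AE_all_countable rep_L2_diff)
  ultimately show ?thesis
  proof eventually_elim
    fix x assume x: "(\<Sum>k. ennreal (2 ^ k * (d k x)\<^sup>2)) \<noteq> \<infinity>"
      and dx: "\<forall>k. d k x = rep_L2 (Y (Suc k)) x - rep_L2 (Y k) x"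
    from x have s: "summable (\<lambda>k. 2 ^ k * (d k x)\<^sup>2)"
      by (intro summable_suminf_not_top) auto
    define C where "C = (\<Sum>k. 2 ^ k * (d k x)\<^sup>2)"
    have C: "2 ^ k * (d k x)\<^sup>2 \<le> C" for k
      using sum_le_suminf[OF s, of "{k}"] by (simp add: C_def)
    have C0: "0 \<le> C" using C[of 0] by (meson order_trans zero_le_mult_iff zero_le_numeral zero_le_power zero_le_power2)
    have "norm (d k x) \<le> sqrt C * (sqrt (1/2)) ^ k" for k
    proof (rule power2_le_imp_le)
      have "(sqrt (1/2) ^ k)\<^sup>2 = (1/2::real) ^ k"
        by (metis power_even_eq power_mult mult.commute real_sqrt_pow2 zero_le_divide_1_iff zero_le_numeral)
      moreover have "(d k x)\<^sup>2 \<le> C * (1/2) ^ k"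
        using C[of k] by (simp add: power_one_over field_simps)
      ultimately show "(norm (d k x))\<^sup>2 \<le> (sqrt C * sqrt (1/2) ^ k)\<^sup>2"
        using C0 by (simp only: power_mult_distrib real_sqrt_pow2 real_norm_def power2_abs)
    qed (use C0 in auto)
    moreover have "summable (\<lambda>k. sqrt C * (sqrt (1/2)) ^ k)"
      by (intro summable_mult summable_geometric) (auto simp: real_sqrt_divide)
    ultimately have "summable (\<lambda>k. d k x)" by (rule summable_comparison_test'[rotated])
    then have "summable (\<lambda>k. rep_L2 (Y (Suc k)) x - rep_L2 (Y k) x)" using dx by simp
    then have "convergent (\<lambda>n. \<Sum>k<n. rep_L2 (Y (Suc k)) x - rep_L2 (Y k) x)"
      by (simp add: summable_iff_convergent)
    then have "convergent (\<lambda>n. rep_L2 (Y n) x - rep_L2 (Y 0) x)"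
      by (simp only: sum_lessThan_telescope[of "\<lambda>k. rep_L2 (Y k) x"])
    from convergent_add[OF this convergent_const[of "rep_L2 (Y 0) x"]]
    show "convergent (\<lambda>k. rep_L2 (Y k) x)" by simp
  qed
qed

text \<open>A Cauchy sequence has a subsequence that converges almost everywhere; by Fatou's lemma the pointwise
limit is also the limit in the norm.\<close>

instance L2 :: complete_space
proof
  fix X :: "nat \<Rightarrow> L2" assume X: "Cauchy X"
  have "\<exists>N. \<forall>m\<ge>N. \<forall>n\<ge>N. dist (X m) (X n) < (1/2) ^ k" for k
    using metric_CauchyD[OF X, of "(1/2) ^ k"] by simp
  then obtain N where N: "\<And>k m n. m \<ge> N k \<Longrightarrow> n \<ge> N k \<Longrightarrow> dist (X m) (X n) < (1/2) ^ k"
    by metis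
  \<comment> \<open>the summand \<open>k\<close> makes \<open>r\<close> strictly increasing, the sum makes \<open>r k \<ge> N k\<close>\<close>
  define r where "r k = k + (\<Sum>i\<le>k. N i)" for k
  have rN: "N k \<le> r k" for k unfolding r_def by (simp add: lessThan_Suc_atMost[symmetric] trans_le_add2)
  have r: "strict_mono r" unfolding r_def by (intro strict_monoI_Suc) simp
  define Y where "Y k = X (r k)" for k
  have Y: "Cauchy Y" using Cauchy_subseq_Cauchy[OF X r] unfolding Y_def comp_def .
  have "dist (Y (Suc k)) (Y k) \<le> (1/2) ^ k" for k
    unfolding Y_def using rN[of k] strict_monoD[OF r, of k "Suc k"]
    by (intro less_imp_le[OF N]) auto
  then have conv: "AE x in lborel. convergent (\<lambda>k. rep_L2 (Y k) x)"
    by (rule L2_fast_Cauchy_AE_convergent)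
  define F where "F x = lim (\<lambda>k. rep_L2 (Y k) x)" for x
  have F[measurable]: "F \<in> borel_measurable borel" unfolding F_def by measurable
  have close: "(\<integral>\<^sup>+x. ennreal ((F x - rep_L2 (Y n) x)\<^sup>2) \<partial>lborel) \<le> ennreal (e\<^sup>2)"
    if e: "e > 0" "\<forall>m\<ge>n. dist (Y m) (Y n) < e" for e n
  proof -
    have "AE x in lborel. \<forall>m. rep_L2 (Y m - Y n) x = rep_L2 (Y m) x - rep_L2 (Y n) x"
      by (simp add: AE_all_countable rep_L2_diff)
    with conv have "AE x in lborel. ennreal ((F x - rep_L2 (Y n) x)\<^sup>2)
        = liminf (\<lambda>m. ennreal ((rep_L2 (Y m - Y n) x)\<^sup>2))"
    proof eventually_elim
      fix x assume "convergent (\<lambda>k. rep_L2 (Y k) x)"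
        and eq: "\<forall>m. rep_L2 (Y m - Y n) x = rep_L2 (Y m) x - rep_L2 (Y n) x"
      then have "(\<lambda>k. rep_L2 (Y k) x) \<longlonglongrightarrow> F x" by (simp add: F_def convergent_LIMSEQ_iff)
      then have "(\<lambda>m. ennreal ((rep_L2 (Y m - Y n) x)\<^sup>2)) \<longlonglongrightarrow> ennreal ((F x - rep_L2 (Y n) x)\<^sup>2)"
        unfolding eq[rule_format] by (intro tendsto_intros tendsto_ennrealI)
      then show "ennreal ((F x - rep_L2 (Y n) x)\<^sup>2) = liminf (\<lambda>m. ennreal ((rep_L2 (Y m - Y n) x)\<^sup>2))"
        by (intro lim_imp_Liminf[symmetric]) auto
    qed
    then have "(\<integral>\<^sup>+x. ennreal ((F x - rep_L2 (Y n) x)\<^sup>2) \<partial>lborel)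
        = (\<integral>\<^sup>+x. liminf (\<lambda>m. ennreal ((rep_L2 (Y m - Y n) x)\<^sup>2)) \<partial>lborel)"
      by (rule nn_integral_cong_AE)
    also have "\<dots> \<le> liminf (\<lambda>m. \<integral>\<^sup>+x. ennreal ((rep_L2 (Y m - Y n) x)\<^sup>2) \<partial>lborel)"
      by (intro nn_integral_liminf) simp
    also have "\<dots> = liminf (\<lambda>m. ennreal ((norm (Y m - Y n))\<^sup>2))"
      by (simp add: nn_integral_square_rep_L2)
    also have "\<dots> \<le> ennreal (e\<^sup>2)"
    proof (rule Liminf_le)
      have "ennreal ((norm (Y m - Y n))\<^sup>2) \<le> ennreal (e\<^sup>2)" if "m \<ge> n" for m
        using e that by (intro ennreal_leI power_mono) (auto simp: dist_norm less_imp_le)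
      then show "\<forall>\<^sub>F m in sequentially. ennreal ((norm (Y m - Y n))\<^sup>2) \<le> ennreal (e\<^sup>2)"
        unfolding eventually_sequentially by blast
    qed simp
    finally show ?thesis .
  qed
  have sqF: "square_integrable F"
  proof -
    obtain n where n: "\<forall>m\<ge>n. dist (Y m) (Y n) < 1" using metric_CauchyD[OF Y, of 1] by fastforce
    have "(\<integral>\<^sup>+x. ennreal ((F x - rep_L2 (Y n) x)\<^sup>2) \<partial>lborel) < \<infinity>"
      by (rule le_less_trans[OF close[OF zero_less_one n]]) simp
    then have "square_integrable (\<lambda>x. F x - rep_L2 (Y n) x)"
      by (subst square_integrable_iff_nn_integral) auto
    from square_integrable_add[OF this square_integrable_rep_L2[of "Y n"]] show ?thesis by simp
  qed
  have "Y \<longlonglongrightarrow> abs_L2 F"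
  proof (rule metric_LIMSEQ_I)
    fix e :: real assume e: "e > 0"
    obtain M where M: "\<forall>m\<ge>M. \<forall>n\<ge>M. dist (Y m) (Y n) < e / 2"
      using metric_CauchyD[OF Y, of "e / 2"] e by auto
    have "dist (Y n) (abs_L2 F) < e" if n: "n \<ge> M" for n
    proof -
      let ?D = "abs_L2 F - Y n"
      have "AE x in lborel. rep_L2 ?D x = F x - rep_L2 (Y n) x"
        using rep_L2_diff[of "abs_L2 F" "Y n"] rep_abs_L2[OF sqF] by eventually_elim simp
      then have "ennreal ((norm ?D)\<^sup>2) = (\<integral>\<^sup>+x. ennreal ((F x - rep_L2 (Y n) x)\<^sup>2) \<partial>lborel)"
        unfolding nn_integral_square_rep_L2[symmetric]
        by (intro nn_integral_cong_AE) (auto elim: eventually_mono)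
      also have "\<dots> \<le> ennreal ((e / 2)\<^sup>2)" using M n e by (intro close) auto
      finally have "(norm ?D)\<^sup>2 \<le> (e / 2)\<^sup>2" by (subst (asm) ennreal_le_iff) auto
      then have "norm ?D \<le> e / 2" using e by (auto dest: power2_le_imp_le)
      then show ?thesis using e by (simp add: dist_norm norm_minus_commute)
    qed
    then show "\<exists>no. \<forall>n\<ge>no. dist (Y n) (abs_L2 F) < e" by blast
  qed
  moreover have "(X \<circ> r) = Y" by (rule ext) (simp add: Y_def)
  ultimately show "convergent X" using X r by (metis Cauchy_converges_subseq convergentI)
qed

text \<open>Meant for bounded measurable \<open>m\<close>; where the product is not square integrable, the value is arbitrary.\<close>

definition mult_L2 :: "(real^2 \<Rightarrow> real) \<Rightarrow> L2 \<Rightarrow> L2" where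
  "mult_L2 m u = abs_L2 (\<lambda>x. m x * rep_L2 u x)"

lemma square_integrable_bounded_mult:
  assumes [measurable]: "m \<in> borel_measurable borel" and m: "\<And>x. \<bar>m x\<bar> \<le> C" and f: "square_integrable f"
  shows "square_integrable (\<lambda>x. m x * f x)"
proof -
  have [measurable]: "f \<in> borel_measurable borel" using f by (simp add: square_integrable_def)
  have "integrable lborel (\<lambda>x. (m x * f x)\<^sup>2)"
  proof (rule Bochner_Integration.integrable_bound)
    show "integrable lborel (\<lambda>x. C\<^sup>2 * (f x)\<^sup>2)" using f by (simp add: square_integrable_def)
    have "(m x * f x)\<^sup>2 \<le> C\<^sup>2 * (f x)\<^sup>2" for x
      using power_mono[OF m, of x 2] by (simp add: power_mult_distrib mult_right_mono)
    then show "AE x in lborel. norm ((m x * f x)\<^sup>2) \<le> norm (C\<^sup>2 * (f x)\<^sup>2)" by simp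
  qed simp
  then show ?thesis by (simp add: square_integrable_def)
qed

context
  fixes m :: "real^2 \<Rightarrow> real" and C :: real
  assumes m_measurable [measurable]: "m \<in> borel_measurable borel" and m_bound: "\<And>x. \<bar>m x\<bar> \<le> C"
begin

lemma rep_mult_L2: "AE x in lborel. rep_L2 (mult_L2 m u) x = m x * rep_L2 u x"
  unfolding mult_L2_def
  by (intro rep_abs_L2 square_integrable_bounded_mult[OF m_measurable m_bound] square_integrable_rep_L2)

lemma mult_L2_add: "mult_L2 m (u + v) = mult_L2 m u + mult_L2 m v"
proof (rule L2_eqI)
  show "AE x in lborel. rep_L2 (mult_L2 m (u + v)) x = rep_L2 (mult_L2 m u + mult_L2 m v) x"
    using rep_mult_L2[of "u + v"] rep_mult_L2[of u] rep_mult_L2[of v] rep_L2_add[of u v]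
      rep_L2_add[of "mult_L2 m u" "mult_L2 m v"]
    by eventually_elim (simp add: algebra_simps)
qed

lemma mult_L2_scale: "mult_L2 m (c *\<^sub>R u) = c *\<^sub>R mult_L2 m u"
proof (rule L2_eqI)
  show "AE x in lborel. rep_L2 (mult_L2 m (c *\<^sub>R u)) x = rep_L2 (c *\<^sub>R mult_L2 m u) x"
    using rep_mult_L2[of "c *\<^sub>R u"] rep_mult_L2[of u] rep_L2_scale[of c u]
      rep_L2_scale[of c "mult_L2 m u"]
    by eventually_elim (simp add: algebra_simps)
qed

lemma norm_mult_L2: "norm (mult_L2 m u) \<le> C * norm u"
proof (rule power2_le_imp_le)
  have C0: "0 \<le> C" using m_bound[of 0] by linarith
  then show "0 \<le> C * norm u" by simp
  have "ennreal ((norm (mult_L2 m u))\<^sup>2) = (\<integral>\<^sup>+x. ennreal ((rep_L2 (mult_L2 m u) x)\<^sup>2) \<partial>lborel)"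
    by (simp add: nn_integral_square_rep_L2)
  also have "\<dots> \<le> (\<integral>\<^sup>+x. ennreal (C\<^sup>2 * (rep_L2 u x)\<^sup>2) \<partial>lborel)"
  proof (rule nn_integral_mono_AE)
    show "AE x in lborel. ennreal ((rep_L2 (mult_L2 m u) x)\<^sup>2) \<le> ennreal (C\<^sup>2 * (rep_L2 u x)\<^sup>2)"
      using rep_mult_L2[of u]
    proof eventually_elim
      case (elim x)
      then show ?case using power_mono[OF m_bound, of x 2]
        by (intro ennreal_leI) (simp add: power_mult_distrib mult_right_mono)
    qed
  qed
  also have "\<dots> = ennreal ((C * norm u)\<^sup>2)"
    by (simp add: ennreal_mult nn_integral_cmult nn_integral_square_rep_L2 power_mult_distrib)
  finally show "(norm (mult_L2 m u))\<^sup>2 \<le> (C * norm u)\<^sup>2" by simp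
qed

lemma bounded_linear_mult_L2: "bounded_linear (mult_L2 m)"
  by (intro bounded_linear_intro[where K = C] mult_L2_add mult_L2_scale)
     (simp add: norm_mult_L2 mult.commute)

end

section \<open>Smooth functions and test functions\<close>

definition smooth :: "(real^2 \<Rightarrow> real) \<Rightarrow> bool" where
  "smooth f \<longleftrightarrow> (\<forall>k. C_diff k f)"

lemma partial_deriv_eqI: "(f has_derivative f') (at x) \<Longrightarrow> partial_deriv i f x = f' (axis i 1)"
  unfolding partial_deriv_def by (metis frechet_derivative_at)

lemma has_derivative_frechet:
  "f differentiable (at x) \<Longrightarrow> (f has_derivative frechet_derivative f (at x)) (at x)"
  by (simp add: frechet_derivative_works)

lemma partial_deriv_add: "f differentiable (at x) \<Longrightarrow> g differentiable (at x) \<Longrightarrow>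
    partial_deriv i (\<lambda>x. f x + g x) x = partial_deriv i f x + partial_deriv i g x"
  by (subst partial_deriv_eqI[OF has_derivative_add[OF has_derivative_frechet has_derivative_frechet]])
     (auto simp: partial_deriv_def)

lemma partial_deriv_mult: "f differentiable (at x) \<Longrightarrow> g differentiable (at x) \<Longrightarrow>
    partial_deriv i (\<lambda>x. f x * g x) x = f x * partial_deriv i g x + partial_deriv i f x * g x"
  by (subst partial_deriv_eqI[OF has_derivative_mult[OF has_derivative_frechet has_derivative_frechet]])
     (auto simp: partial_deriv_def)

lemma partial_deriv_zero_outside:
  assumes "closed S" "\<And>y. y \<notin> S \<Longrightarrow> f y = 0" "x \<notin> S"
  shows "partial_deriv i f x = 0"
proof -
  have "((\<lambda>_. 0) has_derivative (\<lambda>_. 0)) (at x)" by simp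
  then have "(f has_derivative (\<lambda>_. 0)) (at x)"
    using assms by (subst has_derivative_transform_within_open[of "\<lambda>_. 0" _ x UNIV "- S"]) auto
  then show ?thesis by (simp add: partial_deriv_eqI)
qed

lemma C_diff_SucD: "C_diff (Suc k) f \<Longrightarrow> C_diff k f"
  by (induction k arbitrary: f)
     (auto simp: continuous_on_eq_continuous_within differentiable_imp_continuous_within)

lemma C_diff_continuous: "C_diff k f \<Longrightarrow> continuous_on UNIV f"
  by (induction k) (auto dest: C_diff_SucD simp del: C_diff.simps(2))

lemma smooth_differentiable: "smooth f \<Longrightarrow> f differentiable (at x)"
  unfolding smooth_def using C_diff.simps(2) by blast

lemma smooth_partial_deriv: "smooth f \<Longrightarrow> smooth (partial_deriv i f)"
  unfolding smooth_def using C_diff.simps(2) by blast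

lemma smooth_continuous: "smooth f \<Longrightarrow> continuous_on UNIV f"
  unfolding smooth_def using C_diff_continuous by blast

text \<open>Smoothness of an explicit function is shown by exhibiting a family of differentiable functions that
contains it and is closed under partial derivatives.\<close>

lemma smooth_coinduct:
  assumes "f \<in> F" and F: "\<And>f x. f \<in> F \<Longrightarrow> f differentiable (at x)"
    "\<And>f i. f \<in> F \<Longrightarrow> partial_deriv i f \<in> F"
  shows "smooth f"
proof -
  have "\<forall>f\<in>F. C_diff k f" for k
    by (induction k) (use F in \<open>auto simp: continuous_on_eq_continuous_within
      differentiable_imp_continuous_within\<close>)
  then show ?thesis using assms(1) by (auto simp: smooth_def)
qed

lemma C_diff_add: "C_diff k f \<Longrightarrow> C_diff k g \<Longrightarrow> C_diff k (\<lambda>x. f x + g x)"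
proof (induction k arbitrary: f g)
  case (Suc k)
  then have "partial_deriv i (\<lambda>x. f x + g x) = (\<lambda>x. partial_deriv i f x + partial_deriv i g x)" for i
    by (auto simp: partial_deriv_add)
  with Suc show ?case by auto
qed (auto intro: continuous_intros)

lemma C_diff_mult: "C_diff k f \<Longrightarrow> C_diff k g \<Longrightarrow> C_diff k (\<lambda>x. f x * g x)"
proof (induction k arbitrary: f g)
  case (Suc k)
  then have "partial_deriv i (\<lambda>x. f x * g x) = (\<lambda>x. f x * partial_deriv i g x + partial_deriv i f x * g x)" for i
    by (auto simp: partial_deriv_mult)
  moreover have "C_diff k f" "C_diff k g" using Suc.prems C_diff_SucD by blast+
  ultimately show ?case using Suc by (auto intro!: C_diff_add)
qed (auto intro: continuous_intros)

lemma smooth_add: "smooth f \<Longrightarrow> smooth g \<Longrightarrow> smooth (\<lambda>x. f x + g x)"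
  by (simp add: smooth_def C_diff_add)

lemma smooth_mult: "smooth f \<Longrightarrow> smooth g \<Longrightarrow> smooth (\<lambda>x. f x * g x)"
  by (simp add: smooth_def C_diff_mult)

lemma partial_deriv_const: "partial_deriv i (\<lambda>_. c) = (\<lambda>_. 0)"
  by (rule ext, subst partial_deriv_eqI[of _ "\<lambda>_. 0"]) auto

lemma smooth_const: "smooth (\<lambda>_. c)"
  by (rule smooth_coinduct[of _ "range (\<lambda>c _. c)"]) (auto simp: partial_deriv_const)

lemma smooth_component: "smooth (\<lambda>x. x $ j)"
proof -
  have d: "((\<lambda>x::real^2. x $ j) has_derivative (\<lambda>x. x $ j)) (at x)" for x
    by (rule bounded_linear_imp_has_derivative) (rule bounded_linear_vec_nth)
  have "partial_deriv i (\<lambda>x. x $ j) = (\<lambda>_. axis i 1 $ j)" for i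
    by (rule ext) (simp add: partial_deriv_eqI[OF d])
  then show ?thesis
    by (intro smooth_coinduct[of _ "insert (\<lambda>x. x $ j) (range (\<lambda>c _. c))"])
       (auto simp: partial_deriv_const intro: differentiableI[OF d])
qed

text \<open>The wave packets are products of functions of one linear form each, for which the symmetry of the second
derivatives can be read off; carrying it along as a property stable under products takes the place of
Schwarz's theorem.\<close>

definition mixed_symmetric :: "(real^2 \<Rightarrow> real) \<Rightarrow> bool" where
  "mixed_symmetric f \<longleftrightarrow> smooth f \<and>
     (\<forall>i j. partial_deriv i (partial_deriv j f) = partial_deriv j (partial_deriv i f))"

lemma mixed_symmetric_mult:
  assumes f: "mixed_symmetric f" and g: "mixed_symmetric g"
  shows "mixed_symmetric (\<lambda>x. f x * g x)"
proof -
  have s: "smooth f" "smooth g" using assms by (auto simp: mixed_symmetric_def)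
  note d = smooth_differentiable[OF s(1)] smooth_differentiable[OF s(2)]
    smooth_differentiable[OF smooth_partial_deriv[OF s(1)]] smooth_differentiable[OF smooth_partial_deriv[OF s(2)]]
  have p: "partial_deriv j (\<lambda>x. f x * g x) = (\<lambda>x. f x * partial_deriv j g x + partial_deriv j f x * g x)" for j
    by (rule ext) (intro partial_deriv_mult d)
  have "partial_deriv i (partial_deriv j (\<lambda>x. f x * g x)) x =
      f x * partial_deriv i (partial_deriv j g) x + partial_deriv i f x * partial_deriv j g x
    + (partial_deriv j f x * partial_deriv i g x + partial_deriv i (partial_deriv j f) x * g x)" for i j x
    unfolding p by (simp add: partial_deriv_add partial_deriv_mult d differentiable_mult)
  then have "partial_deriv i (partial_deriv j (\<lambda>x. f x * g x)) = partial_deriv j (partial_deriv i (\<lambda>x. f x * g x))" for i j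
    using f g by (auto simp: mixed_symmetric_def)
  then show ?thesis using s by (simp add: mixed_symmetric_def smooth_mult)
qed

lemma mixed_symmetric_const: "mixed_symmetric (\<lambda>_. c)"
  by (simp add: mixed_symmetric_def smooth_const partial_deriv_const)

lemma mixed_symmetric_prod:
  "finite A \<Longrightarrow> (\<And>i. i \<in> A \<Longrightarrow> mixed_symmetric (f i)) \<Longrightarrow> mixed_symmetric (\<lambda>x. \<Prod>i\<in>A. f i x)"
  by (induction A rule: finite_induct) (auto intro: mixed_symmetric_const mixed_symmetric_mult)

text \<open>Sine and cosine are kept together because partial derivatives exchange them.\<close>

definition wave :: "real^2 \<Rightarrow> real \<Rightarrow> real \<Rightarrow> real^2 \<Rightarrow> real" where
  "wave \<omega> A B x = A * sin (\<omega> \<bullet> x) + B * cos (\<omega> \<bullet> x)"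

lemma wave_has_derivative:
  "(wave \<omega> A B has_derivative (\<lambda>h. (\<omega> \<bullet> h) * (A * cos (\<omega> \<bullet> x) - B * sin (\<omega> \<bullet> x)))) (at x)"
  unfolding wave_def by (auto intro!: derivative_eq_intros simp: algebra_simps)

lemma partial_deriv_wave: "partial_deriv i (wave \<omega> A B) = wave \<omega> (- B * \<omega> $ i) (A * \<omega> $ i)"
  by (rule ext) (simp add: partial_deriv_eqI[OF wave_has_derivative] wave_def inner_axis algebra_simps)

lemma mixed_symmetric_wave: "mixed_symmetric (wave \<omega> A B)"
proof -
  have "smooth (wave \<omega> A B)"
    by (rule smooth_coinduct[of _ "{wave \<omega> A B | A B. True}"])
       (auto simp: partial_deriv_wave intro: differentiableI wave_has_derivative, blast)
  then show ?thesis by (simp add: mixed_symmetric_def partial_deriv_wave algebra_simps)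
qed

text \<open>The polynomial factor makes the family closed under differentiation; \<open>exp_flat 1\<close> is the classical smooth
function that vanishes exactly for \<open>t \<le> 0\<close>.\<close>

definition exp_flat :: "real poly \<Rightarrow> real \<Rightarrow> real" where
  "exp_flat p t = (if t > 0 then poly p (1 / t) * exp (- 1 / t) else 0)"

lemma poly_exp_tendsto_0: "((\<lambda>s. poly p s * exp (- s)) \<longlongrightarrow> (0::real)) at_top"
proof -
  have "((\<lambda>s. \<Sum>i\<le>degree p. coeff p i * (s ^ i / exp s)) \<longlongrightarrow> (\<Sum>i\<le>degree p. coeff p i * 0)) at_top"
    by (intro tendsto_intros tendsto_power_div_exp_0)
  then show ?thesis by (simp add: poly_altdef sum_divide_distrib exp_minus divide_inverse sum_distrib_right mult.assoc)
qed

lemma exp_flat_has_derivative: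
  "(exp_flat p has_real_derivative exp_flat ([:0, 0, 1:] * (p - pderiv p)) t) (at t)"
proof -
  consider "t < 0" | "t = 0" | "t > 0" by linarith
  then show ?thesis
  proof cases
    case 1
    have "((\<lambda>_. 0) has_real_derivative 0) (at t)" by simp
    then have "(exp_flat p has_real_derivative 0) (at t)"
      by (rule has_field_derivative_transform_within_open[of _ _ _ "{..<0}"]) (use 1 in \<open>auto simp: exp_flat_def\<close>)
    with 1 show ?thesis by (simp add: exp_flat_def)
  next
    case 2
    \<comment> \<open>the difference quotient at 0 tends to 0 because \<open>exp (- s)\<close> beats every polynomial in \<open>s = 1 / h\<close>\<close>
    have "((\<lambda>h. exp_flat p h / h) \<longlongrightarrow> 0) (at 0)"
    proof (rule filterlim_split_at)
      have "\<forall>\<^sub>F h in at_left 0. exp_flat p h / h = 0"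
        unfolding eventually_at_filter by (intro always_eventually) (auto simp: exp_flat_def)
      then show "((\<lambda>h. exp_flat p h / h) \<longlongrightarrow> 0) (at_left 0)" by (rule tendsto_eventually)
      have "((\<lambda>h. poly ([:0,1:] * p) (inverse h) * exp (- inverse h)) \<longlongrightarrow> 0) (at_right 0)"
        by (rule filterlim_compose[OF poly_exp_tendsto_0 filterlim_inverse_at_top_right])
      moreover have "\<forall>\<^sub>F h in at_right 0. poly ([:0,1:] * p) (inverse h) * exp (- inverse h) = exp_flat p h / h"
        unfolding eventually_at_filter
        by (intro always_eventually) (auto simp: exp_flat_def field_simps)
      ultimately show "((\<lambda>h. exp_flat p h / h) \<longlongrightarrow> 0) (at_right 0)"
        by (rule Lim_transform_eventually)
    qed
    then show ?thesis using 2 by (simp add: has_field_derivative_iff exp_flat_def)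
  next
    case 3
    have "((\<lambda>t. poly p (1 / t) * exp (- 1 / t)) has_real_derivative
        poly p (1 / t) * (exp (- 1 / t) * (1 / t\<^sup>2)) + poly (pderiv p) (1 / t) * (- 1 / t\<^sup>2) * exp (- 1 / t)) (at t)"
      using 3 by (auto intro!: derivative_eq_intros DERIV_chain2[OF poly_DERIV] simp: field_simps power2_eq_square)
    then have "(exp_flat p has_real_derivative
        poly p (1 / t) * (exp (- 1 / t) * (1 / t\<^sup>2)) + poly (pderiv p) (1 / t) * (- 1 / t\<^sup>2) * exp (- 1 / t)) (at t)"
      by (rule has_field_derivative_transform_within_open[of _ _ _ "{0<..}"]) (use 3 in \<open>auto simp: exp_flat_def\<close>)
    moreover have "poly p (1 / t) * (exp (- 1 / t) * (1 / t\<^sup>2)) + poly (pderiv p) (1 / t) * (- 1 / t\<^sup>2) * exp (- 1 / t)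
        = exp_flat ([:0, 0, 1:] * (p - pderiv p)) t"
      using 3 by (simp add: exp_flat_def field_simps power2_eq_square)
    ultimately show ?thesis by simp
  qed
qed

lemma mixed_symmetric_exp_flat: "mixed_symmetric (\<lambda>x. exp_flat p (\<alpha> * x $ j + \<beta>))"
proof -
  let ?f = "\<lambda>\<gamma> p x. \<gamma> * exp_flat p (\<alpha> * x $ j + \<beta>)"
  let ?D = "\<lambda>p. [:0, 0, 1:] * (p - pderiv p)"
  have d: "(?f \<gamma> p has_derivative (\<lambda>h. \<gamma> * (exp_flat (?D p) (\<alpha> * x $ j + \<beta>) * (\<alpha> * h $ j)))) (at x)"
    for \<gamma> p and x :: "real^2"
  proof -
    have "((\<lambda>x. \<alpha> * x $ j + \<beta>) has_derivative (\<lambda>h. \<alpha> * h $ j)) (at x)"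
      by (auto intro!: derivative_eq_intros bounded_linear_imp_has_derivative bounded_linear_vec_nth)
    from has_derivative_compose[OF this, of "exp_flat p"]
      exp_flat_has_derivative[of p, unfolded has_field_derivative_def]
    have "((\<lambda>x. exp_flat p (\<alpha> * x $ j + \<beta>)) has_derivative
        (\<lambda>h. exp_flat (?D p) (\<alpha> * x $ j + \<beta>) * (\<alpha> * h $ j))) (at x)" by blast
    then show ?thesis by (rule has_derivative_mult_right)
  qed
  have p: "partial_deriv i (?f \<gamma> p) = ?f (\<gamma> * (\<alpha> * axis i 1 $ j)) (?D p)" for i \<gamma> p
    by (rule ext) (simp only: partial_deriv_eqI[OF d] mult_ac)
  have "mixed_symmetric (?f 1 p)"
    unfolding mixed_symmetric_def
  proof (intro conjI allI)
    show "smooth (?f 1 p)"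
    proof (rule smooth_coinduct[of _ "{?f \<gamma> p | \<gamma> p. True}"])
      show "?f 1 p \<in> {?f \<gamma> p | \<gamma> p. True}" by blast
    next
      fix f x assume "f \<in> {?f \<gamma> p | \<gamma> p. True}"
      then show "f differentiable (at x)" using d differentiableI by blast
    next
      fix f i assume "f \<in> {?f \<gamma> p | \<gamma> p. True}"
      then obtain \<gamma> q where "f = ?f \<gamma> q" by blast
      then show "partial_deriv i f \<in> {?f \<gamma> p | \<gamma> p. True}" unfolding p using p by blast
    qed
    show "partial_deriv i (partial_deriv k (?f 1 p)) = partial_deriv k (partial_deriv i (?f 1 p))" for i k
      unfolding p by (simp add: mult_ac)
  qed
  then show ?thesis by simp
qed

text \<open>The shift by 1 keeps the closed support inside the open box, by a margin of \<open>1 / n\<close> on each side.\<close>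

definition box_bump :: "nat \<Rightarrow> real^2 \<Rightarrow> real^2 \<Rightarrow> real^2 \<Rightarrow> real" where
  "box_bump n a b x = (\<Prod>j\<in>UNIV. exp_flat 1 (real n * x $ j + (- real n * a $ j - 1)) *
                                   exp_flat 1 (- real n * x $ j + (real n * b $ j - 1)))"

lemma mixed_symmetric_box_bump: "mixed_symmetric (box_bump n a b)"
  unfolding box_bump_def by (intro mixed_symmetric_prod mixed_symmetric_mult mixed_symmetric_exp_flat) auto

lemma exp_flat_1_bounds: "0 \<le> exp_flat 1 t" "exp_flat 1 t \<le> 1"
  by (auto simp: exp_flat_def)

lemma box_bump_bounds: "0 \<le> box_bump n a b x" "box_bump n a b x \<le> 1"
  unfolding box_bump_def by (auto intro!: prod_nonneg prod_le_1 mult_nonneg_nonneg mult_le_one exp_flat_1_bounds)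

lemma zero_outside_support: "x \<notin> closure {x. \<phi> x \<noteq> 0} \<Longrightarrow> \<phi> x = 0"
  using closure_subset[of "{x. \<phi> x \<noteq> 0}"] by blast

lemma box_bump_support:
  assumes n: "n > 0"
  shows "closure {x. box_bump n a b x \<noteq> 0} \<subseteq> box a b" "compact (closure {x. box_bump n a b x \<noteq> 0})"
proof -
  let ?a = "\<chi> j. a $ j + 1 / real n" and ?b = "\<chi> j. b $ j - 1 / real n"
  have "{x. box_bump n a b x \<noteq> 0} \<subseteq> cbox ?a ?b"
  proof
    fix x assume "x \<in> {x. box_bump n a b x \<noteq> 0}"
    then have "real n * x $ j + (- real n * a $ j - 1) > 0 \<and> - real n * x $ j + (real n * b $ j - 1) > 0" for j
      by (auto simp: box_bump_def exp_flat_def split: if_splits)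
    then have "a $ j + 1 / real n < x $ j \<and> x $ j < b $ j - 1 / real n" for j
      using n by (simp add: field_simps)
    then show "x \<in> cbox ?a ?b" by (auto simp: mem_box_cart less_imp_le)
  qed
  then have c: "closure {x. box_bump n a b x \<noteq> 0} \<subseteq> cbox ?a ?b"
    by (simp add: closure_minimal closed_cbox)
  have "cbox ?a ?b \<subseteq> box a b"
  proof
    fix x assume x: "x \<in> cbox ?a ?b"
    have p: "1 / real n > 0" using n by simp
    have "a $ j < x $ j \<and> x $ j < b $ j" for j
    proof -
      have "a $ j + 1 / real n \<le> x $ j \<and> x $ j \<le> b $ j - 1 / real n"
        using x[unfolded mem_box_cart, rule_format, of j] by simp
      then show ?thesis using p by linarith
    qed
    then show "x \<in> box a b" by (simp add: mem_box_cart)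
  qed
  with c show "closure {x. box_bump n a b x \<noteq> 0} \<subseteq> box a b" by blast
  show "compact (closure {x. box_bump n a b x \<noteq> 0})"
    using c by (meson bounded_cbox bounded_subset closed_closure compact_eq_bounded_closed)
qed

lemma box_bump_zero_outside: "x \<notin> box a b \<Longrightarrow> n > 0 \<Longrightarrow> box_bump n a b x = 0"
  using box_bump_support(1)[of n a b] zero_outside_support[of x "box_bump n a b"] by blast

lemma exp_flat_1_tendsto:
  assumes "filterlim f at_top F" shows "((\<lambda>n. exp_flat 1 (f n)) \<longlongrightarrow> 1) F"
proof -
  have "((\<lambda>n. exp (- inverse (f n))) \<longlongrightarrow> exp (- 0)) F"
    by (intro tendsto_intros tendsto_inverse_0_at_top assms)
  moreover have "\<forall>\<^sub>F n in F. exp (- inverse (f n)) = exp_flat 1 (f n)"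
    using filterlim_at_top_dense[THEN iffD1, OF assms, rule_format, of 0]
    by eventually_elim (auto simp: exp_flat_def field_simps)
  ultimately show ?thesis by (simp add: tendsto_cong)
qed

text \<open>Inside the box the arguments of \<open>exp_flat 1\<close> tend to infinity, where this function tends to 1.\<close>

lemma box_bump_tendsto: "(\<lambda>n. box_bump (Suc n) a b x) \<longlonglongrightarrow> indicator (box a b) x"
proof (cases "x \<in> box a b")
  case False
  have "box_bump (Suc n) a b x = 0" for n
    using False by (intro box_bump_zero_outside) auto
  then show ?thesis using False by simp
next
  case True
  have lim: "filterlim (\<lambda>n. real (Suc n) * c - 1) at_top sequentially" if "c > 0" for c
    using that by real_asymp
  have "(\<lambda>n. \<Prod>j\<in>UNIV. exp_flat 1 (real (Suc n) * (x $ j - a $ j) - 1) *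
      exp_flat 1 (real (Suc n) * (b $ j - x $ j) - 1)) \<longlonglongrightarrow> (\<Prod>j\<in>(UNIV::2 set). 1 * 1)"
    using True by (intro tendsto_prod tendsto_mult exp_flat_1_tendsto lim) (auto simp: mem_box_cart)
  then show ?thesis using True by (simp add: box_bump_def algebra_simps)
qed

lemma box_bump_nonzero:
  assumes "x \<in> box a b" shows "\<exists>n>0. box_bump n a b x \<noteq> 0"
proof -
  have "(\<lambda>n. box_bump (Suc n) a b x) \<longlonglongrightarrow> 1" using box_bump_tendsto[of a b x] assms by simp
  then have "\<forall>\<^sub>F n in sequentially. box_bump (Suc n) a b x > 0" by (rule order_tendstoD) simp
  then obtain n where "box_bump (Suc n) a b x > 0" by (auto simp: eventually_sequentially)
  then show ?thesis by (intro exI[of _ "Suc n"]) auto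
qed

lemma test_functions_iff: "\<phi> \<in> test_functions \<Omega> \<longleftrightarrow>
   smooth \<phi> \<and> compact (closure {x. \<phi> x \<noteq> 0}) \<and> closure {x. \<phi> x \<noteq> 0} \<subseteq> \<Omega>"
  by (simp add: test_functions_def smooth_def)

lemma compact_closure_subset: "compact S \<Longrightarrow> closure A \<subseteq> S \<Longrightarrow> compact (closure A)"
  using compact_Int_closed[of S "closure A"] by (simp add: inf_absorb2)

lemma test_functions_supportI:
  assumes "smooth \<psi>" "\<phi> \<in> test_functions \<Omega>" "\<And>x. x \<notin> closure {x. \<phi> x \<noteq> 0} \<Longrightarrow> \<psi> x = 0"
  shows "\<psi> \<in> test_functions \<Omega>"
proof -
  have "closure {x. \<psi> x \<noteq> 0} \<subseteq> closure {x. \<phi> x \<noteq> 0}"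
    using assms(3) by (intro closure_minimal) auto
  then show ?thesis using assms(1,2) compact_closure_subset unfolding test_functions_iff by blast
qed

lemma test_functions_zero_outside: "\<phi> \<in> test_functions \<Omega> \<Longrightarrow> x \<notin> \<Omega> \<Longrightarrow> \<phi> x = 0"
  unfolding test_functions_iff using zero_outside_support[of x \<phi>] by blast

lemma test_functions_partial_deriv:
  assumes "\<phi> \<in> test_functions \<Omega>" shows "partial_deriv i \<phi> \<in> test_functions \<Omega>"
proof (rule test_functions_supportI[OF _ assms])
  show "smooth (partial_deriv i \<phi>)" using assms by (simp add: test_functions_iff smooth_partial_deriv)
  show "partial_deriv i \<phi> x = 0" if "x \<notin> closure {x. \<phi> x \<noteq> 0}" for x
    by (rule partial_deriv_zero_outside[OF closed_closure zero_outside_support that])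
qed

lemma test_functions_mult:
  assumes "\<phi> \<in> test_functions \<Omega>" "smooth g" shows "(\<lambda>x. \<phi> x * g x) \<in> test_functions \<Omega>"
proof (rule test_functions_supportI[OF _ assms(1)])
  show "smooth (\<lambda>x. \<phi> x * g x)" using assms by (simp add: test_functions_iff smooth_mult)
  show "\<phi> x * g x = 0" if "x \<notin> closure {x. \<phi> x \<noteq> 0}" for x
    using zero_outside_support[OF that] by simp
qed

lemma test_functions_add:
  assumes "\<phi> \<in> test_functions \<Omega>" "\<psi> \<in> test_functions \<Omega>"
  shows "(\<lambda>x. \<phi> x + \<psi> x) \<in> test_functions \<Omega>"
proof -
  let ?S = "closure {x. \<phi> x \<noteq> 0} \<union> closure {x. \<psi> x \<noteq> 0}"
  have c: "compact ?S" "?S \<subseteq> \<Omega>" using assms by (auto simp: test_functions_iff)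
  have "{x. \<phi> x + \<psi> x \<noteq> 0} \<subseteq> ?S"
    using closure_subset[of "{x. \<phi> x \<noteq> 0}"] closure_subset[of "{x. \<psi> x \<noteq> 0}"] by force
  then have "closure {x. \<phi> x + \<psi> x \<noteq> 0} \<subseteq> ?S" by (intro closure_minimal) auto
  then show ?thesis using c assms compact_closure_subset[OF c(1)] unfolding test_functions_iff
    by (auto intro: smooth_add simp del: compact_closure)
qed

lemma continuous_compact_support_bounded:
  fixes f :: "real^2 \<Rightarrow> real"
  assumes "continuous_on UNIV f" "compact S" "\<And>x. x \<notin> S \<Longrightarrow> f x = 0"
  obtains C where "0 \<le> C" "\<And>x. \<bar>f x\<bar> \<le> C"
proof -
  have "compact (f ` S)"
    by (rule compact_continuous_image[OF continuous_on_subset[OF assms(1)] assms(2)]) simp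
  then obtain C where C: "C > 0" "\<And>x. x \<in> S \<Longrightarrow> \<bar>f x\<bar> \<le> C"
    using bounded_pos[of "f ` S"] compact_imp_bounded by auto
  have "\<bar>f x\<bar> \<le> C" for x using C assms(3)[of x] by (cases "x \<in> S") auto
  with that[of C] C show thesis by simp
qed

lemma continuous_compact_support_integrable:
  fixes f :: "real^2 \<Rightarrow> real"
  assumes "continuous_on UNIV f" "compact S" "\<And>x. x \<notin> S \<Longrightarrow> f x = 0"
  shows "integrable lborel f"
proof -
  have "integrable lborel (\<lambda>x. indicator S x *\<^sub>R f x)"
    by (rule borel_integrable_compact[OF assms(2) continuous_on_subset[OF assms(1)]]) simp
  also have "(\<lambda>x. indicator S x *\<^sub>R f x) = f"
    by (rule ext) (use assms(3) in \<open>auto simp: indicator_def\<close>)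
  finally show ?thesis .
qed

lemma continuous_compact_support_square_integrable:
  fixes f :: "real^2 \<Rightarrow> real"
  assumes "continuous_on UNIV f" "compact S" "\<And>x. x \<notin> S \<Longrightarrow> f x = 0"
  shows "square_integrable f"
proof -
  have "integrable lborel (\<lambda>x. (f x)\<^sup>2)"
    using assms by (intro continuous_compact_support_integrable[of _ S] continuous_intros) auto
  then show ?thesis using borel_measurable_continuous_onI[OF assms(1)] by (simp add: square_integrable_def)
qed

text \<open>By translation invariance every difference quotient of \<open>f\<close> has integral 0.  The difference quotients
converge to the partial derivative, dominated by its maximum on a ball around the support.\<close>

lemma integral_partial_deriv_eq_0:
  assumes diff: "\<And>x. f differentiable (at x)" and cont: "continuous_on UNIV (partial_deriv i f)"
    and S: "compact S" "\<And>x. x \<notin> S \<Longrightarrow> f x = 0"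
  shows "(LINT x|lborel. partial_deriv i f x) = 0"
proof -
  let ?e = "axis i (1::real) :: real^2"
  have cf: "continuous_on UNIV f"
    using diff by (simp add: continuous_on_eq_continuous_within differentiable_imp_continuous_within)
  have [measurable]: "f \<in> borel_measurable borel" "partial_deriv i f \<in> borel_measurable borel"
    using cf cont by (auto intro: borel_measurable_continuous_onI)
  have pd0: "partial_deriv i f x = 0" if "x \<notin> S" for x
    using S that by (intro partial_deriv_zero_outside[of S]) (auto intro: compact_imp_closed)
  obtain C where C: "0 \<le> C" "\<And>x. \<bar>partial_deriv i f x\<bar> \<le> C"
    using continuous_compact_support_bounded[OF cont S(1) pd0] by blast
  obtain r where r: "S \<subseteq> cball 0 r"
    using bounded_subset_ballD[OF compact_imp_bounded[OF S(1)], of 0] ball_subset_cball by blast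
  have DERIV: "((\<lambda>t. f (x + t *\<^sub>R ?e)) has_real_derivative partial_deriv i f (x + t *\<^sub>R ?e)) (at t)" for x t
  proof -
    have "((\<lambda>t. x + t *\<^sub>R ?e) has_derivative (\<lambda>h. h *\<^sub>R ?e)) (at t)"
      by (auto intro!: derivative_eq_intros)
    from has_derivative_compose[OF this has_derivative_frechet[OF diff]]
    have *: "((\<lambda>t. f (x + t *\<^sub>R ?e)) has_derivative (\<lambda>h. frechet_derivative f (at (x + t *\<^sub>R ?e)) (h *\<^sub>R ?e))) (at t)" .
    have "frechet_derivative f (at y) (h *\<^sub>R ?e) = partial_deriv i f y * h" for y h
      using linear_frechet_derivative[OF diff[of y]] by (simp add: linear_cmul partial_deriv_def)
    with * show ?thesis by (simp add: has_field_derivative_def)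
  qed
  define q where "q n x = real (Suc n) * (f (x + (1 / real (Suc n)) *\<^sub>R ?e) - f x)" for n x
  have "(\<lambda>n. LINT x|lborel. q n x) \<longlonglongrightarrow> (LINT x|lborel. partial_deriv i f x)"
  proof (rule integral_dominated_convergence[where w = "\<lambda>x. indicator (cball 0 (r + 1)) x *\<^sub>R C"])
    show "integrable lborel (\<lambda>x. indicator (cball (0::real^2) (r + 1)) x *\<^sub>R C)"
      by (intro borel_integrable_compact) auto
    show "q n \<in> borel_measurable lborel" for n unfolding q_def by measurable
    show "AE x in lborel. (\<lambda>n. q n x) \<longlonglongrightarrow> partial_deriv i f x"
    proof (rule AE_I2)
      fix x
      have "((\<lambda>h. (f (x + h *\<^sub>R ?e) - f x) / h) \<longlongrightarrow> partial_deriv i f x) (at 0)"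
        using DERIV[of x 0] by (simp add: has_field_derivative_iff)
      moreover have "filterlim (\<lambda>n. 1 / real (Suc n)) (at 0) sequentially"
        by (intro filterlim_atI LIMSEQ_Suc lim_1_over_n always_eventually) auto
      ultimately have "(\<lambda>n. (f (x + (1 / real (Suc n)) *\<^sub>R ?e) - f x) / (1 / real (Suc n))) \<longlonglongrightarrow> partial_deriv i f x"
        by (rule filterlim_compose)
      then show "(\<lambda>n. q n x) \<longlonglongrightarrow> partial_deriv i f x" by (simp add: q_def mult.commute)
    qed
    fix n
    have "\<bar>q n x\<bar> \<le> indicator (cball 0 (r + 1)) x *\<^sub>R C" for x
    proof (cases "x \<in> cball 0 (r + 1)")
      case True
      obtain s where "f (x + (1 / real (Suc n)) *\<^sub>R ?e) - f (x + 0 *\<^sub>R ?e) = (1 / real (Suc n) - 0) * partial_deriv i f (x + s *\<^sub>R ?e)"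
        using MVT2[of 0 "1 / real (Suc n)" "\<lambda>t. f (x + t *\<^sub>R ?e)" "\<lambda>t. partial_deriv i f (x + t *\<^sub>R ?e)"] DERIV by auto
      then have "q n x = partial_deriv i f (x + s *\<^sub>R ?e)" by (simp add: q_def)
      then show ?thesis using C True by simp
    next
      case False
      then have x: "norm x > r + 1" by simp
      have "norm x \<le> norm (x + (1 / real (Suc n)) *\<^sub>R ?e) + norm ((1 / real (Suc n)) *\<^sub>R ?e)"
        using norm_triangle_ineq4[of "x + (1 / real (Suc n)) *\<^sub>R ?e" "(1 / real (Suc n)) *\<^sub>R ?e"] by simp
      also have "norm ((1 / real (Suc n)) *\<^sub>R ?e) \<le> 1" by (simp add: norm_axis_1)
      finally have "x + (1 / real (Suc n)) *\<^sub>R ?e \<notin> S" "x \<notin> S" using x r by auto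
      then show ?thesis using S(2) False by (simp add: q_def)
    qed
    then show "AE x in lborel. norm (q n x) \<le> indicator (cball 0 (r + 1)) x *\<^sub>R C" by simp
  qed measurable
  moreover have "(LINT x|lborel. q n x) = 0" for n
  proof -
    let ?h = "(1 / real (Suc n)) *\<^sub>R ?e"
    have int: "integrable lborel f" using cf S by (rule continuous_compact_support_integrable)
    have "(LINT x|lborel. f x) = (LINT x|distr lborel borel ((+) ?h). f x)" by (simp only: lborel_distr_plus)
    also have "\<dots> = (LINT x|lborel. f (?h + x))" by (subst integral_distr) auto
    finally have "(LINT x|lborel. f (x + ?h)) = (LINT x|lborel. f x)" by (simp add: add.commute)
    moreover have "integrable lborel (\<lambda>x. f (x + ?h))"
    proof -
      have "integrable (distr lborel borel ((+) ?h)) f" using int by (simp only: lborel_distr_plus)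
      then show ?thesis by (subst (asm) integrable_distr_eq) (auto simp: add.commute)
    qed
    ultimately show ?thesis unfolding q_def using int by simp
  qed
  ultimately show ?thesis using LIMSEQ_unique by (simp add: LIMSEQ_const_iff)
qed

lemma test_functions_square_integrable:
  assumes "\<phi> \<in> test_functions \<Omega>" shows "square_integrable \<phi>"
  by (rule continuous_compact_support_square_integrable[OF _ _ zero_outside_support])
     (use assms in \<open>simp_all add: test_functions_iff smooth_continuous del: compact_closure\<close>)

lemma integral_test_function_partial_deriv_eq_0:
  assumes "\<phi> \<in> test_functions \<Omega>" shows "(LINT x|lborel. partial_deriv i \<phi> x) = 0"
  by (rule integral_partial_deriv_eq_0[OF _ _ _ zero_outside_support])
     (use assms in \<open>simp_all add: test_functions_iff smooth_continuous smooth_differentiable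
        smooth_partial_deriv del: compact_closure\<close>)

lemma integration_by_parts:
  assumes \<phi>: "\<phi> \<in> test_functions \<Omega>" and \<psi>: "\<psi> \<in> test_functions \<Omega>"
  shows "(LINT x|lborel. \<phi> x * partial_deriv i \<psi> x) = - (LINT x|lborel. partial_deriv i \<phi> x * \<psi> x)"
proof -
  have s: "smooth \<phi>" "smooth \<psi>" using assms by (auto simp: test_functions_iff)
  have "partial_deriv i (\<lambda>x. \<phi> x * \<psi> x) x = \<phi> x * partial_deriv i \<psi> x + partial_deriv i \<phi> x * \<psi> x" for x
    using s by (simp add: partial_deriv_mult smooth_differentiable)
  with integral_test_function_partial_deriv_eq_0[OF test_functions_mult[OF \<phi> s(2)], of i]
  have "(LINT x|lborel. \<phi> x * partial_deriv i \<psi> x + partial_deriv i \<phi> x * \<psi> x) = 0" by simp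
  moreover have "integrable lborel (\<lambda>x. \<phi> x * partial_deriv i \<psi> x)" "integrable lborel (\<lambda>x. partial_deriv i \<phi> x * \<psi> x)"
    by (intro square_integrable_mult test_functions_square_integrable[of _ \<Omega>] test_functions_partial_deriv assms)+
  ultimately show ?thesis by simp
qed

section \<open>Weak gradients\<close>

lemma box_bump_test_function:
  assumes "box a b \<subseteq> \<Omega>" "n > 0" shows "box_bump n a b \<in> test_functions \<Omega>"
  using box_bump_support[OF assms(2), of a b] assms(1) mixed_symmetric_box_bump[of n a b]
  unfolding test_functions_iff mixed_symmetric_def by blast

text \<open>The sets over which \<open>f\<close> has integral 0 form a Dynkin system; it contains the boxes and therefore all
Borel sets, in particular the sets where \<open>f\<close> is positive or negative.\<close>

lemma AE_eq_0_if_box_integrals_eq_0: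
  fixes f :: "real^2 \<Rightarrow> real"
  assumes f: "integrable lborel f" and total: "(LINT x|lborel. f x) = 0"
    and boxes: "\<And>a b. (LINT x:box a b|lborel. f x) = 0"
  shows "AE x in lborel. f x = 0"
proof -
  have si: "set_integrable lborel A f" if "A \<in> sets borel" for A
    using that f unfolding set_integrable_def by (intro integrable_mult_indicator) auto
  have zero: "(LINT x:A|lborel. f x) = 0" if "A \<in> sets borel" for A
  proof -
    let ?G = "range (\<lambda>(a, b). box a b :: (real^2) set)"
    have "Int_stable ?G" by (auto simp: Int_stable_def box_Int_box)
    moreover have "?G \<subseteq> Pow UNIV" by auto
    moreover have "A \<in> sigma_sets UNIV ?G" using that unfolding borel_eq_box by simp
    ultimately show ?thesis
    proof (induction rule: sigma_sets_induct_disjoint)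
      case (basic A) then show ?case using boxes by auto
    next
      case empty then show ?case by (simp add: set_lebesgue_integral_def)
    next
      case (compl A)
      then have A: "A \<in> sets borel" unfolding borel_eq_box by simp
      have "(LINT x:A \<union> (UNIV - A)|lborel. f x) = (LINT x:A|lborel. f x) + (LINT x:UNIV - A|lborel. f x)"
        using A si by (intro set_integral_Un) auto
      then show ?case using compl total by (simp add: set_lebesgue_integral_def)
    next
      case (union A)
      then have A: "A i \<in> sets borel" for i unfolding borel_eq_box by auto
      have "(LINT x:(\<Union>i. A i)|lborel. f x) = (\<Sum>i. (LINT x:A i|lborel. f x))"
        using union A si by (intro lebesgue_integral_countable_add) (auto simp: disjoint_family_on_def)
      then show ?case using union by simp
    qed
  qed
  have [measurable]: "f \<in> borel_measurable borel" using f by auto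
  have M: "{x. f x > 0} \<in> sets borel" "{x. f x < 0} \<in> sets borel" by measurable
  have "AE x in lborel. indicator {x. f x > 0} x *\<^sub>R f x = 0"
    using zero[OF M(1)] si[OF M(1)] unfolding set_lebesgue_integral_def set_integrable_def
    by (intro integral_nonneg_eq_0_iff_AE[THEN iffD1]) (auto simp: indicator_def)
  moreover have "AE x in lborel. - (indicator {x. f x < 0} x *\<^sub>R f x) = 0"
    using zero[OF M(2)] si[OF M(2)] unfolding set_lebesgue_integral_def set_integrable_def
    by (intro integral_nonneg_eq_0_iff_AE[THEN iffD1]) (auto simp: indicator_def)
  ultimately show ?thesis
  proof eventually_elim
    case (elim x)
    then show ?case by (cases "f x" "0::real" rule: linorder_cases) auto
  qed
qed

lemma inner_abs_L2_right:
  assumes "square_integrable f" shows "inner u (abs_L2 f) = (LINT x|lborel. rep_L2 u x * f x)"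
  using inner_abs_L2[OF square_integrable_rep_L2[of u] assms] by (simp add: abs_rep_L2)

lemma square_integrable_indicator_box: "square_integrable (indicator (box a b) :: real^2 \<Rightarrow> real)"
proof -
  have "(indicator (box a b) x :: real)\<^sup>2 = indicator (box a b) x" for x :: "real^2"
    by (simp add: indicator_def)
  moreover have "integrable lborel (indicator (box a b) :: real^2 \<Rightarrow> real)"
    by (intro integrable_real_indicator emeasure_bounded_finite) auto
  ultimately show ?thesis by (simp add: square_integrable_def)
qed

text \<open>The fundamental lemma of the calculus of variations: the bump functions of a box inside \<open>\<Omega>\<close> converge to
its indicator function, so \<open>w\<close> has integral 0 over all such boxes.\<close>

lemma L2_on_eq_0_if_orthogonal_test_functions:
  assumes "open \<Omega>" "w \<in> L2_on \<Omega>" and orth: "\<And>\<phi>. \<phi> \<in> test_functions \<Omega> \<Longrightarrow> inner w (abs_L2 \<phi>) = 0"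
  shows "w = 0"
proof -
  let ?w = "rep_L2 w"
  have wint: "integrable lborel (\<lambda>x. ?w x * indicator (box a b) x)" for a b
    by (intro square_integrable_mult square_integrable_rep_L2 square_integrable_indicator_box)
  have box0: "(LINT x|lborel. ?w x * indicator (box a b) x) = 0" if "box a b \<subseteq> \<Omega>" for a b
  proof -
    have [measurable]: "box_bump (Suc n) a b \<in> borel_measurable borel" for n
      using mixed_symmetric_box_bump[of "Suc n" a b]
      by (auto simp: mixed_symmetric_def intro: borel_measurable_continuous_onI smooth_continuous)
    have "(\<lambda>n. LINT x|lborel. ?w x * box_bump (Suc n) a b x) \<longlonglongrightarrow> (LINT x|lborel. ?w x * indicator (box a b) x)"
    proof (rule integral_dominated_convergence[where w = "\<lambda>x. norm (?w x * indicator (box a b) x)"])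
      show "AE x in lborel. (\<lambda>n. ?w x * box_bump (Suc n) a b x) \<longlonglongrightarrow> ?w x * indicator (box a b) x"
        by (intro AE_I2 tendsto_intros box_bump_tendsto)
      have "\<bar>box_bump (Suc n) a b x\<bar> \<le> indicator (box a b) x" for n x
        using box_bump_bounds[of "Suc n" a b x] box_bump_zero_outside[of x a b "Suc n"]
        by (cases "x \<in> box a b") auto
      then show "AE x in lborel. norm (?w x * box_bump (Suc n) a b x) \<le> norm (?w x * indicator (box a b) x)" for n
        by (intro AE_I2) (simp add: abs_mult mult_left_mono)
    qed (use wint in auto)
    moreover have "(LINT x|lborel. ?w x * box_bump (Suc n) a b x) = 0" for n
    proof -
      have t: "box_bump (Suc n) a b \<in> test_functions \<Omega>" using that by (intro box_bump_test_function) auto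
      show ?thesis using orth[OF t] inner_abs_L2_right[OF test_functions_square_integrable[OF t], of w] by simp
    qed
    ultimately show ?thesis by (simp add: LIMSEQ_const_iff)
  qed
  have boxAE: "AE x in lborel. x \<in> box a b \<longrightarrow> ?w x = 0" if ab: "box a b \<subseteq> \<Omega>" for a b
  proof -
    have "AE x in lborel. ?w x * indicator (box a b) x = 0"
    proof (rule AE_eq_0_if_box_integrals_eq_0[OF wint box0[OF ab]])
      fix c d :: "real^2"
      obtain p q where pq: "box a b \<inter> box c d = box p q" using box_Int_box by blast
      have "(LINT x:box c d|lborel. ?w x * indicator (box a b) x) = (LINT x|lborel. ?w x * indicator (box p q) x)"
        unfolding set_lebesgue_integral_def pq[symmetric] by (intro Bochner_Integration.integral_cong) (auto simp: indicator_def)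
      also have "\<dots> = 0" using ab pq by (intro box0) auto
      finally show "(LINT x:box c d|lborel. ?w x * indicator (box a b) x) = 0" .
    qed
    then show ?thesis by eventually_elim (auto simp: indicator_def split: if_splits)
  qed
  obtain \<D> where D: "countable \<D>" "\<D> \<subseteq> Pow \<Omega>" "\<And>X. X \<in> \<D> \<Longrightarrow> \<exists>a b. X = box a b" "\<Union>\<D> = \<Omega>"
    using open_countable_Union_open_box[OF assms(1)] by metis
  have "AE x in lborel. \<forall>X\<in>\<D>. x \<in> X \<longrightarrow> ?w x = 0"
    using D(1)
  proof (subst AE_ball_countable, simp, intro ballI)
    fix X assume X: "X \<in> \<D>"
    then obtain a b where "X = box a b" using D(3) by blast
    then show "AE x in lborel. x \<in> X \<longrightarrow> ?w x = 0" using boxAE[of a b] X D(2) by auto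
  qed
  moreover have "AE x in lborel. x \<notin> \<Omega> \<longrightarrow> ?w x = 0" using assms(2) by (simp add: L2_on_def)
  ultimately have "AE x in lborel. rep_L2 w x = rep_L2 0 x"
    using rep_L2_zero by eventually_elim (use D(4) in auto)
  then show ?thesis by (rule L2_eqI)
qed

text \<open>This describes \<open>L2_on \<Omega>\<close> as the kernel of a bounded operator, so that it is a closed subspace.\<close>

lemma L2_on_iff_mult_L2:
  assumes "\<Omega> \<in> sets borel"
  shows "u \<in> L2_on \<Omega> \<longleftrightarrow> mult_L2 (indicator (- \<Omega>)) u = 0"
proof -
  have [measurable]: "\<Omega> \<in> sets borel" by fact
  have ae: "AE x in lborel. rep_L2 (mult_L2 (indicator (- \<Omega>)) u) x = indicator (- \<Omega>) x * rep_L2 u x"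
    by (rule rep_mult_L2[where C = 1]) (auto simp: indicator_def)
  show ?thesis
  proof
    assume "u \<in> L2_on \<Omega>"
    then have "AE x in lborel. x \<notin> \<Omega> \<longrightarrow> rep_L2 u x = 0" by (simp add: L2_on_def)
    with ae rep_L2_zero have "AE x in lborel. rep_L2 (mult_L2 (indicator (- \<Omega>)) u) x = rep_L2 0 x"
      by eventually_elim (auto simp: indicator_def)
    then show "mult_L2 (indicator (- \<Omega>)) u = 0" by (rule L2_eqI)
  next
    assume "mult_L2 (indicator (- \<Omega>)) u = 0"
    with ae rep_L2_zero have "AE x in lborel. x \<notin> \<Omega> \<longrightarrow> rep_L2 u x = 0"
      by (auto elim: eventually_elim2)
    then show "u \<in> L2_on \<Omega>" by (simp add: L2_on_def)
  qed
qed

lemma bounded_linear_mult_L2_indicator: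
  assumes "A \<in> sets borel" shows "bounded_linear (mult_L2 (indicator A))"
  using assms by (intro bounded_linear_mult_L2[where C = 1]) (auto simp: indicator_def)

lemma closed_L2_on:
  assumes O: "\<Omega> \<in> sets borel" shows "closed (L2_on \<Omega>)"
proof -
  from O have "continuous_on UNIV (mult_L2 (indicator (- \<Omega>)))"
    by (intro linear_continuous_on bounded_linear_mult_L2_indicator) auto
  then have "closed {u. mult_L2 (indicator (- \<Omega>)) u = 0}"
    by (intro closed_Collect_eq continuous_on_const)
  moreover have "L2_on \<Omega> = {u. mult_L2 (indicator (- \<Omega>)) u = 0}" using L2_on_iff_mult_L2[OF O] by blast
  ultimately show ?thesis by simp
qed

lemma subspace_L2_on: assumes "\<Omega> \<in> sets borel" shows "subspace (L2_on \<Omega>)"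
proof -
  have "bounded_linear (mult_L2 (indicator (- \<Omega>)))"
    using assms by (intro bounded_linear_mult_L2_indicator) auto
  then interpret bounded_linear "mult_L2 (indicator (- \<Omega>))" .
  have "L2_on \<Omega> = {u. mult_L2 (indicator (- \<Omega>)) u = 0}" using L2_on_iff_mult_L2[OF assms] by blast
  then show ?thesis by (simp add: subspace_def zero add scale)
qed

lemma test_function_in_L2_on:
  assumes "\<phi> \<in> test_functions \<Omega>" shows "abs_L2 \<phi> \<in> L2_on \<Omega>"
  unfolding L2_on_def using rep_abs_L2[OF test_functions_square_integrable[OF assms]]
  by (auto elim!: eventually_mono simp: test_functions_zero_outside[OF assms])

lemma set_integral_test_function:
  assumes "\<phi> \<in> test_functions \<Omega>"
  shows "(LINT x:\<Omega>|lborel. rep_L2 u x * \<phi> x) = inner u (abs_L2 \<phi>)"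
  unfolding set_lebesgue_integral_def inner_abs_L2_right[OF test_functions_square_integrable[OF assms]]
  by (intro Bochner_Integration.integral_cong) (auto simp: indicator_def test_functions_zero_outside[OF assms])

text \<open>Test functions vanish outside \<open>\<Omega>\<close>, so the integrals over \<open>\<Omega>\<close> in the definition are inner products.\<close>

lemma is_weak_gradient_iff:
  "is_weak_gradient \<Omega> u g \<longleftrightarrow> (\<forall>i. g $ i \<in> L2_on \<Omega>) \<and>
     (\<forall>\<phi>\<in>test_functions \<Omega>. \<forall>i. inner u (abs_L2 (partial_deriv i \<phi>)) = - inner (g $ i) (abs_L2 \<phi>))"
  unfolding is_weak_gradient_def
  by (simp add: set_integral_test_function test_functions_partial_deriv)

lemma weak_gradient_eqI:
  assumes "open \<Omega>" "is_weak_gradient \<Omega> u g"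
  shows "weak_gradient \<Omega> u = g"
  unfolding weak_gradient_def
proof (rule the_equality)
  show "is_weak_gradient \<Omega> u g" by fact
  fix h assume h: "is_weak_gradient \<Omega> u h"
  have "h $ i - g $ i = 0" for i
  proof (rule L2_on_eq_0_if_orthogonal_test_functions[OF assms(1)])
    show "h $ i - g $ i \<in> L2_on \<Omega>"
      using h assms by (auto simp: is_weak_gradient_iff intro!: subspace_diff subspace_L2_on)
    show "inner (h $ i - g $ i) (abs_L2 \<phi>) = 0" if "\<phi> \<in> test_functions \<Omega>" for \<phi>
      using h assms(2) that by (auto simp: is_weak_gradient_iff inner_diff_left)
  qed
  then show "h = g" by (simp add: vec_eq_iff)
qed

text \<open>The graph of the gradient on test functions.  Its closure is the graph of the weak gradient on \<open>H01 \<Omega>\<close>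
(lemmas \<open>H01_iff_closure_test_graph\<close> and \<open>closure_test_graph_D\<close>), so that properties of \<open>H01 \<Omega>\<close>
follow from closed conditions checked on test functions.\<close>

definition test_graph :: "(real^2) set \<Rightarrow> (L2 \<times> (L2^2)) set" where
  "test_graph \<Omega> = (\<lambda>\<phi>. (abs_L2 \<phi>, \<chi> i. abs_L2 (partial_deriv i \<phi>))) ` test_functions \<Omega>"

lemma is_weak_gradient_test_function:
  assumes \<phi>: "\<phi> \<in> test_functions \<Omega>"
  shows "is_weak_gradient \<Omega> (abs_L2 \<phi>) (\<chi> i. abs_L2 (partial_deriv i \<phi>))"
  unfolding is_weak_gradient_iff
proof (intro conjI allI ballI)
  show "(\<chi> i. abs_L2 (partial_deriv i \<phi>)) $ i \<in> L2_on \<Omega>" for i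
    using \<phi> by (simp add: test_function_in_L2_on test_functions_partial_deriv)
  fix \<psi> i assume \<psi>: "\<psi> \<in> test_functions \<Omega>"
  show "inner (abs_L2 \<phi>) (abs_L2 (partial_deriv i \<psi>)) = - inner ((\<chi> i. abs_L2 (partial_deriv i \<phi>)) $ i) (abs_L2 \<psi>)"
    using integration_by_parts[OF \<phi> \<psi>, of i] \<phi> \<psi>
    by (simp add: inner_abs_L2 test_functions_square_integrable[of _ \<Omega>] test_functions_partial_deriv)
qed

lemma is_weak_gradient_closure_test_graph:
  assumes "open \<Omega>" "(u, g) \<in> closure (test_graph \<Omega>)"
  shows "u \<in> L2_on \<Omega>" "is_weak_gradient \<Omega> u g"
proof -
  let ?C = "{p. fst p \<in> L2_on \<Omega> \<and> (\<forall>i. snd p $ i \<in> L2_on \<Omega>) \<and>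
     (\<forall>\<phi> i. \<phi> \<in> test_functions \<Omega> \<longrightarrow>
        inner (fst p) (abs_L2 (partial_deriv i \<phi>)) + inner (snd p $ i) (abs_L2 \<phi>) = 0)}"
  have O: "closed (L2_on \<Omega>)" using assms(1) by (intro closed_L2_on) auto
  \<comment> \<open>both memberships and the weak gradient identity are closed conditions, which hold on the test graph\<close>
  have "closed ?C"
    by (intro closed_Collect_conj closed_Collect_all closed_Collect_imp open_Collect_const closed_Collect_eq
        closed_vimage_fst[OF O, unfolded vimage_def] continuous_closed_vimage[OF O, unfolded vimage_def] continuous_intros)
  moreover have "test_graph \<Omega> \<subseteq> ?C"
    using is_weak_gradient_test_function[of _ \<Omega>] unfolding test_graph_def
    by (auto simp: is_weak_gradient_iff test_function_in_L2_on)
  ultimately have "(u, g) \<in> ?C" using assms(2) closure_minimal by blast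
  then show "u \<in> L2_on \<Omega>" "is_weak_gradient \<Omega> u g" by (auto simp: is_weak_gradient_iff add_eq_0_iff2)
qed

lemma is_weak_gradient_diff:
  assumes "open \<Omega>" "is_weak_gradient \<Omega> u g" "is_weak_gradient \<Omega> v h"
  shows "is_weak_gradient \<Omega> (u - v) (g - h)"
  using assms unfolding is_weak_gradient_iff
  by (auto simp: inner_diff_left intro!: subspace_diff subspace_L2_on)

lemma H01_iff_closure_test_graph:
  assumes "open \<Omega>"
  shows "u \<in> H01 \<Omega> \<longleftrightarrow> (u, weak_gradient \<Omega> u) \<in> closure (test_graph \<Omega>)"
proof -
  have approx: "H1_norm \<Omega> (u - abs_L2 \<phi>) = dist (abs_L2 \<phi>, \<chi> i. abs_L2 (partial_deriv i \<phi>)) (u, g)"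
    if g: "is_weak_gradient \<Omega> u g" and \<phi>: "\<phi> \<in> test_functions \<Omega>" for g \<phi>
  proof -
    have "weak_gradient \<Omega> (u - abs_L2 \<phi>) = g - (\<chi> i. abs_L2 (partial_deriv i \<phi>))"
      by (intro weak_gradient_eqI is_weak_gradient_diff is_weak_gradient_test_function assms g \<phi>)
    then show ?thesis by (simp add: H1_norm_def dist_norm norm_Pair norm_minus_commute)
  qed
  show ?thesis
  proof
    assume u: "u \<in> H01 \<Omega>"
    then obtain g where g: "is_weak_gradient \<Omega> u g" by (auto simp: H01_def H1_def)
    have "\<exists>y\<in>test_graph \<Omega>. dist y (u, g) < e" if "e > 0" for e
      using u that approx[OF g] unfolding H01_def test_graph_def by fastforce
    then show "(u, weak_gradient \<Omega> u) \<in> closure (test_graph \<Omega>)"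
      unfolding weak_gradient_eqI[OF assms g] closure_approachable by blast
  next
    assume c: "(u, weak_gradient \<Omega> u) \<in> closure (test_graph \<Omega>)"
    note w = is_weak_gradient_closure_test_graph[OF assms c]
    have "\<exists>\<phi>\<in>test_functions \<Omega>. H1_norm \<Omega> (u - abs_L2 \<phi>) < e" if "e > 0" for e
      using c that approx[OF w(2)] unfolding closure_approachable test_graph_def by fastforce
    then show "u \<in> H01 \<Omega>" using w by (auto simp: H01_def H1_def)
  qed
qed

lemma closure_test_graph_D:
  assumes "open \<Omega>" "(u, g) \<in> closure (test_graph \<Omega>)"
  shows "u \<in> H01 \<Omega>" "weak_gradient \<Omega> u = g"
  using assms weak_gradient_eqI is_weak_gradient_closure_test_graph(2) H01_iff_closure_test_graph by metis+

lemma subspace_closure: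
  fixes S :: "'a::real_normed_vector set"
  assumes "subspace S" shows "subspace (closure S)"
  unfolding subspace_def
proof (intro conjI ballI allI)
  show "0 \<in> closure S" using subspace_0[OF assms] closure_subset by blast
  fix x y assume "x \<in> closure S" "y \<in> closure S"
  then obtain a b where "\<And>n. a n \<in> S" "a \<longlonglongrightarrow> x" "\<And>n. b n \<in> S" "b \<longlonglongrightarrow> y"
    unfolding closure_sequential by blast
  then show "x + y \<in> closure S"
    unfolding closure_sequential using assms
    by (intro exI[of _ "\<lambda>n. a n + b n"]) (auto intro: tendsto_add subspace_add)
next
  fix c x assume "x \<in> closure S"
  then obtain a where "\<And>n. a n \<in> S" "a \<longlonglongrightarrow> x" unfolding closure_sequential by blast
  then show "c *\<^sub>R x \<in> closure S"
    unfolding closure_sequential using assms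
    by (intro exI[of _ "\<lambda>n. c *\<^sub>R a n"]) (auto intro: tendsto_scaleR subspace_scale)
qed

lemma subspace_test_graph: "subspace (test_graph \<Omega>)"
  unfolding subspace_def test_graph_def
proof (intro conjI ballI allI)
  have z: "(\<lambda>_. 0) \<in> test_functions \<Omega>" by (simp add: test_functions_iff smooth_const)
  then show "0 \<in> (\<lambda>\<phi>. (abs_L2 \<phi>, \<chi> i. abs_L2 (partial_deriv i \<phi>))) ` test_functions \<Omega>"
    by (intro image_eqI[of _ _ "\<lambda>_. 0"])
       (simp_all add: partial_deriv_const vec_eq_iff prod_eq_iff flip: zero_L2.abs_eq)
  fix x y assume "x \<in> (\<lambda>\<phi>. (abs_L2 \<phi>, \<chi> i. abs_L2 (partial_deriv i \<phi>))) ` test_functions \<Omega>"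
    "y \<in> (\<lambda>\<phi>. (abs_L2 \<phi>, \<chi> i. abs_L2 (partial_deriv i \<phi>))) ` test_functions \<Omega>"
  then obtain \<phi> \<psi> where \<phi>: "\<phi> \<in> test_functions \<Omega>" "x = (abs_L2 \<phi>, \<chi> i. abs_L2 (partial_deriv i \<phi>))"
    and \<psi>: "\<psi> \<in> test_functions \<Omega>" "y = (abs_L2 \<psi>, \<chi> i. abs_L2 (partial_deriv i \<psi>))" by blast
  have p: "partial_deriv i (\<lambda>x. \<phi> x + \<psi> x) = (\<lambda>x. partial_deriv i \<phi> x + partial_deriv i \<psi> x)" for i
    using \<phi> \<psi> by (intro ext partial_deriv_add smooth_differentiable) (auto simp: test_functions_iff)
  show "x + y \<in> (\<lambda>\<phi>. (abs_L2 \<phi>, \<chi> i. abs_L2 (partial_deriv i \<phi>))) ` test_functions \<Omega>"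
  proof (rule image_eqI)
    show "(\<lambda>x. \<phi> x + \<psi> x) \<in> test_functions \<Omega>" using \<phi> \<psi> by (intro test_functions_add)
    show "x + y = (abs_L2 (\<lambda>x. \<phi> x + \<psi> x), \<chi> i. abs_L2 (partial_deriv i (\<lambda>x. \<phi> x + \<psi> x)))"
      using \<phi> \<psi> unfolding p
      by (simp add: vec_eq_iff abs_L2_add test_functions_square_integrable[of _ \<Omega>] test_functions_partial_deriv)
  qed
next
  fix c x assume "x \<in> (\<lambda>\<phi>. (abs_L2 \<phi>, \<chi> i. abs_L2 (partial_deriv i \<phi>))) ` test_functions \<Omega>"
  then obtain \<phi> where \<phi>: "\<phi> \<in> test_functions \<Omega>" "x = (abs_L2 \<phi>, \<chi> i. abs_L2 (partial_deriv i \<phi>))" by blast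
  have p: "partial_deriv i (\<lambda>x. \<phi> x * c) = (\<lambda>x. c * partial_deriv i \<phi> x)" for i
    using \<phi> partial_deriv_mult[of \<phi> _ "\<lambda>_. c" i]
    by (auto simp: test_functions_iff smooth_differentiable partial_deriv_const)
  show "c *\<^sub>R x \<in> (\<lambda>\<phi>. (abs_L2 \<phi>, \<chi> i. abs_L2 (partial_deriv i \<phi>))) ` test_functions \<Omega>"
  proof (rule image_eqI)
    show "(\<lambda>x. \<phi> x * c) \<in> test_functions \<Omega>" using \<phi> by (intro test_functions_mult smooth_const)
    show "c *\<^sub>R x = (abs_L2 (\<lambda>x. \<phi> x * c), \<chi> i. abs_L2 (partial_deriv i (\<lambda>x. \<phi> x * c)))"
      using \<phi> unfolding p
      by (simp add: vec_eq_iff mult.commute[of _ c] abs_L2_scale test_functions_square_integrable[of _ \<Omega>] test_functions_partial_deriv)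
  qed
qed

lemma norm_abs_L2_le:
  assumes "square_integrable f" "square_integrable g" "0 \<le> C" "\<And>x. \<bar>f x\<bar> \<le> C * \<bar>g x\<bar>"
  shows "norm (abs_L2 f) \<le> C * norm (abs_L2 g)"
proof -
  have n: "(norm (abs_L2 h))\<^sup>2 = (LINT x|lborel. (h x)\<^sup>2)" if "square_integrable h" for h
    using inner_abs_L2[OF that that] by (simp add: power2_norm_eq_inner power2_eq_square[of "h _"])
  have "(LINT x|lborel. (f x)\<^sup>2) \<le> (LINT x|lborel. C\<^sup>2 * (g x)\<^sup>2)"
  proof (rule integral_mono)
    show "(f x)\<^sup>2 \<le> C\<^sup>2 * (g x)\<^sup>2" for x
      using power_mono[OF assms(4)[of x], of 2] by (simp add: power_mult_distrib)
  qed (use assms in \<open>auto simp: square_integrable_def\<close>)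
  then have "(norm (abs_L2 f))\<^sup>2 \<le> (C * norm (abs_L2 g))\<^sup>2"
    using assms by (simp add: n power_mult_distrib)
  then show ?thesis using assms(3) by (auto dest: power2_le_imp_le)
qed

text \<open>Integration by parts applied to \<open>\<psi> x = \<phi> x * x $ 1\<close> gives
\<open>\<integral> \<phi>\<^sup>2 = - 2 * \<integral> \<psi> * \<partial>\<^sub>1 \<phi>\<close>, and \<open>\<bar>\<psi>\<bar> \<le> R * \<bar>\<phi>\<bar>\<close>.\<close>

lemma Poincare_test_function:
  assumes R: "0 \<le> R" "\<Omega> \<subseteq> cball 0 R" and \<phi>: "\<phi> \<in> test_functions \<Omega>"
  shows "norm (abs_L2 \<phi>) \<le> 2 * R * norm (abs_L2 (partial_deriv 1 \<phi>))"
proof -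
  define \<psi> where "\<psi> x = \<phi> x * x $ 1" for x
  have s: "smooth \<phi>" using \<phi> by (simp add: test_functions_iff)
  have \<psi>: "\<psi> \<in> test_functions \<Omega>" unfolding \<psi>_def by (intro test_functions_mult smooth_component \<phi>)
  have sq: "square_integrable \<phi>" "square_integrable \<psi>" "square_integrable (partial_deriv 1 \<phi>)"
    using \<phi> \<psi> by (auto intro: test_functions_square_integrable[of _ \<Omega>] test_functions_partial_deriv)
  have c: "partial_deriv 1 (\<lambda>x. x $ 1) x = 1" for x :: "real^2"
    using partial_deriv_eqI[OF bounded_linear_imp_has_derivative[OF bounded_linear_vec_nth[of 1]]]
    by (simp add: axis_def)
  have p: "partial_deriv 1 \<psi> = (\<lambda>x. \<phi> x + partial_deriv 1 \<phi> x * x $ 1)"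
    unfolding \<psi>_def
    by (rule ext, subst partial_deriv_mult) (auto simp: c s smooth_differentiable smooth_component)
  have "(LINT x|lborel. \<psi> x * partial_deriv 1 \<phi> x) = - (LINT x|lborel. partial_deriv 1 \<psi> x * \<phi> x)"
    by (rule integration_by_parts[OF \<psi> \<phi>])
  also have "(LINT x|lborel. partial_deriv 1 \<psi> x * \<phi> x) = (LINT x|lborel. \<phi> x * \<phi> x + \<psi> x * partial_deriv 1 \<phi> x)"
    unfolding p \<psi>_def by (intro Bochner_Integration.integral_cong) (auto simp: algebra_simps)
  also have "\<dots> = (LINT x|lborel. \<phi> x * \<phi> x) + (LINT x|lborel. \<psi> x * partial_deriv 1 \<phi> x)"
    using sq by (intro Bochner_Integration.integral_add square_integrable_mult)
  finally have "(norm (abs_L2 \<phi>))\<^sup>2 = - 2 * inner (abs_L2 \<psi>) (abs_L2 (partial_deriv 1 \<phi>))"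
    using sq by (simp add: power2_norm_eq_inner inner_abs_L2)
  also have "\<dots> \<le> 2 * (norm (abs_L2 \<psi>) * norm (abs_L2 (partial_deriv 1 \<phi>)))"
    using Cauchy_Schwarz_ineq2[of "abs_L2 \<psi>" "abs_L2 (partial_deriv 1 \<phi>)"] by linarith
  also have "norm (abs_L2 \<psi>) \<le> R * norm (abs_L2 \<phi>)"
  proof (rule norm_abs_L2_le)
    show "\<bar>\<psi> x\<bar> \<le> R * \<bar>\<phi> x\<bar>" for x
    proof (cases "x \<in> \<Omega>")
      case True
      then have "\<bar>x $ 1\<bar> \<le> R" using R component_le_norm_cart[of x 1] by auto
      then show ?thesis by (simp add: \<psi>_def abs_mult mult.commute[of "\<bar>\<phi> x\<bar>"] mult_right_mono)
    qed (use test_functions_zero_outside[OF \<phi>] in \<open>simp add: \<psi>_def\<close>)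
  qed (use sq R in auto)
  finally have "norm (abs_L2 \<phi>) * norm (abs_L2 \<phi>) \<le> (2 * R * norm (abs_L2 (partial_deriv 1 \<phi>))) * norm (abs_L2 \<phi>)"
    by (simp add: power2_eq_square mult_ac mult_right_mono)
  then show ?thesis
    using R by (cases "abs_L2 \<phi> = 0") auto
qed

lemma Poincare_H01:
  assumes "open \<Omega>" "bounded \<Omega>"
  obtains C where "0 < C" "\<And>u. u \<in> H01 \<Omega> \<Longrightarrow> norm u \<le> C * norm (weak_gradient \<Omega> u)"
proof -
  obtain R where R: "R > 0" "\<Omega> \<subseteq> cball 0 R"
    using bounded_subset_ballD[OF assms(2), of 0] ball_subset_cball by blast
  let ?S = "{p::L2 \<times> (L2^2). norm (fst p) \<le> 2 * R * norm (snd p)}"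
  have "closed ?S" by (intro closed_Collect_le continuous_intros)
  moreover have "test_graph \<Omega> \<subseteq> ?S"
  proof -
    have "norm (abs_L2 \<phi>) \<le> 2 * R * norm (\<chi> i. abs_L2 (partial_deriv i \<phi>))" if "\<phi> \<in> test_functions \<Omega>" for \<phi>
    proof -
      have "norm (abs_L2 (partial_deriv 1 \<phi>)) \<le> norm (\<chi> i. abs_L2 (partial_deriv i \<phi>))"
        using Finite_Cartesian_Product.norm_nth_le[of "\<chi> i. abs_L2 (partial_deriv i \<phi>)" 1] by simp
      then have "2 * R * norm (abs_L2 (partial_deriv 1 \<phi>)) \<le> 2 * R * norm (\<chi> i. abs_L2 (partial_deriv i \<phi>))"
        using R by (intro mult_left_mono) auto
      with Poincare_test_function[OF _ R(2) that] R show ?thesis by (meson less_imp_le order_trans)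
    qed
    then show ?thesis by (auto simp: test_graph_def)
  qed
  ultimately have "closure (test_graph \<Omega>) \<subseteq> ?S" by (rule closure_minimal[rotated])
  then have "norm u \<le> 2 * R * norm (weak_gradient \<Omega> u)" if "u \<in> H01 \<Omega>" for u
    using that H01_iff_closure_test_graph[OF assms(1)] by fastforce
  with that[of "2 * R"] R show thesis by simp
qed

lemma
  assumes "open \<Omega>"
  shows subspace_H01: "subspace (H01 \<Omega>)"
    and weak_gradient_add: "u \<in> H01 \<Omega> \<Longrightarrow> v \<in> H01 \<Omega> \<Longrightarrow>
          weak_gradient \<Omega> (u + v) = weak_gradient \<Omega> u + weak_gradient \<Omega> v"
    and weak_gradient_scale: "u \<in> H01 \<Omega> \<Longrightarrow> weak_gradient \<Omega> (c *\<^sub>R u) = c *\<^sub>R weak_gradient \<Omega> u"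
proof -
  note cl = H01_iff_closure_test_graph[OF assms] and D = closure_test_graph_D[OF assms]
  have S: "subspace (closure (test_graph \<Omega>))" by (intro subspace_closure subspace_test_graph)
  have a: "(u + v, weak_gradient \<Omega> u + weak_gradient \<Omega> v) \<in> closure (test_graph \<Omega>)"
    if "u \<in> H01 \<Omega>" "v \<in> H01 \<Omega>" for u v
    using subspace_add[OF S] that cl by (metis add_Pair)
  have s: "(c *\<^sub>R u, c *\<^sub>R weak_gradient \<Omega> u) \<in> closure (test_graph \<Omega>)" if "u \<in> H01 \<Omega>" for u c
    using subspace_scale[OF S] that cl by (metis scaleR_Pair)
  show "u \<in> H01 \<Omega> \<Longrightarrow> v \<in> H01 \<Omega> \<Longrightarrow> weak_gradient \<Omega> (u + v) = weak_gradient \<Omega> u + weak_gradient \<Omega> v"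
    using D(2)[OF a] by simp
  show "u \<in> H01 \<Omega> \<Longrightarrow> weak_gradient \<Omega> (c *\<^sub>R u) = c *\<^sub>R weak_gradient \<Omega> u"
    using D(2)[OF s] by simp
  show "subspace (H01 \<Omega>)"
    unfolding subspace_def using D(1)[OF a] D(1)[OF s] D(1)[of 0 0] subspace_0[OF S]
    by (auto simp: zero_prod_def)
qed

text \<open>By the Poincare inequality, functions whose gradients form a Cauchy sequence form a Cauchy sequence
themselves; the limit of the pairs is in the closed graph of the gradient.\<close>

lemma complete_gradients:
  assumes "open \<Omega>" "bounded \<Omega>"
  shows "complete (weak_gradient \<Omega> ` H01 \<Omega>)"
  unfolding complete_def
proof (intro allI impI, elim conjE)
  fix g assume g: "\<forall>n. g n \<in> weak_gradient \<Omega> ` H01 \<Omega>" and Cg: "Cauchy g"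
  obtain C where C: "0 < C" "\<And>u. u \<in> H01 \<Omega> \<Longrightarrow> norm u \<le> C * norm (weak_gradient \<Omega> u)"
    using Poincare_H01[OF assms] by blast
  have "\<forall>n. \<exists>u. u \<in> H01 \<Omega> \<and> g n = weak_gradient \<Omega> u" using g by blast
  from choice[OF this] obtain u
    where u: "\<And>n. u n \<in> H01 \<Omega>" "\<And>n. g n = weak_gradient \<Omega> (u n)" by blast
  have d: "weak_gradient \<Omega> (a - b) = weak_gradient \<Omega> a - weak_gradient \<Omega> b" "a - b \<in> H01 \<Omega>"
    if "a \<in> H01 \<Omega>" "b \<in> H01 \<Omega>" for a b
    using that weak_gradient_add[OF assms(1), of a "(-1) *\<^sub>R b"] weak_gradient_scale[OF assms(1), of b "-1"]
      subspace_scale[OF subspace_H01[OF assms(1)], of b "-1"] subspace_diff[OF subspace_H01[OF assms(1)]] by auto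
  have "Cauchy u"
  proof (rule metric_CauchyI)
    fix e :: real assume e: "e > 0"
    then obtain M where M: "\<forall>m\<ge>M. \<forall>n\<ge>M. dist (g m) (g n) < e / C"
      using metric_CauchyD[OF Cg, of "e / C"] C by auto
    have "dist (u m) (u n) < e" if "m \<ge> M" "n \<ge> M" for m n
    proof -
      have "dist (u m) (u n) \<le> C * dist (g m) (g n)"
        using C(2)[OF d(2)[OF u(1) u(1)], of m n] by (simp add: dist_norm u d)
      also have "\<dots> < e" using M that C by (simp add: pos_less_divide_eq mult.commute)
      finally show ?thesis .
    qed
    then show "\<exists>M. \<forall>m\<ge>M. \<forall>n\<ge>M. dist (u m) (u n) < e" by blast
  qed
  then obtain v where v: "u \<longlonglongrightarrow> v" using Cauchy_convergent convergent_def by blast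
  obtain h where h: "g \<longlonglongrightarrow> h" using Cg Cauchy_convergent convergent_def by blast
  have lim: "(\<lambda>n. (u n, g n)) \<longlonglongrightarrow> (v, h)" using v h by (rule tendsto_Pair)
  have mem: "(u n, g n) \<in> closure (test_graph \<Omega>)" for n
    using u H01_iff_closure_test_graph[OF assms(1)] by simp
  have "(v, h) \<in> closure (test_graph \<Omega>)"
    using Lim_in_closed_set[OF closed_closure _ _ lim] mem by simp
  then show "\<exists>l\<in>weak_gradient \<Omega> ` H01 \<Omega>. g \<longlonglongrightarrow> l"
    using closure_test_graph_D[OF assms(1)] h by blast
qed

section \<open>The preconditioned operator\<close>

text \<open>The pointwise product of the matrix field \<open>K\<close>, extended by zero outside \<open>\<Omega>\<close>, with a vector field.\<close>

definition coeff_mult :: "(real^2) set \<Rightarrow> (real^2 \<Rightarrow> real^2^2) \<Rightarrow> L2^2 \<Rightarrow> L2^2" where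
  "coeff_mult \<Omega> K g = (\<chi> i. \<Sum>j\<in>UNIV. mult_L2 (\<lambda>x. indicator \<Omega> x * K x $ i $ j) (g $ j))"

definition bounded_coeff :: "(real^2) set \<Rightarrow> (real^2 \<Rightarrow> real^2^2) \<Rightarrow> real \<Rightarrow> bool" where
  "bounded_coeff \<Omega> K C \<longleftrightarrow> (\<forall>i j. (\<lambda>x. indicator \<Omega> x * K x $ i $ j) \<in> borel_measurable borel
     \<and> (\<forall>x. \<bar>indicator \<Omega> x * K x $ i $ j\<bar> \<le> C))"

lemma bounded_coeffD:
  assumes "bounded_coeff \<Omega> K C"
  shows "(\<lambda>x. indicator \<Omega> x * K x $ i $ j) \<in> borel_measurable borel"
    "\<bar>indicator \<Omega> x * K x $ i $ j\<bar> \<le> C"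
  using assms by (auto simp: bounded_coeff_def)

lemma bounded_coeff_continuous:
  assumes "\<Omega> \<in> sets borel" "bounded \<Omega>" "continuous_on (closure \<Omega>) K"
  obtains C where "bounded_coeff \<Omega> K C"
proof -
  have "bounded (K ` closure \<Omega>)"
    using assms by (intro compact_imp_bounded compact_continuous_image) auto
  then obtain C where C: "C > 0" "\<And>x. x \<in> closure \<Omega> \<Longrightarrow> norm (K x) \<le> C"
    unfolding bounded_pos by auto
  have "bounded_coeff \<Omega> K C"
    unfolding bounded_coeff_def
  proof (intro allI conjI)
    fix i j
    have "continuous_on \<Omega> (\<lambda>x. K x $ i $ j)"
      by (intro continuous_intros continuous_on_subset[OF assms(3) closure_subset])
    from borel_measurable_continuous_on_indicator[OF assms(1) this]
    show "(\<lambda>x. indicator \<Omega> x * K x $ i $ j) \<in> borel_measurable borel" by simp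
    fix x
    have "\<bar>K x $ i $ j\<bar> \<le> norm (K x)"
      using Finite_Cartesian_Product.norm_nth_le[of "K x $ i" j] Finite_Cartesian_Product.norm_nth_le[of "K x" i] by simp
    then show "\<bar>indicator \<Omega> x * K x $ i $ j\<bar> \<le> C"
      using C(1) C(2)[of x] closure_subset[of \<Omega>] by (cases "x \<in> \<Omega>") auto
  qed
  with that show thesis .
qed

lemma bounded_coeff_const: "\<Omega> \<in> sets borel \<Longrightarrow> bounded_coeff \<Omega> (\<lambda>_. A) (norm A)"
  unfolding bounded_coeff_def
proof (intro allI conjI)
  fix i j and x :: "real^2"
  have "\<bar>A $ i $ j\<bar> \<le> norm A"
    using Finite_Cartesian_Product.norm_nth_le[of "A $ i" j] Finite_Cartesian_Product.norm_nth_le[of "A" i] by simp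
  then show "\<bar>indicator \<Omega> x * A $ i $ j\<bar> \<le> norm A" by (auto simp: indicator_def)
qed auto

definition rep_field :: "L2^2 \<Rightarrow> real^2 \<Rightarrow> real^2" where
  "rep_field g x = (\<chi> i. rep_L2 (g $ i) x)"

lemma
  assumes K: "bounded_coeff \<Omega> K C"
  shows integrable_coeff_mult: "set_integrable lborel \<Omega> (\<lambda>x. (K x *v rep_field g x) \<bullet> rep_field h x)" (is ?int)
    and inner_coeff_mult: "inner (coeff_mult \<Omega> K g) h =
       (LINT x:\<Omega>|lborel. (K x *v rep_field g x) \<bullet> rep_field h x)" (is ?eq)
proof -
  let ?k = "\<lambda>i j x. indicator \<Omega> x * K x $ i $ j"
  have sq: "square_integrable (\<lambda>x. ?k i j x * rep_L2 (g $ j) x)" for i j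
    by (intro square_integrable_bounded_mult[OF bounded_coeffD[OF K]] square_integrable_rep_L2)
  have int: "integrable lborel (\<lambda>x. (?k i j x * rep_L2 (g $ j) x) * rep_L2 (h $ i) x)" for i j
    by (intro square_integrable_mult sq square_integrable_rep_L2)
  have pt: "indicator \<Omega> x *\<^sub>R ((K x *v rep_field g x) \<bullet> rep_field h x)
      = (\<Sum>i\<in>UNIV. \<Sum>j\<in>UNIV. (?k i j x * rep_L2 (g $ j) x) * rep_L2 (h $ i) x)" for x
    by (simp add: inner_vec_def rep_field_def matrix_vector_mult_def sum_distrib_left sum_distrib_right mult.assoc)
  show ?int unfolding set_integrable_def pt by (intro Bochner_Integration.integrable_sum int)
  have "inner (coeff_mult \<Omega> K g) h
      = (\<Sum>i\<in>UNIV. \<Sum>j\<in>UNIV. inner (mult_L2 (?k i j) (g $ j)) (h $ i))"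
    by (simp add: inner_vec_def coeff_mult_def inner_sum_left)
  also have "\<dots> = (\<Sum>i\<in>UNIV. \<Sum>j\<in>UNIV. LINT x|lborel. (?k i j x * rep_L2 (g $ j) x) * rep_L2 (h $ i) x)"
    using inner_abs_L2[OF sq square_integrable_rep_L2] by (simp add: mult_L2_def abs_rep_L2)
  also have "\<dots> = (LINT x:\<Omega>|lborel. (K x *v rep_field g x) \<bullet> rep_field h x)"
    unfolding set_lebesgue_integral_def pt
    by (simp only: Bochner_Integration.integral_sum Bochner_Integration.integrable_sum int)
  finally show ?eq .
qed

lemma norm_vec_le_sum: "norm (g :: 'a::real_normed_vector^2) \<le> norm (g $ 1) + norm (g $ 2)"
  using L2_set_le_sum[of UNIV "\<lambda>i. norm (g $ i)"] by (simp add: norm_vec_def sum_2)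

lemma norm_coeff_mult:
  assumes K: "bounded_coeff \<Omega> K C"
  shows "norm (coeff_mult \<Omega> K g) \<le> 4 * C * norm g"
proof -
  have C0: "0 \<le> C" using bounded_coeffD(2)[OF K, of undefined undefined undefined] by linarith
  have "norm (coeff_mult \<Omega> K g $ i) \<le> 2 * C * norm g" for i
  proof -
    have "norm (mult_L2 (\<lambda>x. indicator \<Omega> x * K x $ i $ j) (g $ j)) \<le> C * norm g" for j
      using norm_mult_L2[OF bounded_coeffD[OF K], of i j "g $ j"]
        mult_left_mono[OF Finite_Cartesian_Product.norm_nth_le[of g j] C0] by (rule order_trans)
    then have "norm (\<Sum>j\<in>UNIV. mult_L2 (\<lambda>x. indicator \<Omega> x * K x $ i $ j) (g $ j)) \<le> (\<Sum>j\<in>(UNIV::2 set). C * norm g)"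
      by (intro sum_norm_le)
    then show ?thesis by (simp add: coeff_mult_def)
  qed
  from this[of 1] this[of 2] norm_vec_le_sum[of "coeff_mult \<Omega> K g"] show ?thesis by simp
qed

lemma coeff_mult_const:
  assumes "\<Omega> \<in> sets borel" "\<And>i. g $ i \<in> L2_on \<Omega>"
  shows "coeff_mult \<Omega> (\<lambda>_. A) g = (\<chi> i. \<Sum>j\<in>UNIV. A $ i $ j *\<^sub>R g $ j)"
proof -
  have "mult_L2 (\<lambda>x. indicator \<Omega> x * c) u = c *\<^sub>R u" if u: "u \<in> L2_on \<Omega>" for c u
  proof (rule L2_eqI)
    have "AE x in lborel. rep_L2 (mult_L2 (\<lambda>x. indicator \<Omega> x * c) u) x = (indicator \<Omega> x * c) * rep_L2 u x"
      by (rule rep_mult_L2[where C = "\<bar>c\<bar>"]) (use assms(1) in \<open>auto simp: indicator_def\<close>)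
    moreover have "AE x in lborel. x \<notin> \<Omega> \<longrightarrow> rep_L2 u x = 0" using u by (simp add: L2_on_def)
    ultimately show "AE x in lborel. rep_L2 (mult_L2 (\<lambda>x. indicator \<Omega> x * c) u) x = rep_L2 (c *\<^sub>R u) x"
      using rep_L2_scale[of c u] by eventually_elim (auto simp: indicator_def)
  qed
  then show ?thesis using assms(2) by (simp add: coeff_mult_def)
qed

lemma coeff_mult_mat_1:
  assumes "\<Omega> \<in> sets borel" "\<And>i. g $ i \<in> L2_on \<Omega>"
  shows "coeff_mult \<Omega> (\<lambda>_. mat 1) g = g"
  unfolding coeff_mult_const[OF assms] by (simp add: vec_eq_iff mat_def if_distrib[of "\<lambda>c. c *\<^sub>R _"] cong: if_cong)

lemma weak_gradient_in_L2_on: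
  assumes "open \<Omega>" "u \<in> H01 \<Omega>" shows "weak_gradient \<Omega> u $ i \<in> L2_on \<Omega>"
  using assms is_weak_gradient_closure_test_graph(2)[OF assms(1)] H01_iff_closure_test_graph[OF assms(1)]
  by (auto simp: is_weak_gradient_iff)

lemma op_A_eq:
  assumes "bounded_coeff \<Omega> K C"
  shows "op_A \<Omega> K u = (\<lambda>v\<in>H01 \<Omega>. inner (coeff_mult \<Omega> K (weak_gradient \<Omega> u)) (weak_gradient \<Omega> v))"
  unfolding op_A_def inner_coeff_mult[OF assms] by (simp add: grad_def[abs_def] rep_field_def)

text \<open>\<open>op_L \<Omega>\<close> is the special case of \<open>op_A \<Omega> K\<close> where \<open>K\<close> is the identity matrix.\<close>

lemma op_L_eq:
  assumes "open \<Omega>" "u \<in> H01 \<Omega>"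
  shows "op_L \<Omega> u = (\<lambda>v\<in>H01 \<Omega>. inner (weak_gradient \<Omega> u) (weak_gradient \<Omega> v))"
proof -
  have "op_L \<Omega> u = op_A \<Omega> (\<lambda>_. mat 1) u" by (simp add: op_L_def op_A_def)
  also have "\<dots> = (\<lambda>v\<in>H01 \<Omega>. inner (coeff_mult \<Omega> (\<lambda>_. mat 1) (weak_gradient \<Omega> u)) (weak_gradient \<Omega> v))"
    using assms by (intro op_A_eq[OF bounded_coeff_const]) auto
  also have "coeff_mult \<Omega> (\<lambda>_. mat 1) (weak_gradient \<Omega> u) = weak_gradient \<Omega> u"
    using assms by (intro coeff_mult_mat_1 weak_gradient_in_L2_on) auto
  finally show ?thesis .
qed

lemma norm_L_eq:
  assumes "open \<Omega>" "u \<in> H01 \<Omega>" shows "norm_L \<Omega> u = norm (weak_gradient \<Omega> u)"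
  using assms by (simp add: norm_L_def op_L_eq norm_eq_sqrt_inner)

lemma weak_gradient_diff:
  assumes "open \<Omega>" "u \<in> H01 \<Omega>" "v \<in> H01 \<Omega>"
  shows "weak_gradient \<Omega> (u - v) = weak_gradient \<Omega> u - weak_gradient \<Omega> v"
  using assms weak_gradient_add[OF assms(1), of u "(-1) *\<^sub>R v"] weak_gradient_scale[OF assms(1), of v "-1"]
    subspace_scale[OF subspace_H01[OF assms(1)], of v "-1"] by auto

lemma inj_on_weak_gradient:
  assumes "open \<Omega>" "bounded \<Omega>" shows "inj_on (weak_gradient \<Omega>) (H01 \<Omega>)"
proof (rule inj_onI)
  fix u v assume uv: "u \<in> H01 \<Omega>" "v \<in> H01 \<Omega>" "weak_gradient \<Omega> u = weak_gradient \<Omega> v"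
  obtain C where C: "\<And>u. u \<in> H01 \<Omega> \<Longrightarrow> norm u \<le> C * norm (weak_gradient \<Omega> u)"
    using Poincare_H01[OF assms] by blast
  have "u - v \<in> H01 \<Omega>" using uv by (intro subspace_diff subspace_H01 assms)
  from C[OF this] show "u = v" using uv by (simp add: weak_gradient_diff[OF assms(1)])
qed

lemma inj_on_op_L:
  assumes "open \<Omega>" "bounded \<Omega>" shows "inj_on (op_L \<Omega>) (H01 \<Omega>)"
proof (rule inj_onI)
  fix u v assume uv: "u \<in> H01 \<Omega>" "v \<in> H01 \<Omega>" "op_L \<Omega> u = op_L \<Omega> v"
  have w: "u - v \<in> H01 \<Omega>" using uv by (intro subspace_diff subspace_H01 assms)
  have "inner (weak_gradient \<Omega> u) (weak_gradient \<Omega> (u - v)) = inner (weak_gradient \<Omega> v) (weak_gradient \<Omega> (u - v))"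
    using fun_cong[OF uv(3)[unfolded op_L_eq[OF assms(1) uv(1)] op_L_eq[OF assms(1) uv(2)]], of "u - v"] w
    by simp
  then have "inner (weak_gradient \<Omega> u - weak_gradient \<Omega> v) (weak_gradient \<Omega> u - weak_gradient \<Omega> v) = 0"
    using uv by (simp add: weak_gradient_diff[OF assms(1)] inner_diff_left)
  then show "u = v" using uv inj_on_weak_gradient[OF assms] by (auto dest: inj_onD)
qed

text \<open>The gradient of \<open>precond_op \<Omega> K u\<close> is the orthogonal projection of the field \<open>K \<nabla>u\<close> onto the space
of gradients.\<close>

lemma
  assumes \<Omega>: "open \<Omega>" "bounded \<Omega>" and K: "bounded_coeff \<Omega> K C" and u: "u \<in> H01 \<Omega>"
  shows precond_op_in_H01: "precond_op \<Omega> K u \<in> H01 \<Omega>"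
    and inner_precond_op: "v \<in> H01 \<Omega> \<Longrightarrow> inner (weak_gradient \<Omega> (precond_op \<Omega> K u)) (weak_gradient \<Omega> v)
          = inner (coeff_mult \<Omega> K (weak_gradient \<Omega> u)) (weak_gradient \<Omega> v)"
proof -
  let ?G = "weak_gradient \<Omega> ` H01 \<Omega>"
  have "subspace ?G"
    unfolding subspace_def
  proof (intro conjI ballI allI)
    note H = subspace_H01[OF \<Omega>(1)]
    show "0 \<in> ?G" using weak_gradient_scale[OF \<Omega>(1), of 0 0] subspace_0[OF H] by force
    show "x + y \<in> ?G" if "x \<in> ?G" "y \<in> ?G" for x y
      using that subspace_add[OF H] by (auto simp flip: weak_gradient_add[OF \<Omega>(1)])
    show "c *\<^sub>R x \<in> ?G" if "x \<in> ?G" for c x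
      using that subspace_scale[OF H] by (auto simp flip: weak_gradient_scale[OF \<Omega>(1)])
  qed
  from orthogonal_projection_exists[OF this complete_gradients[OF \<Omega>]]
  obtain t where t: "t \<in> H01 \<Omega>"
    and eq: "\<And>v. v \<in> H01 \<Omega> \<Longrightarrow> inner (coeff_mult \<Omega> K (weak_gradient \<Omega> u)) (weak_gradient \<Omega> v)
          = inner (weak_gradient \<Omega> t) (weak_gradient \<Omega> v)" by fast
  have "op_A \<Omega> K u = op_L \<Omega> t"
    unfolding op_A_eq[OF K] op_L_eq[OF \<Omega>(1) t] using eq by (intro restrict_ext) simp
  then have "precond_op \<Omega> K u = t"
    unfolding precond_op_def using the_inv_into_f_f[OF inj_on_op_L[OF \<Omega>] t] by simp
  with t eq show "precond_op \<Omega> K u \<in> H01 \<Omega>"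
    "v \<in> H01 \<Omega> \<Longrightarrow> inner (weak_gradient \<Omega> (precond_op \<Omega> K u)) (weak_gradient \<Omega> v)
          = inner (coeff_mult \<Omega> K (weak_gradient \<Omega> u)) (weak_gradient \<Omega> v)" by simp_all
qed

lemma coeff_mult_add:
  assumes K: "bounded_coeff \<Omega> K C"
  shows "coeff_mult \<Omega> K (g + h) = coeff_mult \<Omega> K g + coeff_mult \<Omega> K h"
  using mult_L2_add[OF bounded_coeffD[OF K]] by (simp add: coeff_mult_def vec_eq_iff sum.distrib)

lemma coeff_mult_scale:
  assumes K: "bounded_coeff \<Omega> K C"
  shows "coeff_mult \<Omega> K (c *\<^sub>R g) = c *\<^sub>R coeff_mult \<Omega> K g"
  using mult_L2_scale[OF bounded_coeffD[OF K]] by (simp add: coeff_mult_def vec_eq_iff scaleR_sum_right)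

lemma H01_eqI:
  assumes \<Omega>: "open \<Omega>" "bounded \<Omega>" and uv: "u \<in> H01 \<Omega>" "v \<in> H01 \<Omega>"
    and eq: "\<And>w. w \<in> H01 \<Omega> \<Longrightarrow> inner (weak_gradient \<Omega> u) (weak_gradient \<Omega> w) = inner (weak_gradient \<Omega> v) (weak_gradient \<Omega> w)"
  shows "u = v"
proof (rule inj_onD[OF inj_on_op_L[OF \<Omega>] _ uv])
  show "op_L \<Omega> u = op_L \<Omega> v" unfolding op_L_eq[OF \<Omega>(1) uv(1)] op_L_eq[OF \<Omega>(1) uv(2)]
    by (intro restrict_ext eq)
qed

lemma
  assumes \<Omega>: "open \<Omega>" "bounded \<Omega>" and K: "bounded_coeff \<Omega> K C" and u: "u \<in> H01 \<Omega>"
  shows precond_op_add: "v \<in> H01 \<Omega> \<Longrightarrow> precond_op \<Omega> K (u + v) = precond_op \<Omega> K u + precond_op \<Omega> K v"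
    and precond_op_scale: "precond_op \<Omega> K (c *\<^sub>R u) = c *\<^sub>R precond_op \<Omega> K u"
    and norm_precond_op: "norm (weak_gradient \<Omega> (precond_op \<Omega> K u)) \<le> 4 * C * norm (weak_gradient \<Omega> u)"
proof -
  note H = subspace_H01[OF \<Omega>(1)] and P = precond_op_in_H01[OF \<Omega> K] and I = inner_precond_op[OF \<Omega> K]
  note W = weak_gradient_add[OF \<Omega>(1)] weak_gradient_scale[OF \<Omega>(1)]
  show "precond_op \<Omega> K (u + v) = precond_op \<Omega> K u + precond_op \<Omega> K v" if v: "v \<in> H01 \<Omega>"
    using u v by (intro H01_eqI[OF \<Omega>])
      (auto simp: P I W subspace_add[OF H] inner_add_left coeff_mult_add[OF K])
  show "precond_op \<Omega> K (c *\<^sub>R u) = c *\<^sub>R precond_op \<Omega> K u"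
    using u by (intro H01_eqI[OF \<Omega>])
      (auto simp: P I W subspace_scale[OF H] coeff_mult_scale[OF K])
  let ?g = "weak_gradient \<Omega> (precond_op \<Omega> K u)"
  have "norm ?g * norm ?g = inner (coeff_mult \<Omega> K (weak_gradient \<Omega> u)) ?g"
    using I[OF u P[OF u]] by (simp add: power2_norm_eq_inner flip: power2_eq_square)
  also have "\<dots> \<le> norm (coeff_mult \<Omega> K (weak_gradient \<Omega> u)) * norm ?g" by (rule norm_cauchy_schwarz)
  finally have "norm ?g \<le> norm (coeff_mult \<Omega> K (weak_gradient \<Omega> u))"
    by (cases "norm ?g = 0") auto
  then show "norm ?g \<le> 4 * C * norm (weak_gradient \<Omega> u)"
    using norm_coeff_mult[OF K, of "weak_gradient \<Omega> u"] by linarith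
qed

lemma inner_coeff_mult_commute:
  assumes K: "bounded_coeff \<Omega> K C" and sym: "\<And>x. x \<in> \<Omega> \<Longrightarrow> transpose (K x) = K x"
    and \<Omega>: "\<Omega> \<in> sets borel"
  shows "inner (coeff_mult \<Omega> K g) h = inner g (coeff_mult \<Omega> K h)"
proof -
  have "(K x *v y) \<bullet> z = (K x *v z) \<bullet> y" if "x \<in> \<Omega>" for x y z
    using dot_lmul_matrix[of z "K x" y] sym[OF that]
    by (metis inner_commute matrix_transpose_mul dot_lmul_matrix transpose_matrix_vector)
  then show ?thesis
    unfolding inner_commute[of g] inner_coeff_mult[OF K]
    using \<Omega> by (intro set_lebesgue_integral_cong) auto
qed

lemma inner_coeff_mult_bounds:
  assumes K: "bounded_coeff \<Omega> K C" and \<Omega>: "\<Omega> \<in> sets borel" and g: "\<And>i. g $ i \<in> L2_on \<Omega>"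
  shows "(\<And>x y. x \<in> \<Omega> \<Longrightarrow> m * (norm y)\<^sup>2 \<le> (K x *v y) \<bullet> y) \<Longrightarrow> m * (norm g)\<^sup>2 \<le> inner (coeff_mult \<Omega> K g) g"
    and "(\<And>x y. x \<in> \<Omega> \<Longrightarrow> (K x *v y) \<bullet> y \<le> M * (norm y)\<^sup>2) \<Longrightarrow> inner (coeff_mult \<Omega> K g) g \<le> M * (norm g)\<^sup>2"
proof -
  have 1: "bounded_coeff \<Omega> (\<lambda>_. mat 1) (norm (mat 1 :: real^2^2))" by (rule bounded_coeff_const[OF \<Omega>])
  have ng: "c * (norm g)\<^sup>2 = (LINT x:\<Omega>|lborel. c * (norm (rep_field g x))\<^sup>2)" for c
    using inner_coeff_mult[OF 1, of g g] by (simp add: coeff_mult_mat_1[OF \<Omega> g] power2_norm_eq_inner)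
  have int: "set_integrable lborel \<Omega> (\<lambda>x. c * (norm (rep_field g x))\<^sup>2)" for c
    using integrable_coeff_mult[OF 1, of g g] by (simp add: power2_norm_eq_inner)
  show "m * (norm g)\<^sup>2 \<le> inner (coeff_mult \<Omega> K g) g"
    if "\<And>x y. x \<in> \<Omega> \<Longrightarrow> m * (norm y)\<^sup>2 \<le> (K x *v y) \<bullet> y"
    unfolding ng inner_coeff_mult[OF K] by (intro set_integral_mono int integrable_coeff_mult[OF K] that)
  show "inner (coeff_mult \<Omega> K g) g \<le> M * (norm g)\<^sup>2"
    if "\<And>x y. x \<in> \<Omega> \<Longrightarrow> (K x *v y) \<bullet> y \<le> M * (norm y)\<^sup>2"
    unfolding ng inner_coeff_mult[OF K] by (intro set_integral_mono int integrable_coeff_mult[OF K] that)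
qed

lemma spectrum_precond_op_subset:
  assumes \<Omega>: "open \<Omega>" "bounded \<Omega>" and K: "bounded_coeff \<Omega> K C"
    and sym: "\<And>x. x \<in> \<Omega> \<Longrightarrow> transpose (K x) = K x"
    and lo: "\<And>x y. x \<in> \<Omega> \<Longrightarrow> m * (norm y)\<^sup>2 \<le> (K x *v y) \<bullet> y"
    and hi: "\<And>x y. x \<in> \<Omega> \<Longrightarrow> (K x *v y) \<bullet> y \<le> M * (norm y)\<^sup>2"
  shows "spectrum (H01 \<Omega>) (norm_L \<Omega>) (precond_op \<Omega> K) \<subseteq> complex_of_real ` {m..M}"
proof
  fix z assume z: "z \<in> spectrum (H01 \<Omega>) (norm_L \<Omega>) (precond_op \<Omega> K)"
  have O: "\<Omega> \<in> sets borel" using \<Omega> by simp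
  note P = precond_op_in_H01[OF \<Omega> K] and I = inner_precond_op[OF \<Omega> K]
  have I': "inner (weak_gradient \<Omega> u) (weak_gradient \<Omega> (precond_op \<Omega> K v)) = inner (weak_gradient \<Omega> u) (coeff_mult \<Omega> K (weak_gradient \<Omega> v))"
    if "u \<in> H01 \<Omega>" "v \<in> H01 \<Omega>" for u v
    using I[OF that(2,1)] by (simp add: inner_commute)
  have "Im z = 0 \<and> m \<le> Re z \<and> Re z \<le> M"
  proof (rule ccontr)
    assume "\<not> (Im z = 0 \<and> m \<le> Re z \<and> Re z \<le> M)"
    then have "has_bounded_inverse (H01 \<Omega> \<times> H01 \<Omega>) (cplx_norm (norm_L \<Omega>))
        (\<lambda>w. cplx_scale z w - map_prod (precond_op \<Omega> K) (precond_op \<Omega> K) w)"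
    proof (rule has_bounded_inverse_outside_numerical_range[rotated -1])
      show "inner (weak_gradient \<Omega> (precond_op \<Omega> K u)) (weak_gradient \<Omega> v)
          = inner (weak_gradient \<Omega> u) (weak_gradient \<Omega> (precond_op \<Omega> K v))"
        if "u \<in> H01 \<Omega>" "v \<in> H01 \<Omega>" for u v
        using that by (simp add: I I' inner_coeff_mult_commute[OF K sym O])
      show "m * (norm (weak_gradient \<Omega> u))\<^sup>2 \<le> inner (weak_gradient \<Omega> (precond_op \<Omega> K u)) (weak_gradient \<Omega> u)"
        if "u \<in> H01 \<Omega>" for u
        using that inner_coeff_mult_bounds(1)[OF K O weak_gradient_in_L2_on[OF \<Omega>(1) that] lo] by (simp add: I)
      show "inner (weak_gradient \<Omega> (precond_op \<Omega> K u)) (weak_gradient \<Omega> u) \<le> M * (norm (weak_gradient \<Omega> u))\<^sup>2"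
        if "u \<in> H01 \<Omega>" for u
        using that inner_coeff_mult_bounds(2)[OF K O weak_gradient_in_L2_on[OF \<Omega>(1) that] hi] by (simp add: I)
    qed (use \<Omega> P in \<open>auto intro: subspace_H01 weak_gradient_add weak_gradient_scale inj_on_weak_gradient
          complete_gradients norm_L_eq precond_op_add[OF \<Omega> K] precond_op_scale[OF \<Omega> K] norm_precond_op[OF \<Omega> K]\<close>)
    with z show False by (simp add: spectrum_def)
  qed
  then show "z \<in> complex_of_real ` {m..M}" by (intro image_eqI[of _ _ "Re z"]) (auto simp: complex_eq_iff)
qed

section \<open>Approximate eigenvectors\<close>

text \<open>If \<open>l - T\<close> had an inverse bounded by \<open>C\<close>, then \<open>N u \<le> C * N (l *\<^sub>R u - T u)\<close>, which fails
for an approximate eigenvector whose relative error is less than \<open>1 / C\<close>.\<close>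

lemma in_spectrum_if_approximate_eigenvectors:
  fixes H :: "'a::real_vector set"
  assumes H: "subspace H" and T0: "T 0 = 0" and N0: "N 0 = 0"
    and nonneg: "\<And>u. u \<in> H \<Longrightarrow> 0 \<le> N u"
    and approx: "\<And>e. e > 0 \<Longrightarrow> \<exists>u\<in>H. 0 < N u \<and> N (l *\<^sub>R u - T u) \<le> e * N u"
    and TH: "\<And>u. u \<in> H \<Longrightarrow> T u \<in> H"
  shows "complex_of_real l \<in> spectrum H N T"
  unfolding spectrum_def
proof (intro CollectI notI)
  let ?S = "\<lambda>w. cplx_scale (complex_of_real l) w - map_prod T T w"
  assume "has_bounded_inverse (H \<times> H) (cplx_norm N) ?S"
  then obtain R C where R: "\<And>w. w \<in> H \<times> H \<Longrightarrow> ?S w \<in> H \<times> H \<and> R (?S w) = w"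
    and C: "\<And>w. w \<in> H \<times> H \<Longrightarrow> cplx_norm N (R w) \<le> C * cplx_norm N w"
    unfolding has_bounded_inverse_def bounded_cplx_operator_def by metis
  define e where "e = 1 / (2 * (\<bar>C\<bar> + 1))"
  have e: "e > 0" unfolding e_def by (intro divide_pos_pos mult_pos_pos) auto
  obtain u where u: "u \<in> H" "0 < N u" "N (l *\<^sub>R u - T u) \<le> e * N u" using approx[OF e] by blast
  let ?w = "(u, 0)"
  have w: "?w \<in> H \<times> H" using u subspace_0[OF H] by simp
  have Sw: "?S ?w = (l *\<^sub>R u - T u, 0)" by (simp add: cplx_scale_def T0)
  have d: "l *\<^sub>R u - T u \<in> H" using u TH by (intro subspace_diff[OF H] subspace_scale[OF H]) auto
  have "N u = cplx_norm N (R (?S ?w))" using R[OF w] nonneg u by (simp add: cplx_norm_def N0)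
  also have "\<dots> \<le> C * cplx_norm N (?S ?w)" using R[OF w] by (intro C) simp
  also have "\<dots> = C * N (l *\<^sub>R u - T u)" unfolding Sw using nonneg[OF d] by (simp add: cplx_norm_def N0)
  also have "\<dots> \<le> (\<bar>C\<bar> + 1) * (e * N u)" using u nonneg[OF d] by (intro mult_mono) auto
  also have "\<dots> = ((\<bar>C\<bar> + 1) * e) * N u" by simp
  also have "(\<bar>C\<bar> + 1) * e = 1 / 2"
    unfolding e_def using abs_ge_zero[of C] by (simp add: field_simps)
  finally show False using u by simp
qed

definition dir_deriv :: "real^2 \<Rightarrow> (real^2 \<Rightarrow> real) \<Rightarrow> real^2 \<Rightarrow> real" where
  "dir_deriv \<tau> f x = \<tau> $ 1 * partial_deriv 1 f x + \<tau> $ 2 * partial_deriv 2 f x"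

lemma test_functions_scale: "\<phi> \<in> test_functions \<Omega> \<Longrightarrow> (\<lambda>x. c * \<phi> x) \<in> test_functions \<Omega>"
  using test_functions_mult[of \<phi> \<Omega> "\<lambda>_. c"] by (simp add: smooth_const mult.commute)

lemma test_functions_dir_deriv: "\<phi> \<in> test_functions \<Omega> \<Longrightarrow> dir_deriv \<tau> \<phi> \<in> test_functions \<Omega>"
  unfolding dir_deriv_def[abs_def]
  by (intro test_functions_add test_functions_scale test_functions_partial_deriv)

lemma dir_deriv_mult_wave:
  assumes "smooth \<eta>"
  shows "dir_deriv \<tau> (\<lambda>x. \<eta> x * wave \<omega> A B x) x =
    (\<tau> \<bullet> \<omega>) * \<eta> x * wave \<omega> (- B) A x + dir_deriv \<tau> \<eta> x * wave \<omega> A B x"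
proof -
  have "smooth (wave \<omega> A B)" using mixed_symmetric_wave by (simp add: mixed_symmetric_def)
  then have p: "partial_deriv i (\<lambda>x. \<eta> x * wave \<omega> A B x) x
      = \<eta> x * wave \<omega> (- B * \<omega> $ i) (A * \<omega> $ i) x + partial_deriv i \<eta> x * wave \<omega> A B x" for i
    using assms by (simp add: partial_deriv_mult smooth_differentiable partial_deriv_wave)
  show ?thesis unfolding dir_deriv_def p by (simp add: wave_def inner_vec_def sum_2 algebra_simps)
qed

text \<open>A continuous function that vanishes almost everywhere vanishes, since nonempty open sets are not negligible.\<close>

lemma integral_square_pos:
  assumes c: "continuous_on UNIV f" and sq: "square_integrable f" and ne: "f a \<noteq> (0::real)"
  shows "0 < (LINT x|lborel. (f x)\<^sup>2)"
proof -
  have "(LINT x|lborel. (f x)\<^sup>2) \<noteq> 0"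
  proof
    assume "(LINT x|lborel. (f x)\<^sup>2) = 0"
    then have "AE x in lborel. (f x)\<^sup>2 = 0"
      using sq by (subst (asm) integral_nonneg_eq_0_iff_AE) (auto simp: square_integrable_def)
    then have "AE x in lborel. f x = 0" by simp
    moreover have [measurable]: "f \<in> borel_measurable borel" using sq by (simp add: square_integrable_def)
    ultimately have "{x. f x \<noteq> 0} \<in> null_sets lborel"
      by (subst (asm) AE_iff_null) auto
    then have "negligible {x. f x \<noteq> 0}" by (auto simp: negligible_iff_null_sets intro: null_sets_completionI)
    moreover have "open {x. f x \<noteq> 0}" by (intro open_Collect_neq c continuous_on_const)
    ultimately show False using open_not_negligible[of "{x. f x \<noteq> 0}"] ne by blast
  qed
  then show ?thesis by (simp add: order_less_le)
qed

text \<open>Modulate a fixed bump function \<open>\<eta>\<close> by \<open>sin (N * (\<theta> \<bullet> x))\<close> and by \<open>cos (N * (\<theta> \<bullet> x))\<close>.  Since \<open>\<tau>\<close> is orthogonal to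
\<open>\<theta>\<close>, the squared derivatives of the two functions in direction \<open>\<tau>\<close> add up to \<open>(\<partial>\<^sub>\<tau> \<eta>)\<^sup>2\<close>, whereas in
direction \<open>\<theta>\<close> they add up to \<open>N\<^sup>2 \<eta>\<^sup>2 + (\<partial>\<^sub>\<theta> \<eta>)\<^sup>2\<close>.  For large \<open>N\<close> at least one of the two functions
has the desired property; taking both phases avoids evaluating oscillatory integrals.\<close>

lemma wave_packet:
  assumes U: "open U" "a \<in> U" and \<theta>: "\<theta> \<bullet> \<theta> = 1" "\<tau> \<bullet> \<theta> = 0" and \<delta>: "0 < \<delta>"
  shows "\<exists>f\<in>test_functions U. mixed_symmetric f \<and>
     (LINT x|lborel. (dir_deriv \<tau> f x)\<^sup>2) < \<delta> * (LINT x|lborel. (dir_deriv \<theta> f x)\<^sup>2)"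
proof -
  obtain c d where cd: "a \<in> box c d" "box c d \<subseteq> U"
    using open_countable_Union_open_box[OF U(1)] U(2) by (metis PowD UnionE subsetD)
  obtain n where n: "n > 0" "box_bump n c d a \<noteq> 0" using box_bump_nonzero[OF cd(1)] by blast
  define \<eta> where "\<eta> = box_bump n c d"
  have \<eta>: "\<eta> \<in> test_functions U" "mixed_symmetric \<eta>" "smooth \<eta>"
    using box_bump_test_function[OF cd(2) n(1)] mixed_symmetric_box_bump by (auto simp: \<eta>_def mixed_symmetric_def)
  define A where "A = (LINT x|lborel. (dir_deriv \<tau> \<eta> x)\<^sup>2)"
  define B where "B = (LINT x|lborel. (\<eta> x)\<^sup>2)"
  have B: "B > 0" unfolding B_def
    using \<eta> n by (intro integral_square_pos[of _ a] smooth_continuous test_functions_square_integrable) (auto simp: \<eta>_def)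
  obtain k :: nat where k: "A / (\<delta> * B) < real k" using reals_Archimedean2 by blast
  \<comment> \<open>large enough for \<open>\<delta> * N\<^sup>2 * B\<close> to exceed \<open>A\<close>, since \<open>N\<^sup>2 \<ge> k\<close>\<close>
  define N where "N = real k + 1"
  have N: "A < \<delta> * (N\<^sup>2 * B)"
  proof -
    have "A < real k * (\<delta> * B)" using k B \<delta> by (simp add: pos_divide_less_eq)
    also have "\<dots> \<le> N\<^sup>2 * (\<delta> * B)"
      using B \<delta> by (intro mult_right_mono) (auto simp: N_def power2_eq_square algebra_simps)
    finally show ?thesis by (simp add: mult_ac)
  qed
  define \<phi> where "\<phi> x = \<eta> x * wave (N *\<^sub>R \<theta>) 1 0 x" for x
  define \<psi> where "\<psi> x = \<eta> x * wave (N *\<^sub>R \<theta>) 0 1 x" for x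
  have t: "\<phi> \<in> test_functions U" "\<psi> \<in> test_functions U" "mixed_symmetric \<phi>" "mixed_symmetric \<psi>"
    unfolding \<phi>_def[abs_def] \<psi>_def[abs_def]
    using mixed_symmetric_wave by (auto intro!: test_functions_mult mixed_symmetric_mult \<eta> simp: mixed_symmetric_def[of "wave _ _ _"])
  have sq: "integrable lborel (\<lambda>x. (dir_deriv \<sigma> h x)\<^sup>2)" if "h \<in> test_functions U" for \<sigma> h
    using test_functions_square_integrable[OF test_functions_dir_deriv[OF that]] by (simp add: square_integrable_def)
  note dd = dir_deriv_mult_wave[OF \<eta>(3)]
  have sc: "a\<^sup>2 * (sin y)\<^sup>2 + a\<^sup>2 * (cos y)\<^sup>2 = a\<^sup>2" for a y :: real
    by (metis distrib_left mult.right_neutral sin_cos_squared_add)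
  have "(dir_deriv \<tau> \<phi> x)\<^sup>2 + (dir_deriv \<tau> \<psi> x)\<^sup>2 = (dir_deriv \<tau> \<eta> x)\<^sup>2" for x
    unfolding \<phi>_def[abs_def] \<psi>_def[abs_def] dd using \<theta> by (simp add: wave_def power_mult_distrib sc)
  then have 1: "(LINT x|lborel. (dir_deriv \<tau> \<phi> x)\<^sup>2) + (LINT x|lborel. (dir_deriv \<tau> \<psi> x)\<^sup>2) = A"
    unfolding A_def by (subst Bochner_Integration.integral_add[symmetric]) (auto intro: sq t)
  have "(p * c + q * s)\<^sup>2 + (- (p * s) + q * c)\<^sup>2 = p\<^sup>2 + q\<^sup>2" if "s\<^sup>2 + c\<^sup>2 = 1" for p q s c :: real
    using that by algebra
  note rot = this[OF sin_cos_squared_add]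
  have "(dir_deriv \<theta> \<phi> x)\<^sup>2 + (dir_deriv \<theta> \<psi> x)\<^sup>2 = (N * \<eta> x)\<^sup>2 + (dir_deriv \<theta> \<eta> x)\<^sup>2" for x
    using rot[of "N * \<eta> x" "(N *\<^sub>R \<theta>) \<bullet> x" "dir_deriv \<theta> \<eta> x"]
    unfolding \<phi>_def[abs_def] \<psi>_def[abs_def] dd using \<theta> by (simp add: wave_def)
  then have "(LINT x|lborel. (dir_deriv \<theta> \<phi> x)\<^sup>2) + (LINT x|lborel. (dir_deriv \<theta> \<psi> x)\<^sup>2)
      = (LINT x|lborel. N\<^sup>2 * (\<eta> x)\<^sup>2 + (dir_deriv \<theta> \<eta> x)\<^sup>2)"
    by (subst Bochner_Integration.integral_add[symmetric]) (auto intro: sq t simp: power_mult_distrib)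
  also have "\<dots> = N\<^sup>2 * B + (LINT x|lborel. (dir_deriv \<theta> \<eta> x)\<^sup>2)"
    using test_functions_square_integrable[OF \<eta>(1)] sq[OF \<eta>(1)] by (simp add: B_def square_integrable_def)
  finally have 2: "(LINT x|lborel. (dir_deriv \<theta> \<phi> x)\<^sup>2) + (LINT x|lborel. (dir_deriv \<theta> \<psi> x)\<^sup>2) \<ge> N\<^sup>2 * B" by simp
  have "\<delta> * (N\<^sup>2 * B) \<le> \<delta> * (LINT x|lborel. (dir_deriv \<theta> \<phi> x)\<^sup>2) + \<delta> * (LINT x|lborel. (dir_deriv \<theta> \<psi> x)\<^sup>2)"
    using mult_left_mono[OF 2, of \<delta>] \<delta> by (simp add: distrib_left)
  with 1 N have "(LINT x|lborel. (dir_deriv \<tau> \<phi> x)\<^sup>2) < \<delta> * (LINT x|lborel. (dir_deriv \<theta> \<phi> x)\<^sup>2)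
      \<or> (LINT x|lborel. (dir_deriv \<tau> \<psi> x)\<^sup>2) < \<delta> * (LINT x|lborel. (dir_deriv \<theta> \<psi> x)\<^sup>2)" by linarith
  then show ?thesis using t by blast
qed

lemma test_functions_mono: "\<phi> \<in> test_functions U \<Longrightarrow> U \<subseteq> \<Omega> \<Longrightarrow> \<phi> \<in> test_functions \<Omega>"
  by (auto simp: test_functions_iff)

lemma test_function_in_H01:
  assumes "open \<Omega>" "\<phi> \<in> test_functions \<Omega>"
  shows "abs_L2 \<phi> \<in> H01 \<Omega>" "weak_gradient \<Omega> (abs_L2 \<phi>) = (\<chi> i. abs_L2 (partial_deriv i \<phi>))"
proof -
  have "(abs_L2 \<phi>, \<chi> i. abs_L2 (partial_deriv i \<phi>)) \<in> closure (test_graph \<Omega>)"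
    using assms(2) by (intro subsetD[OF closure_subset]) (auto simp: test_graph_def)
  from closure_test_graph_D[OF assms(1) this]
  show "abs_L2 \<phi> \<in> H01 \<Omega>" "weak_gradient \<Omega> (abs_L2 \<phi>) = (\<chi> i. abs_L2 (partial_deriv i \<phi>))" .
qed

text \<open>Both sides equal \<open>- inner v (abs_L2 (\<partial>\<^sub>i \<partial>\<^sub>j f))\<close>.\<close>

lemma inner_partial_deriv_weak_gradient_commute:
  assumes \<Omega>: "open \<Omega>" and f: "f \<in> test_functions \<Omega>" "mixed_symmetric f" and v: "v \<in> H01 \<Omega>"
  shows "inner (abs_L2 (partial_deriv i f)) (weak_gradient \<Omega> v $ j)
    = inner (abs_L2 (partial_deriv j f)) (weak_gradient \<Omega> v $ i)"
proof -
  have "is_weak_gradient \<Omega> v (weak_gradient \<Omega> v)"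
    using v H01_iff_closure_test_graph[OF \<Omega>] is_weak_gradient_closure_test_graph(2)[OF \<Omega>] by blast
  then have "inner v (abs_L2 (partial_deriv j (partial_deriv i f))) = - inner (weak_gradient \<Omega> v $ j) (abs_L2 (partial_deriv i f))" for i j
    using test_functions_partial_deriv[OF f(1)] by (auto simp: is_weak_gradient_iff)
  from this[of j i] this[of i j] f(2) show ?thesis by (simp add: mixed_symmetric_def inner_commute)
qed

text \<open>Let \<open>A\<close> be the symmetric matrix with entries \<open>k11\<close>, \<open>k12\<close>, \<open>k22\<close>, and let \<open>\<tau> = (- \<theta>2, \<theta>1)\<close>.  Then \<open>l\<close>, \<open>\<mu>\<close>,
\<open>\<nu>\<close> are the entries of \<open>A\<close> in the orthonormal basis \<open>\<theta>\<close>, \<open>\<tau>\<close>.  With \<open>a\<close>, \<open>b\<close>, \<open>d\<close> standing for the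
integrals of \<open>\<partial>\<^sub>1 u \<partial>\<^sub>1 v\<close>, \<open>\<partial>\<^sub>1 u \<partial>\<^sub>2 v = \<partial>\<^sub>2 u \<partial>\<^sub>1 v\<close> and \<open>\<partial>\<^sub>2 u \<partial>\<^sub>2 v\<close>, the left-hand
side is the integral of \<open>(A \<nabla>u - l \<nabla>u) \<bullet> \<nabla>v\<close>, and in the right-hand side the brackets
\<open>\<theta>1 * b - \<theta>2 * a\<close> and \<open>\<theta>1 * d - \<theta>2 * b\<close> are the integrals of \<open>\<partial>\<^sub>\<tau> u \<partial>\<^sub>1 v\<close> and \<open>\<partial>\<^sub>\<tau> u \<partial>\<^sub>2 v\<close>:
every term contains the derivative of \<open>u\<close> in direction \<open>\<tau>\<close>.\<close>

lemma constant_coefficient_defect: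
  fixes k11 k12 k22 \<theta>1 \<theta>2 a b d :: real
  assumes "\<theta>1\<^sup>2 + \<theta>2\<^sup>2 = 1"
    and "l = k11 * \<theta>1\<^sup>2 + 2 * k12 * \<theta>1 * \<theta>2 + k22 * \<theta>2\<^sup>2"
    and "\<mu> = k12 * (\<theta>1\<^sup>2 - \<theta>2\<^sup>2) + (k22 - k11) * \<theta>1 * \<theta>2"
    and "\<nu> = k11 * \<theta>2\<^sup>2 - 2 * k12 * \<theta>1 * \<theta>2 + k22 * \<theta>1\<^sup>2"
  shows "k11 * a + 2 * k12 * b + k22 * d - l * (a + d)
     = 2 * \<mu> * (\<theta>1 * (\<theta>1 * b - \<theta>2 * a) + \<theta>2 * (\<theta>1 * d - \<theta>2 * b))
       + (\<nu> - l) * (\<theta>1 * (\<theta>1 * d - \<theta>2 * b) - \<theta>2 * (\<theta>1 * b - \<theta>2 * a))"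
  using assms by algebra

text \<open>Coefficients matter only where the field does not vanish.\<close>

lemma coeff_mult_add_coeff:
  assumes K: "bounded_coeff \<Omega> K C" and A: "bounded_coeff \<Omega> A C'" and B: "bounded_coeff \<Omega> B C''"
    and g: "\<And>i. g $ i \<in> L2_on U" and eq: "\<And>x. x \<in> U \<Longrightarrow> K x = A x + B x"
  shows "coeff_mult \<Omega> K g = coeff_mult \<Omega> A g + coeff_mult \<Omega> B g"
proof -
  let ?m = "\<lambda>K i j. mult_L2 (\<lambda>x. indicator \<Omega> x * K x $ i $ j) (g $ j)"
  have "?m K i j = ?m A i j + ?m B i j" for i j
  proof (rule L2_eqI)
    have "AE x in lborel. x \<notin> U \<longrightarrow> rep_L2 (g $ j) x = 0" using g by (simp add: L2_on_def)
    then show "AE x in lborel. rep_L2 (?m K i j) x = rep_L2 (?m A i j + ?m B i j) x"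
      using rep_mult_L2[OF bounded_coeffD[OF K], of i j "g $ j"]
        rep_mult_L2[OF bounded_coeffD[OF A], of i j "g $ j"] rep_mult_L2[OF bounded_coeffD[OF B], of i j "g $ j"]
        rep_L2_add[of "?m A i j" "?m B i j"]
    proof eventually_elim
      case (elim x)
      then show ?case using eq[of x] by (cases "x \<in> U") (auto simp: distrib_left distrib_right)
    qed
  qed
  then show ?thesis by (simp add: coeff_mult_def vec_eq_iff sum.distrib)
qed

text \<open>Take for \<open>u\<close> a wave packet in direction \<open>\<theta>\<close> supported so close to \<open>x0\<close> that there \<open>K\<close> differs from \<open>K x0\<close> by
at most \<open>\<epsilon>\<close>.  The defect \<open>w = l *\<^sub>R u - precond_op \<Omega> K u\<close> is tested against itself: the perturbation
\<open>K - K x0\<close> contributes at most \<open>4 * \<epsilon>\<close>, and the constant coefficient \<open>K x0\<close> contributes only terms with the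
derivative of \<open>u\<close> orthogonal to \<open>\<theta>\<close>.\<close>

lemma approximate_eigenvector:
  assumes \<Omega>: "open \<Omega>" "bounded \<Omega>" and cont: "continuous_on (closure \<Omega>) K"
    and x0: "x0 \<in> closure \<Omega>" and sym: "transpose (K x0) = K x0"
    and \<theta>: "norm \<theta> = 1" and e: "0 < e"
  defines "l \<equiv> (K x0 *v \<theta>) \<bullet> \<theta>"
  shows "\<exists>u\<in>H01 \<Omega>. 0 < norm_L \<Omega> u \<and> norm_L \<Omega> (l *\<^sub>R u - precond_op \<Omega> K u) \<le> e * norm_L \<Omega> u"
proof -
  have O: "\<Omega> \<in> sets borel" using \<Omega> by simp
  obtain C where K: "bounded_coeff \<Omega> K C" using bounded_coeff_continuous[OF O \<Omega>(2) cont] by blast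
  define \<epsilon> where "\<epsilon> = e / 8"
  have \<epsilon>: "\<epsilon> > 0" using e by (simp add: \<epsilon>_def)
  obtain r where r: "r > 0" "\<And>x. x \<in> closure \<Omega> \<Longrightarrow> dist x x0 < r \<Longrightarrow> dist (K x) (K x0) < \<epsilon>"
    using cont[unfolded continuous_on_iff] x0 \<epsilon> by blast
  define U where "U = \<Omega> \<inter> ball x0 r"
  obtain a0 where "a0 \<in> \<Omega>" "dist a0 x0 < r" using x0 r(1) unfolding closure_approachable by blast
  then have U: "open U" "a0 \<in> U" "U \<subseteq> \<Omega>" using \<Omega> by (auto simp: U_def dist_commute)
  define \<theta>1 \<theta>2 where "\<theta>1 = \<theta> $ 1" and "\<theta>2 = \<theta> $ 2"
  define \<tau> :: "real^2" where "\<tau> = vector [- \<theta>2, \<theta>1]"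
  have \<tau>: "\<tau> $ 1 = - \<theta>2" "\<tau> $ 2 = \<theta>1" by (simp_all add: \<tau>_def)
  have \<theta>\<theta>: "\<theta> \<bullet> \<theta> = 1" using \<theta> by (simp add: norm_eq_1)
  then have unit: "\<theta>1\<^sup>2 + \<theta>2\<^sup>2 = 1" by (simp add: inner_vec_def sum_2 \<theta>1_def \<theta>2_def power2_eq_square)
  have \<tau>\<theta>: "\<tau> \<bullet> \<theta> = 0" by (simp add: inner_vec_def sum_2 \<tau> \<theta>1_def \<theta>2_def)
  have \<theta>le: "\<bar>\<theta>1\<bar> \<le> 1" "\<bar>\<theta>2\<bar> \<le> 1"
    using \<theta> component_le_norm_cart[of \<theta>] by (simp_all add: \<theta>1_def \<theta>2_def)
  define k11 k12 k22 where "k11 = K x0 $ 1 $ 1" and "k12 = K x0 $ 1 $ 2" and "k22 = K x0 $ 2 $ 2"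
  have k21: "K x0 $ 2 $ 1 = k12" unfolding k12_def using sym by (simp add: transpose_def vec_eq_iff)
  have l: "l = k11 * \<theta>1\<^sup>2 + 2 * k12 * \<theta>1 * \<theta>2 + k22 * \<theta>2\<^sup>2"
    unfolding l_def inner_vec_def matrix_vector_mult_def
    by (simp add: sum_2 k21 flip: k11_def k12_def k22_def \<theta>1_def \<theta>2_def) (simp add: algebra_simps power2_eq_square)
  define \<mu> where "\<mu> = k12 * (\<theta>1\<^sup>2 - \<theta>2\<^sup>2) + (k22 - k11) * \<theta>1 * \<theta>2"
  define \<nu> where "\<nu> = k11 * \<theta>2\<^sup>2 - 2 * k12 * \<theta>1 * \<theta>2 + k22 * \<theta>1\<^sup>2"
  define D where "D = 2 * \<bar>\<mu>\<bar> + \<bar>\<nu> - l\<bar>"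
  have D: "0 \<le> D" by (simp add: D_def)
  \<comment> \<open>with this bound on the ratio of the derivatives, and with \<open>4 * \<epsilon> = e / 2\<close>, both parts of the error are at most \<open>e / 2\<close>\<close>
  define \<delta> where "\<delta> = e / (4 * (D + 1))"
  have \<delta>: "\<delta> > 0" "2 * D * \<delta> \<le> e / 2" using e D by (auto simp: \<delta>_def field_simps)
  obtain f where f: "f \<in> test_functions U" "mixed_symmetric f"
    and small: "(LINT x|lborel. (dir_deriv \<tau> f x)\<^sup>2) < \<delta>\<^sup>2 * (LINT x|lborel. (dir_deriv \<theta> f x)\<^sup>2)"
    using wave_packet[OF U(1,2) \<theta>\<theta> \<tau>\<theta>, of "\<delta>\<^sup>2"] \<delta>(1) by auto
  have fO: "f \<in> test_functions \<Omega>" using f(1) U(3) by (rule test_functions_mono)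
  define u where "u = abs_L2 f"
  define g where "g = weak_gradient \<Omega> u"
  have u: "u \<in> H01 \<Omega>" and g: "g = (\<chi> i. abs_L2 (partial_deriv i f))"
    using test_function_in_H01[OF \<Omega>(1) fO] by (simp_all add: u_def g_def)
  have pd: "partial_deriv i f \<in> test_functions U" for i by (rule test_functions_partial_deriv[OF f(1)])
  have sqd: "square_integrable (partial_deriv i f)" for i by (rule test_functions_square_integrable[OF pd])
  have dir: "abs_L2 (dir_deriv \<sigma> f) = \<sigma> $ 1 *\<^sub>R g $ 1 + \<sigma> $ 2 *\<^sub>R g $ 2" for \<sigma>
    unfolding dir_deriv_def[abs_def] g
    by (simp add: abs_L2_add abs_L2_scale sqd square_integrable_scale)
  have normdir: "(norm (\<sigma> $ 1 *\<^sub>R g $ 1 + \<sigma> $ 2 *\<^sub>R g $ 2))\<^sup>2 = (LINT x|lborel. (dir_deriv \<sigma> f x)\<^sup>2)" for \<sigma>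
    using inner_abs_L2[of "dir_deriv \<sigma> f" "dir_deriv \<sigma> f"]
      test_functions_square_integrable[OF test_functions_dir_deriv[OF f(1)]]
    by (simp add: power2_norm_eq_inner power2_eq_square[of "dir_deriv _ _ _"] flip: dir)
  \<comment> \<open>the derivative of \<open>f\<close> in direction \<open>\<tau>\<close>\<close>
  define G where "G = \<theta>1 *\<^sub>R g $ 2 - \<theta>2 *\<^sub>R g $ 1"
  have small': "(norm G)\<^sup>2 < \<delta>\<^sup>2 * (norm (\<theta>1 *\<^sub>R g $ 1 + \<theta>2 *\<^sub>R g $ 2))\<^sup>2"
    using small normdir[of \<tau>] normdir[of \<theta>] by (simp add: G_def \<tau> \<theta>1_def \<theta>2_def algebra_simps)
  have "(norm (\<theta>1 *\<^sub>R g $ 1 + \<theta>2 *\<^sub>R g $ 2))\<^sup>2 + (norm G)\<^sup>2 = (\<theta>1\<^sup>2 + \<theta>2\<^sup>2) * ((norm (g $ 1))\<^sup>2 + (norm (g $ 2))\<^sup>2)"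
    unfolding G_def power2_norm_eq_inner
    by (simp add: inner_add_left inner_add_right inner_diff_left inner_diff_right inner_commute
        power2_eq_square algebra_simps)
  also have "(norm (g $ 1))\<^sup>2 + (norm (g $ 2))\<^sup>2 = (norm g)\<^sup>2"
    by (simp add: power2_norm_eq_inner inner_vec_def sum_2)
  finally have "(norm (\<theta>1 *\<^sub>R g $ 1 + \<theta>2 *\<^sub>R g $ 2))\<^sup>2 \<le> (norm g)\<^sup>2"
    unfolding unit using zero_le_power2[of "norm G"] by linarith
  then have G2: "(norm G)\<^sup>2 < \<delta>\<^sup>2 * (norm g)\<^sup>2"
    using small' by (meson less_le_trans mult_left_mono zero_le_power2)
  then have "(norm G)\<^sup>2 \<le> (\<delta> * norm g)\<^sup>2" by (simp add: power_mult_distrib)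
  then have Gle: "norm G \<le> \<delta> * norm g" by (rule power2_le_imp_le) (use \<delta> in simp)
  have gpos: "0 < norm g" using G2 by (cases "g = 0") auto
  \<comment> \<open>the deviation from the constant coefficient on the support of \<open>f\<close>\<close>
  define E where "E x = (if x \<in> U then K x - K x0 else 0)" for x
  have E: "bounded_coeff \<Omega> E \<epsilon>"
    unfolding bounded_coeff_def
  proof (intro allI conjI)
    fix i j
    have "continuous_on U (\<lambda>x. K x $ i $ j - K x0 $ i $ j)"
      using U(3) closure_subset[of \<Omega>] by (intro continuous_intros continuous_on_subset[OF cont]) auto
    from borel_measurable_continuous_on_indicator[OF _ this] U(1)
    have "(\<lambda>x. indicator U x * (K x $ i $ j - K x0 $ i $ j)) \<in> borel_measurable borel" by simp
    also have "(\<lambda>x. indicator U x * (K x $ i $ j - K x0 $ i $ j)) = (\<lambda>x. indicator \<Omega> x * E x $ i $ j)"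
      using U(3) by (intro ext) (auto simp: E_def indicator_def)
    finally show "(\<lambda>x. indicator \<Omega> x * E x $ i $ j) \<in> borel_measurable borel" .
    fix x
    have "\<bar>E x $ i $ j\<bar> \<le> norm (E x)"
      using Finite_Cartesian_Product.norm_nth_le[of "E x $ i" j] Finite_Cartesian_Product.norm_nth_le[of "E x" i] by simp
    also have "norm (E x) \<le> \<epsilon>"
      using r(2)[of x] closure_subset[of \<Omega>] \<epsilon> by (auto simp: E_def U_def dist_norm norm_minus_commute)
    finally show "\<bar>indicator \<Omega> x * E x $ i $ j\<bar> \<le> \<epsilon>" using \<epsilon> by (auto simp: indicator_def)
  qed
  have gU: "g $ i \<in> L2_on U" and gO: "g $ i \<in> L2_on \<Omega>" for i
    using test_function_in_L2_on[OF pd] test_function_in_L2_on[OF test_functions_mono[OF pd U(3)]] by (simp_all add: g)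
  have split: "coeff_mult \<Omega> K g = coeff_mult \<Omega> E g + coeff_mult \<Omega> (\<lambda>_. K x0) g"
    by (rule coeff_mult_add_coeff[OF K E bounded_coeff_const[OF O] gU]) (simp add: E_def)
  define w where "w = l *\<^sub>R u - precond_op \<Omega> K u"
  define h where "h = weak_gradient \<Omega> w"
  have T: "precond_op \<Omega> K u \<in> H01 \<Omega>" by (rule precond_op_in_H01[OF \<Omega> K u])
  have lu: "l *\<^sub>R u \<in> H01 \<Omega>" using u by (rule subspace_scale[OF subspace_H01[OF \<Omega>(1)]])
  have w: "w \<in> H01 \<Omega>" unfolding w_def using lu T by (rule subspace_diff[OF subspace_H01[OF \<Omega>(1)]])
  have h: "h = l *\<^sub>R g - weak_gradient \<Omega> (precond_op \<Omega> K u)"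
    unfolding h_def w_def g_def by (simp add: weak_gradient_diff[OF \<Omega>(1) lu T] weak_gradient_scale[OF \<Omega>(1) u])
  define a b d where "a = inner (g $ 1) (h $ 1)" and "b = inner (g $ 1) (h $ 2)" and "d = inner (g $ 2) (h $ 2)"
  have b': "inner (g $ 2) (h $ 1) = b"
    using inner_partial_deriv_weak_gradient_commute[OF \<Omega>(1) fO f(2) w, of 2 1] by (simp add: b_def g h_def)
  define p q where "p = inner G (h $ 1)" and "q = inner G (h $ 2)"
  have p: "p = \<theta>1 * b - \<theta>2 * a" and q: "q = \<theta>1 * d - \<theta>2 * b"
    by (simp_all add: p_def q_def G_def inner_diff_left b' a_def b_def d_def)
  have "inner (coeff_mult \<Omega> (\<lambda>_. K x0) g) h - l * inner g h
      = k11 * a + 2 * k12 * b + k22 * d - l * (a + d)"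
    unfolding coeff_mult_const[OF O gO]
    by (simp add: inner_vec_def sum_2 inner_add_left k21 b' flip: k11_def k12_def k22_def a_def b_def d_def)
  also have "\<dots> = 2 * \<mu> * (\<theta>1 * p + \<theta>2 * q) + (\<nu> - l) * (\<theta>1 * q - \<theta>2 * p)"
    unfolding p q by (rule constant_coefficient_defect[OF unit l \<mu>_def \<nu>_def])
  finally have const: "inner (coeff_mult \<Omega> (\<lambda>_. K x0) g) h - l * inner g h
      = 2 * \<mu> * (\<theta>1 * p + \<theta>2 * q) + (\<nu> - l) * (\<theta>1 * q - \<theta>2 * p)" .
  define P where "P = norm G * norm h"
  have "\<bar>p\<bar> \<le> P" "\<bar>q\<bar> \<le> P"
    unfolding p_def q_def P_def
    by (rule order_trans[OF Cauchy_Schwarz_ineq2]; intro mult_left_mono Finite_Cartesian_Product.norm_nth_le; simp)+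
  then have pq: "\<bar>\<theta>i * p\<bar> \<le> P" "\<bar>\<theta>i * q\<bar> \<le> P" if "\<bar>\<theta>i\<bar> \<le> 1" for \<theta>i
    using that mult_mono[of "\<bar>\<theta>i\<bar>" 1 "\<bar>p\<bar>" P] mult_mono[of "\<bar>\<theta>i\<bar>" 1 "\<bar>q\<bar>" P] by (auto simp: abs_mult)
  have "\<bar>2 * \<mu> * (\<theta>1 * p + \<theta>2 * q) + (\<nu> - l) * (\<theta>1 * q - \<theta>2 * p)\<bar>
      \<le> (2 * \<bar>\<mu>\<bar>) * \<bar>\<theta>1 * p + \<theta>2 * q\<bar> + \<bar>\<nu> - l\<bar> * \<bar>\<theta>1 * q - \<theta>2 * p\<bar>"
    using abs_triangle_ineq[of "2 * \<mu> * (\<theta>1 * p + \<theta>2 * q)" "(\<nu> - l) * (\<theta>1 * q - \<theta>2 * p)"] by (simp add: abs_mult)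
  also have "\<dots> \<le> (2 * \<bar>\<mu>\<bar>) * (2 * P) + \<bar>\<nu> - l\<bar> * (2 * P)"
    using pq[OF \<theta>le(1)] pq[OF \<theta>le(2)] by (intro add_mono mult_left_mono) auto
  also have "\<dots> = 2 * D * P" by (simp add: D_def algebra_simps)
  also have "\<dots> \<le> 2 * D * (\<delta> * norm g * norm h)"
    unfolding P_def using Gle D by (intro mult_left_mono mult_right_mono) auto
  also have "\<dots> = (2 * D * \<delta>) * (norm g * norm h)" by simp
  also have "\<dots> \<le> (e / 2) * (norm g * norm h)" using \<delta>(2) by (intro mult_right_mono) auto
  finally have bound1: "\<bar>inner (coeff_mult \<Omega> (\<lambda>_. K x0) g) h - l * inner g h\<bar> \<le> (e / 2) * (norm g * norm h)"
    unfolding const .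
  have "\<bar>inner (coeff_mult \<Omega> E g) h\<bar> \<le> norm (coeff_mult \<Omega> E g) * norm h" by (rule Cauchy_Schwarz_ineq2)
  also have "\<dots> \<le> (4 * \<epsilon> * norm g) * norm h" by (intro mult_right_mono norm_coeff_mult[OF E]) simp
  finally have bound2: "\<bar>inner (coeff_mult \<Omega> E g) h\<bar> \<le> (e / 2) * (norm g * norm h)" by (simp add: \<epsilon>_def)
  have "norm h * norm h = inner h h" by (simp add: power2_norm_eq_inner flip: power2_eq_square)
  also have "\<dots> = l * inner g h - inner (coeff_mult \<Omega> K g) h"
    using inner_precond_op[OF \<Omega> K u w] unfolding h[THEN arg_cong[of _ _ "\<lambda>y. inner y h"]]
    by (simp add: inner_diff_left flip: g_def h_def)
  also have "\<dots> = - inner (coeff_mult \<Omega> E g) h - (inner (coeff_mult \<Omega> (\<lambda>_. K x0) g) h - l * inner g h)"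
    by (simp add: split inner_add_left)
  also have "\<dots> \<le> (e / 2) * (norm g * norm h) + (e / 2) * (norm g * norm h)" using bound1 bound2 by linarith
  also have "\<dots> = (e * norm g) * norm h" by simp
  finally have "norm h \<le> e * norm g"
    using e by (cases "h = 0") (auto dest: mult_right_le_imp_le)
  moreover have "norm_L \<Omega> u = norm g" "norm_L \<Omega> w = norm h"
    using norm_L_eq[OF \<Omega>(1) u] norm_L_eq[OF \<Omega>(1) w] by (simp_all add: g_def h_def)
  ultimately have "0 < norm_L \<Omega> u \<and> norm_L \<Omega> w \<le> e * norm_L \<Omega> u" using gpos by simp
  with u show ?thesis unfolding w_def by (rule bexI[rotated])
qed

section \<open>The spectrum\<close>

lemma in_spectrum_precond_op:
  assumes \<Omega>: "open \<Omega>" "bounded \<Omega>" and cont: "continuous_on (closure \<Omega>) K"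
    and x0: "x0 \<in> closure \<Omega>" and sym: "transpose (K x0) = K x0" and \<theta>: "norm \<theta> = 1"
  shows "complex_of_real ((K x0 *v \<theta>) \<bullet> \<theta>) \<in> spectrum (H01 \<Omega>) (norm_L \<Omega>) (precond_op \<Omega> K)"
proof -
  obtain C where K: "bounded_coeff \<Omega> K C"
    using bounded_coeff_continuous[OF borel_open[OF \<Omega>(1)] \<Omega>(2) cont] by blast
  note H = subspace_H01[OF \<Omega>(1)]
  have 0: "0 \<in> H01 \<Omega>" by (rule subspace_0[OF H])
  show ?thesis
  proof (rule in_spectrum_if_approximate_eigenvectors[OF H])
    show "precond_op \<Omega> K 0 = 0" using precond_op_scale[OF \<Omega> K 0, of 0] by simp
    show "norm_L \<Omega> 0 = 0" using weak_gradient_scale[OF \<Omega>(1) 0, of 0] by (simp add: norm_L_eq[OF \<Omega>(1) 0])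
    show "0 \<le> norm_L \<Omega> u" if "u \<in> H01 \<Omega>" for u using that by (simp add: norm_L_eq[OF \<Omega>(1)])
    show "precond_op \<Omega> K u \<in> H01 \<Omega>" if "u \<in> H01 \<Omega>" for u using that by (rule precond_op_in_H01[OF \<Omega> K])
    show "\<exists>u\<in>H01 \<Omega>. 0 < norm_L \<Omega> u \<and>
        norm_L \<Omega> (((K x0 *v \<theta>) \<bullet> \<theta>) *\<^sub>R u - precond_op \<Omega> K u) \<le> e * norm_L \<Omega> u" if "e > 0" for e
      using approximate_eigenvector[OF \<Omega> cont x0 sym \<theta> that] .
  qed
qed

text \<open>\<open>c y\<close> are the coordinates of \<open>y\<close> in the orthonormal basis formed by the columns of \<open>Q\<close>.\<close>

lemma quadratic_form_diagonalization:
  fixes A Q L :: "real^2^2"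
  assumes A: "A = Q ** L ** transpose Q" and Q: "Q ** transpose Q = mat 1 \<and> transpose Q ** Q = mat 1"
    and L: "L = vector [vector [a, 0], vector [0, b]]"
  defines "c \<equiv> \<lambda>y. transpose Q *v y"
  shows "(A *v y) \<bullet> y = a * (c y $ 1)\<^sup>2 + b * (c y $ 2)\<^sup>2"
    and "(c y $ 1)\<^sup>2 + (c y $ 2)\<^sup>2 = (norm y)\<^sup>2"
    and "c (Q *v z) = z" and "norm (Q *v z) = norm z"
proof -
  have adj: "(Q *v w) \<bullet> v = w \<bullet> (transpose Q *v v)" for w v
    by (metis dot_lmul_matrix inner_commute transpose_matrix_vector)
  have "(A *v y) \<bullet> y = (L *v c y) \<bullet> c y"
    unfolding A c_def by (simp add: adj flip: matrix_vector_mul_assoc)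
  also have "\<dots> = a * (c y $ 1)\<^sup>2 + b * (c y $ 2)\<^sup>2"
    by (simp add: L inner_vec_def matrix_vector_mult_def sum_2 power2_eq_square)
  finally show "(A *v y) \<bullet> y = a * (c y $ 1)\<^sup>2 + b * (c y $ 2)\<^sup>2" .
  have "(c y $ 1)\<^sup>2 + (c y $ 2)\<^sup>2 = c y \<bullet> c y" by (simp add: inner_vec_def sum_2 power2_eq_square)
  also have "\<dots> = (Q *v c y) \<bullet> y" by (simp add: adj c_def)
  also have "Q *v c y = y" using Q by (simp add: c_def matrix_vector_mul_assoc del: transpose_matrix_vector)
  finally show "(c y $ 1)\<^sup>2 + (c y $ 2)\<^sup>2 = (norm y)\<^sup>2" by (simp add: power2_norm_eq_inner)
  show cz: "c (Q *v z) = z" using Q by (simp add: c_def matrix_vector_mul_assoc del: transpose_matrix_vector)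
  have "(Q *v z) \<bullet> (Q *v z) = z \<bullet> z" using cz by (simp add: adj c_def)
  then show "norm (Q *v z) = norm z" by (simp add: norm_eq_sqrt_inner)
qed

lemma numerical_range_interval:
  fixes K :: "real^2 \<Rightarrow> real^2^2"
  assumes "compact X" "connected X" "X \<noteq> {}" "continuous_on X K"
  obtains a b where "a \<le> b" "{(K x *v \<theta>) \<bullet> \<theta> | x \<theta>. x \<in> X \<and> norm \<theta> = 1} = {a..b}"
proof -
  let ?F = "\<lambda>p. (K (fst p) *v snd p) \<bullet> snd p"
  let ?D = "X \<times> sphere (0::real^2) 1"
  have "continuous_on ?D (\<lambda>p. K (fst p))"
    by (rule continuous_on_compose2[OF assms(4)]) (auto intro: continuous_intros)
  then have c: "continuous_on ?D ?F"
    unfolding inner_vec_def matrix_vector_mult_def by (auto intro!: continuous_intros)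
  have "connected (sphere (0::real^2) 1)" by (rule connected_sphere) simp
  then have "connected (?F ` ?D)"
    using assms by (intro connected_continuous_image[OF c] connected_Times)
  moreover have "compact (?F ` ?D)"
    using assms by (intro compact_continuous_image[OF c] compact_Times) auto
  ultimately obtain a b where ab: "?F ` ?D = {a..b}"
    using connected_compact_interval_1[of "?F ` ?D"] by blast
  have "?F ` ?D \<noteq> {}" using assms(3) by (simp add: sphere_eq_empty)
  then have "a \<le> b" unfolding ab by simp
  moreover have "?F ` ?D = {(K x *v \<theta>) \<bullet> \<theta> | x \<theta>. x \<in> X \<and> norm \<theta> = 1}" by force
  ultimately show thesis using that ab by simp
qed

theorem theorem1p1:
  fixes \<Omega> :: "(real^2) set"
    and K Q \<Lambda> :: "real^2 \<Rightarrow> real^2^2"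
    and \<kappa>\<^sub>1 \<kappa>\<^sub>2 :: "real^2 \<Rightarrow> real"
  assumes "lipschitz_domain \<Omega>" and "bounded \<Omega>"
    and "\<And>x. x \<in> closure \<Omega> \<Longrightarrow> transpose (K x) = K x"
    and "continuous_on (closure \<Omega>) K"
    and "\<And>x. x \<in> closure \<Omega> \<Longrightarrow> K x = Q x ** \<Lambda> x ** transpose (Q x)"
    and "\<And>x. x \<in> closure \<Omega> \<Longrightarrow> Q x ** transpose (Q x) = mat 1 \<and> transpose (Q x) ** Q x = mat 1"
    and "\<And>x. x \<in> closure \<Omega> \<Longrightarrow> \<Lambda> x = vector [vector [\<kappa>\<^sub>1 x, 0], vector [0, \<kappa>\<^sub>2 x]]"
  shows "spectrum (H01 \<Omega>) (norm_L \<Omega>) (precond_op \<Omega> K) =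
           complex_of_real ` (convex hull (\<kappa>\<^sub>1 ` closure \<Omega> \<union> \<kappa>\<^sub>2 ` closure \<Omega>))
       \<and> convex hull (\<kappa>\<^sub>1 ` closure \<Omega> \<union> \<kappa>\<^sub>2 ` closure \<Omega>) =
           {(INF x\<in>closure \<Omega>. min (\<kappa>\<^sub>1 x) (\<kappa>\<^sub>2 x)) .. (SUP x\<in>closure \<Omega>. max (\<kappa>\<^sub>1 x) (\<kappa>\<^sub>2 x))}"
proof -
  have \<Omega>: "open \<Omega>" "connected \<Omega>" "\<Omega> \<noteq> {}" using assms(1) by (auto simp: lipschitz_domain_def)
  let ?X = "closure \<Omega>" and ?S = "\<kappa>\<^sub>1 ` closure \<Omega> \<union> \<kappa>\<^sub>2 ` closure \<Omega>"
  note diag = quadratic_form_diagonalization[OF assms(5) assms(6) assms(7)]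
  define c where "c x y = transpose (Q x) *v y" for x and y :: "real^2"
  have form: "(K x *v y) \<bullet> y = \<kappa>\<^sub>1 x * (c x y $ 1)\<^sup>2 + \<kappa>\<^sub>2 x * (c x y $ 2)\<^sup>2"
    and pyth: "(c x y $ 1)\<^sup>2 + (c x y $ 2)\<^sup>2 = (norm y)\<^sup>2" if "x \<in> ?X" for x y
    using diag(1,2)[OF that that that] by (simp_all add: c_def)
  have "connected ?X" using \<Omega>(2) by (rule connected_imp_connected_closure)
  moreover have "compact ?X" using assms(2) by simp
  moreover have "?X \<noteq> {}" using \<Omega>(3) by simp
  ultimately obtain a b where ab: "a \<le> b"
    and range: "{(K x *v \<theta>) \<bullet> \<theta> | x \<theta>. x \<in> ?X \<and> norm \<theta> = 1} = {a..b}"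
    using numerical_range_interval[OF _ _ _ assms(4)] by blast
  have \<kappa>_in: "\<kappa>\<^sub>1 x \<in> {a..b}" "\<kappa>\<^sub>2 x \<in> {a..b}" if x: "x \<in> ?X" for x
  proof -
    have n: "norm (Q x *v axis i 1) = 1" "c x (Q x *v axis i 1) = axis i 1" for i
      using diag(3,4)[OF x x x] by (simp_all add: c_def norm_axis_1)
    have "(K x *v (Q x *v axis i 1)) \<bullet> (Q x *v axis i 1) \<in> {a..b}"
      "(K x *v (Q x *v axis i 1)) \<bullet> (Q x *v axis i 1) = \<kappa>\<^sub>1 x * (axis i 1 $ 1)\<^sup>2 + \<kappa>\<^sub>2 x * (axis i 1 $ 2)\<^sup>2" for i
      using x n(1) form[OF x, of "Q x *v axis i 1"] unfolding range[symmetric] n(2) by blast+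
    from this[of 1] this[of 2] show "\<kappa>\<^sub>1 x \<in> {a..b}" "\<kappa>\<^sub>2 x \<in> {a..b}" by (simp_all add: axis_def)
  qed
  have between: "min (\<kappa>\<^sub>1 x) (\<kappa>\<^sub>2 x) * (norm y)\<^sup>2 \<le> (K x *v y) \<bullet> y"
    "(K x *v y) \<bullet> y \<le> max (\<kappa>\<^sub>1 x) (\<kappa>\<^sub>2 x) * (norm y)\<^sup>2" if x: "x \<in> ?X" for x y
    unfolding form[OF x] pyth[OF x, symmetric] distrib_left
    by (intro add_mono mult_right_mono; simp)+
  have hull: "convex hull ?S = {a..b}"
  proof
    show "convex hull ?S \<subseteq> {a..b}" using \<kappa>_in by (intro hull_minimal) auto
    show "{a..b} \<subseteq> convex hull ?S"
    proof
      fix t assume "t \<in> {a..b}"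
      then obtain x \<theta> where x: "x \<in> ?X" and \<theta>: "norm \<theta> = 1" and t: "t = (K x *v \<theta>) \<bullet> \<theta>"
        unfolding range[symmetric] by blast
      have "(c x \<theta> $ 1)\<^sup>2 *\<^sub>R \<kappa>\<^sub>1 x + (c x \<theta> $ 2)\<^sup>2 *\<^sub>R \<kappa>\<^sub>2 x \<in> convex hull ?S"
        using x pyth[OF x, of \<theta>] \<theta> by (intro convexD convex_convex_hull hull_inc) auto
      then show "t \<in> convex hull ?S" by (simp add: t form[OF x] mult.commute)
    qed
  qed
  have "(INF x\<in>?X. min (\<kappa>\<^sub>1 x) (\<kappa>\<^sub>2 x)) = a"
  proof (rule cInf_eq_minimum)
    have "a \<in> {a..b}" using ab by simp
    then obtain x \<theta> where x: "x \<in> ?X" "norm \<theta> = 1" "a = (K x *v \<theta>) \<bullet> \<theta>"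
      unfolding range[symmetric] by blast
    then have "min (\<kappa>\<^sub>1 x) (\<kappa>\<^sub>2 x) = a" using between(1)[OF x(1), of \<theta>] \<kappa>_in[OF x(1)] by auto
    then show "a \<in> (\<lambda>x. min (\<kappa>\<^sub>1 x) (\<kappa>\<^sub>2 x)) ` ?X" using x(1) by blast
  qed (use \<kappa>_in in auto)
  moreover have "(SUP x\<in>?X. max (\<kappa>\<^sub>1 x) (\<kappa>\<^sub>2 x)) = b"
  proof (rule cSup_eq_maximum)
    have "b \<in> {a..b}" using ab by simp
    then obtain x \<theta> where x: "x \<in> ?X" "norm \<theta> = 1" "b = (K x *v \<theta>) \<bullet> \<theta>"
      unfolding range[symmetric] by blast
    then have "max (\<kappa>\<^sub>1 x) (\<kappa>\<^sub>2 x) = b" using between(2)[OF x(1), of \<theta>] \<kappa>_in[OF x(1)] by auto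
    then show "b \<in> (\<lambda>x. max (\<kappa>\<^sub>1 x) (\<kappa>\<^sub>2 x)) ` ?X" using x(1) by blast
  qed (use \<kappa>_in in auto)
  moreover have "spectrum (H01 \<Omega>) (norm_L \<Omega>) (precond_op \<Omega> K) = complex_of_real ` {a..b}"
  proof
    obtain C where K: "bounded_coeff \<Omega> K C"
      using bounded_coeff_continuous[OF borel_open[OF \<Omega>(1)] assms(2) assms(4)] by blast
    show "spectrum (H01 \<Omega>) (norm_L \<Omega>) (precond_op \<Omega> K) \<subseteq> complex_of_real ` {a..b}"
    proof (rule spectrum_precond_op_subset[OF \<Omega>(1) assms(2) K])
      fix x y :: "real^2" assume "x \<in> \<Omega>"
      then have x: "x \<in> ?X" using closure_subset by blast
      have "a * (norm y)\<^sup>2 \<le> min (\<kappa>\<^sub>1 x) (\<kappa>\<^sub>2 x) * (norm y)\<^sup>2"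
        "max (\<kappa>\<^sub>1 x) (\<kappa>\<^sub>2 x) * (norm y)\<^sup>2 \<le> b * (norm y)\<^sup>2"
        using \<kappa>_in[OF x] by (intro mult_right_mono; simp)+
      with between[OF x, of y] show "a * (norm y)\<^sup>2 \<le> (K x *v y) \<bullet> y" "(K x *v y) \<bullet> y \<le> b * (norm y)\<^sup>2"
        by linarith+
    qed (use assms(3) closure_subset in blast)
    show "complex_of_real ` {a..b} \<subseteq> spectrum (H01 \<Omega>) (norm_L \<Omega>) (precond_op \<Omega> K)"
      unfolding range[symmetric]
      using in_spectrum_precond_op[OF \<Omega>(1) assms(2) assms(4)] assms(3) by auto
  qed
  ultimately show ?thesis unfolding hull by simp
qed

end
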